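(* Let $d=2m+1$ with $m\in\mathbb Z_{\ge 0}$, and let $\mathcal C_d$, $V_d$, $a_d=\frac{1}{2V_d\mathcal C_d}$, the zeros $0<\tau_1<\tau_2<\ldots$ of the radial extremal function $\varphi_d$, and $\Phi(z)=\prod_{k=1}^{\infty}\bigl(1+(-1)^k\frac{z}{\tau_k}\bigr)$ be as defined in the context. Then the following hold. (a) There exists an even polynomial $Q_d$ such that, with $R_d(z)=a_d+z^2Q_d(z)$, the quadratic functional identity $$z^{d+1}\bigl(\Phi'(z)\Phi(-z)+\Phi'(-z)\Phi(z)\bigr)-2R_d(z)\Phi(z)\Phi(-z)=-2a_d$$ holds for all $z\in\mathbb C$. Moreover, $Q_1=0$, and $\deg Q_d\le d-3$ for $d\ge 3$. (b) With $R_d$ the polynomial from part (a), there exists an even polynomial $K_d$ such that $\Phi$ satisfies, for all $z\in\mathbb C$, the linear differential equation $$z^{d+1}\Phi''(z)+\bigl((d+1)z^d-2R_d(z)\bigr)\Phi'(z)+\bigl(K_d(z)-R_d'(z)\bigr)\Phi(z)=0.$$ The polynomial $K_d$ has degree $d+1$ and leading coefficient $1/4$. (c) The function $\Phi$ has exact exponential type $1/2$, and, for real $x$, $$\Phi(x)=O\bigl(|x|^{-(d+1)/2}\bigr),\quad |x|\to\infty.$$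
   Context: For $r>0$, $1\le p\le\infty$ and $d\ge1$, $PW_r^p(\mathbb R^d)$ denotes the Paley--Wiener class of functions in $L^p(\mathbb R^d)$ that are restrictions to $\mathbb R^d$ of entire functions on $\mathbb C^d$ of spherical exponential type at most $r$ (that is, for every $\varepsilon>0$ there is $A_\varepsilon$ with $|f(z)|\le A_\varepsilon e^{(r+\varepsilon)|z|}$, $z\in\mathbb C^d$, where $|z|^2=\sum_j|z_j|^2$). The sharp Nikolskii constant $\mathcal C_d$ is defined by $$\mathcal C_d^{-1}=\inf\{\|f\|_{L^1(\mathbb R^d)}\colon f\in PW_1^1(\mathbb R^d),\ f(0)=1\}.$$ It is known that this problem has a unique radial extremal function $x\mapsto\varphi_d(|x|)\in PW_1^1(\mathbb R^d)$ (so $\varphi_d(0)=1$ and $\|\varphi_d(|\cdot|)\|_{L^1(\mathbb R^d)}=\mathcal C_d^{-1}$), where $\varphi_d$ is an even real entire function of one complex variable which can be written as $$\varphi_d(z)=\prod_{k=1}^\infty\Bigl(1-\frac{z^2}{\tau_k^2}\Bigr),\quad z\in\mathbb C,$$ where $0<\tau_1<\tau_2<\ldots$ are the positive zeros of $\varphi_d$ (all zeros of $\varphi_d$ are real and simple), and $\tau_k\sim\pi k$ as $k\to\infty$. $V_d$ is the volume of the unit ball of $\mathbb R^d$, and $$a_d=\frac{1}{2V_d\mathcal C_d}.$$ The function $\Phi$ is defined by $$\Phi(z)=\prod_{k=1}^{\infty}\Bigl(1+(-1)^k\frac{z}{\tau_k}\Bigr),$$ the product being the limit of its partial products in the natural order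 of $k$; it is an entire function of finite exponential type, and $\varphi_d(z)=\Phi(z)\Phi(-z)$. The notation $\Phi'(-z)$ means the derivative $\Phi'$ evaluated at $-z$. *)

theory Defs
  imports
    "HOL-Analysis.Analysis"
    "HOL-Complex_Analysis.Complex_Analysis"
    "HOL-Computational_Algebra.Polynomial"
    "HOL-Library.Landau_Symbols"
begin

text \<open>
  Entire functions on the space of \<open>n\<close>-tuples of complex numbers: at every point the (real)
  Frechet derivative exists and is complex-linear.
\<close>

definition entire_vec :: "(complex ^ 'n::finite \<Rightarrow> complex) \<Rightarrow> bool" where
  "entire_vec F \<longleftrightarrow>
     (\<forall>z. \<exists>D. (F has_derivative D) (at z) \<and> (\<forall>c v. D (c *s v) = c * D v))"

text \<open>
  On \<^typ>\<open>complex ^ 'n\<close> the library norm is the Euclidean one, so this is the spherical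
  exponential type; on \<^typ>\<open>complex\<close> it is the usual one-variable notion.
\<close>

definition exp_type_at_most :: "('a::real_normed_vector \<Rightarrow> complex) \<Rightarrow> real \<Rightarrow> bool" where
  "exp_type_at_most F r \<longleftrightarrow>
     (\<forall>\<epsilon>>0. \<exists>A. \<forall>z. norm (F z) \<le> A * exp ((r + \<epsilon>) * norm z))"

definition has_exact_exp_type :: "(complex \<Rightarrow> complex) \<Rightarrow> real \<Rightarrow> bool" where
  "has_exact_exp_type F r \<longleftrightarrow>
     F holomorphic_on UNIV \<and> exp_type_at_most F r \<and> (\<forall>s<r. \<not> exp_type_at_most F s)"

definition cvec :: "real ^ 'n \<Rightarrow> complex ^ 'n" where
  "cvec x = (\<chi> i. complex_of_real (x $ i))"

text \<open>The Paley--Wiener class with integrability exponent \<open>p = 1\<close>.\<close>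

definition PW1 :: "real \<Rightarrow> (real ^ 'n::finite \<Rightarrow> complex) set" where
  "PW1 r = {f. integrable lborel f \<and>
     (\<exists>F. entire_vec F \<and> exp_type_at_most F r \<and> (\<forall>x. f x = F (cvec x)))}"

definition L1_norm :: "(real ^ 'n::finite \<Rightarrow> complex) \<Rightarrow> real" where
  "L1_norm f = (LINT x|lborel. norm (f x))"

text \<open>The dimension is carried by a type argument.\<close>

definition nikolskii_const :: "'n::finite itself \<Rightarrow> real" where
  "nikolskii_const _ =
     inverse (Inf {L1_norm f | f :: real ^ 'n \<Rightarrow> complex. f \<in> PW1 1 \<and> f 0 = 1})"

definition unit_ball_volume :: "'n::finite itself \<Rightarrow> real" where
  "unit_ball_volume _ = measure lborel (ball (0 :: real ^ 'n) 1)"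

definition a_const :: "'n::finite itself \<Rightarrow> real" where
  "a_const T = 1 / (2 * unit_ball_volume T * nikolskii_const T)"

definition radial_lift :: "(complex \<Rightarrow> complex) \<Rightarrow> real ^ 'n::finite \<Rightarrow> complex" where
  "radial_lift \<phi> x = \<phi> (complex_of_real (norm x))"

definition radial_extremal :: "'n::finite itself \<Rightarrow> (complex \<Rightarrow> complex) \<Rightarrow> bool" where
  "radial_extremal T \<phi> \<longleftrightarrow>
     \<phi> holomorphic_on UNIV \<and> (\<forall>z. \<phi> (- z) = \<phi> z) \<and> (\<forall>x\<in>\<real>. \<phi> x \<in> \<real>) \<and>
     \<phi> 0 = 1 \<and>
     (radial_lift \<phi> :: real ^ 'n \<Rightarrow> complex) \<in> PW1 1 \<and>
     L1_norm (radial_lift \<phi> :: real ^ 'n \<Rightarrow> complex) = inverse (nikolskii_const T)"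

text \<open>
  The limit is taken along partial products in the natural order; the product is in general not
  absolutely convergent. Indices start at \<open>1\<close>, so \<open>\<tau> 0\<close> is irrelevant.
\<close>

definition Phi :: "(nat \<Rightarrow> real) \<Rightarrow> complex \<Rightarrow> complex" where
  "Phi \<tau> z = lim (\<lambda>n. \<Prod>k=1..n. 1 + (-1) ^ k * (z / complex_of_real (\<tau> k)))"

definition even_poly :: "complex poly \<Rightarrow> bool" where
  "even_poly p \<longleftrightarrow> (\<forall>z. poly p (- z) = poly p z)"

end

theory Submission
  imports Defs "HOL-Real_Asymp.Real_Asymp"
begin

text \<open>
  The first-order condition at the extremal function says that
  \<open>\<integral> f(x) sgn \<phi>(x) x\<^sup>(\<^sup>d\<^sup>-\<^sup>1\<^sup>) dx\<close> over the half-line equals \<open>(2 a / d) f(0)\<close> for all even \<open>f\<close> of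
  exponential type at most 1 that are integrable against the weight. Since \<open>d\<close> is odd, inserting
  \<open>f = d h + z h'\<close> turns this into the quadrature formula \<open>\<Sum> (-1)\<^sup>(\<^sup>k\<^sup>+\<^sup>1\<^sup>) \<tau>\<^sub>k\<^sup>d h(\<tau>\<^sub>k) = a h(0)\<close>.
  Taking \<open>h = \<phi> / (z\<^sup>2 - \<tau>\<^sub>j\<^sup>2)\<close> gives \<open>\<tau>\<^sub>j\<^sup>(\<^sup>d\<^sup>+\<^sup>1\<^sup>) \<phi>'(\<tau>\<^sub>j) = 2 a (-1)\<^sup>j\<close>, so that
  \<open>z\<^sup>(\<^sup>d\<^sup>+\<^sup>1\<^sup>) (\<Phi>'(z) \<Phi>(-z) + \<Phi>'(-z) \<Phi>(z)) + 2 a\<close> is divisible by \<open>\<phi>\<close>. Comparing \<open>\<phi>\<close> with a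
  function \<open>\<psi>\<close> of known size in the same formula shows that \<open>1 / \<phi>\<close>, and hence the quotient, grows
  polynomially away from the real line; so the quotient is a polynomial, and the asymptotics of
  \<open>\<Phi>' / \<Phi>\<close> on the imaginary axis determine its degree. Differentiating the identity, and using that \<open>\<Phi>(z)\<close>
  and \<open>\<Phi>(-z)\<close> have no common zeros, gives the differential equation, and an energy estimate for
  \<open>z\<^sup>(\<^sup>d\<^sup>+\<^sup>1\<^sup>)\<^sup>/\<^sup>2 \<Phi>(z)\<close> along rays gives the growth of \<open>\<Phi>\<close>.
\<close>

subsection \<open>Entire functions of polynomial growth off the real axis\<close>

text \<open>The asymptotics \<tau>_k ~ pi k determine \<phi> and \<Phi> only up to factors
  exp(o(|z|)), too coarse for polynomial bounds, so finer estimates have to come from extremality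
  itself. The comparison function \<psi> serves this end: a combination of \<phi> and \<psi>
  vanishing at a given nonreal w is divided by its zero and inserted into the quadrature formula,
  where the nodes see only \<psi> scaled by \<phi>(w). The resulting bound, like the one for
  \<Phi>'/\<Phi>, degenerates at the real axis; growth is therefore measured in |z| and 1/|Im z|
  together, and entire functions with such bounds are still polynomials. The alternating signs in
  \<Phi> mirror those of \<phi>' at successive zeros: placing the zeros alternately on both
  half-lines turns the alternating values into one constant. The test function d h + z h' contains a
  derivative, whereas extremality speaks of functions in the mean; a Bernstein inequality in L^1
  bridges the gap. The type 1/2 and the coefficient 1/4 have one origin: \<Phi>'/\<Phi> tends to
  -i/2 along the positive imaginary axis.\<close>

lemma entire_divide_linear:
  fixes f :: "complex \<Rightarrow> complex"
  assumes "f holomorphic_on UNIV" "f w = 0"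
  obtains q where "q holomorphic_on UNIV" "\<And>z. f z = (z - w) * q z"
proof
  let ?q = "\<lambda>z. if z = w then deriv f w else (f z - f w) / (z - w)"
  show "?q holomorphic_on UNIV"
    using assms by (intro pole_lemma) auto
  show "f z = (z - w) * ?q z" for z
    using assms by simp
qed

text \<open>The zeros to be cancelled in later identities all lie on the real axis, so those
  identities are first obtained by division off the axis; approaching a real point vertically
  carries them over.\<close>

lemma eq_if_eq_off_real:
  fixes f g :: "complex \<Rightarrow> complex"
  assumes "continuous_on UNIV f" "continuous_on UNIV g" "\<And>z. Im z \<noteq> 0 \<Longrightarrow> f z = g z"
  shows "f z = g z"
proof -
  define e :: "nat \<Rightarrow> real" where "e = (\<lambda>n. if Im z = 0 then 1 / (real n + 1) else 0)"
  define s where "s = (\<lambda>n. z + \<i> * of_real (e n))"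
  have "(\<lambda>n. 1 / (real n + 1)) \<longlonglongrightarrow> 0"
    using LIMSEQ_inverse_real_of_nat by (simp add: inverse_eq_divide add.commute)
  then have "e \<longlonglongrightarrow> 0"
    by (cases "Im z = 0") (auto simp: e_def)
  then have "(\<lambda>n. z + \<i> * of_real (e n)) \<longlonglongrightarrow> z + \<i> * of_real 0"
    by (intro tendsto_intros)
  then have s: "s \<longlonglongrightarrow> z"
    by (simp add: s_def)
  have "f (s n) = g (s n)" for n
    by (rule assms(3)) (auto simp: s_def e_def)
  moreover have "(\<lambda>n. f (s n)) \<longlonglongrightarrow> f z" "(\<lambda>n. g (s n)) \<longlonglongrightarrow> g z"
    using assms(1,2) s by (auto simp: continuous_on_eq_continuous_at isCont_tendsto_compose)
  ultimately show ?thesis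
    using LIMSEQ_unique by auto
qed

text \<open>By evenness -w is a second zero, distinct from w because w \<noteq> 0, so two linear
  factors split off. Evenness of the cofactor follows by cancelling z^2 - w^2 away from w and -w,
  and by continuity at these two points.\<close>

lemma even_entire_divide_quadratic:
  fixes f :: "complex \<Rightarrow> complex"
  assumes f: "f holomorphic_on UNIV" and even: "\<And>z. f (- z) = f z" and "f w = 0" "w \<noteq> 0"
  obtains h where "h holomorphic_on UNIV" "\<And>z. h (- z) = h z" "\<And>z. f z = (z\<^sup>2 - w\<^sup>2) * h z"
proof -
  obtain q where q: "q holomorphic_on UNIV" "\<And>z. f z = (z - w) * q z"
    using entire_divide_linear assms by metis
  have "q (- w) = 0"
    using q(2)[of "- w"] even[of w] assms by simp
  then obtain h where h: "h holomorphic_on UNIV" "\<And>z. q z = (z - (- w)) * h z"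
    using entire_divide_linear q(1) by metis
  have fh: "f z = (z\<^sup>2 - w\<^sup>2) * h z" for z
    using q(2) h(2) by (simp add: power2_eq_square algebra_simps)
  have "h (- z) = h z" for z
  proof -
    have ch: "continuous_on UNIV h"
      using h(1) holomorphic_on_imp_continuous_on by blast
    have ch': "continuous_on UNIV (\<lambda>z. h (- z))"
      by (rule continuous_on_compose2[OF ch]) (auto intro: continuous_intros)
    have off: "h (- z) = h z" if "z \<noteq> w" "z \<noteq> - w" for z
    proof -
      have "f z = (z\<^sup>2 - w\<^sup>2) * h (- z)"
        using fh[of "- z"] unfolding even power2_minus .
      then have "(z\<^sup>2 - w\<^sup>2) * h (- z) = (z\<^sup>2 - w\<^sup>2) * h z"
        using fh[of z] by (rule trans[OF sym])
      moreover have "z\<^sup>2 - w\<^sup>2 \<noteq> 0"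
        using that by (auto simp: power2_eq_iff)
      ultimately show ?thesis by (metis mult_left_cancel)
    qed
    have "\<forall>\<^sub>F u in at z. h (- u) = h u"
    proof -
      have "\<forall>\<^sub>F u in at z. u \<noteq> w" "\<forall>\<^sub>F u in at z. u \<noteq> - w"
        by (simp_all add: eventually_neq_at_within)
      then show ?thesis
        by eventually_elim (use off in auto)
    qed
    moreover have "(h \<longlongrightarrow> h z) (at z)" "((\<lambda>z. h (- z)) \<longlongrightarrow> h (- z)) (at z)"
      using ch ch' by (auto simp: continuous_on_def)
    ultimately show ?thesis
      using tendsto_unique[OF at_neq_bot] tendsto_cong[of "\<lambda>z. h (- z)" h "at z"] by blast
  qed
  then show ?thesis using that h(1) fh by blast
qed

text \<open>After removing the common factor at a zero z of g, the denominator takes the value g'(z)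
  \<noteq> 0 there, so the singularity is removable. Both the quotient producing R and the one
  producing K arise this way.\<close>

lemma entire_quotient_simple_zeros:
  fixes f g :: "complex \<Rightarrow> complex"
  assumes f: "f holomorphic_on UNIV" and g: "g holomorphic_on UNIV"
    and zero: "\<And>z. g z = 0 \<Longrightarrow> f z = 0 \<and> deriv g z \<noteq> 0"
  obtains q where "q holomorphic_on UNIV" "\<And>z. f z = q z * g z"
proof
  let ?q = "\<lambda>z. if g z = 0 then deriv f z / deriv g z else f z / g z"
  show "f z = ?q z * g z" for z
    using zero by auto
  have "?q field_differentiable (at z)" for z
  proof (cases "g z = 0")
    case False
    have op: "open {u. g u \<noteq> 0}"
      using g holomorphic_on_imp_continuous_on open_Collect_neq[of g "\<lambda>_. 0"] by fastforce
    have "(\<lambda>u. f u / g u) holomorphic_on {u. g u \<noteq> 0}"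
      using f g by (intro holomorphic_on_divide) (auto intro: holomorphic_on_subset)
    then have "?q holomorphic_on {u. g u \<noteq> 0}"
      by (rule holomorphic_transform) auto
    then show ?thesis
      using False op holomorphic_on_imp_differentiable_at by (metis (mono_tags, lifting) mem_Collect_eq)
  next
    case True
    obtain f1 where f1: "f1 holomorphic_on UNIV" "\<And>u. f u = (u - z) * f1 u"
      using entire_divide_linear[of f z] f zero[OF True] by metis
    obtain g1 where g1: "g1 holomorphic_on UNIV" "\<And>u. g u = (u - z) * g1 u"
      using entire_divide_linear[of g z] g True by metis
    \<comment> \<open>The cofactor of \<open>u - z\<close> takes the value of the derivative at z,
      so \<open>f1 / g1\<close> agrees with \<open>?q\<close> also at z itself.\<close>
    have der: "deriv k z = k1 z" if "k1 holomorphic_on UNIV" "\<And>u. k u = (u - z) * k1 u"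
      for k k1 :: "complex \<Rightarrow> complex"
    proof -
      have "(k1 has_field_derivative deriv k1 z) (at z)"
        using that(1) by (simp add: holomorphic_derivI)
      then have "((\<lambda>u. (u - z) * k1 u) has_field_derivative k1 z) (at z)"
        by (auto intro!: derivative_eq_intros)
      moreover have "k = (\<lambda>u. (u - z) * k1 u)"
        using that(2) by auto
      ultimately show ?thesis
        by (simp add: DERIV_imp_deriv)
    qed
    have g1z: "g1 z \<noteq> 0"
      using zero[OF True] der[OF g1] by simp
    have op: "open {u. g1 u \<noteq> 0}"
      using g1(1) holomorphic_on_imp_continuous_on open_Collect_neq[of g1 "\<lambda>_. 0"] by fastforce
    have "(\<lambda>u. f1 u / g1 u) holomorphic_on {u. g1 u \<noteq> 0}"
      using f1(1) g1(1) by (intro holomorphic_on_divide) (auto intro: holomorphic_on_subset)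
    moreover have "f1 u / g1 u = ?q u" if "u \<in> {u. g1 u \<noteq> 0}" for u
    proof (cases "u = z")
      case True
      then show ?thesis
        using der[OF f1] der[OF g1] \<open>g z = 0\<close> by simp
    next
      case False
      then show ?thesis
        using f1(2) g1(2) that by simp
    qed
    ultimately have "?q holomorphic_on {u. g1 u \<noteq> 0}"
      by (rule holomorphic_transform)
    then show ?thesis
      using g1z op holomorphic_on_imp_differentiable_at by (metis (mono_tags, lifting) mem_Collect_eq)
  qed
  then show "?q holomorphic_on UNIV"
    by (simp add: holomorphic_on_def)
qed

text \<open>The weight is at least 1 and dominates |z|, 1/|Im z| and |z|/|Im z|, so one exponent
  records all three kinds of growth and the class is closed under sums and products. Nothing is
  required on the real axis, which leaves room for real poles such as those of
  \<Phi>'/\<Phi>.\<close>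

definition tame :: "(complex \<Rightarrow> complex) \<Rightarrow> bool" where
  "tame f \<longleftrightarrow> (\<exists>C p. \<forall>z. Im z \<noteq> 0 \<longrightarrow> norm (f z) \<le> C * ((1 + norm z) * (1 + 1 / \<bar>Im z\<bar>)) ^ p)"

lemma tame_weight_ge:
  assumes "Im z \<noteq> 0"
  shows "1 \<le> (1 + norm z) * (1 + 1 / \<bar>Im z\<bar>)" "norm z \<le> (1 + norm z) * (1 + 1 / \<bar>Im z\<bar>)"
    "1 / \<bar>Im z\<bar> \<le> (1 + norm z) * (1 + 1 / \<bar>Im z\<bar>)"
    "norm z / \<bar>Im z\<bar> \<le> (1 + norm z) * (1 + 1 / \<bar>Im z\<bar>)"
  using assms by (auto simp: field_simps)

lemma tame_bound_mono:
  assumes "norm (f :: complex) \<le> C * w ^ p" "(1::real) \<le> w" "p \<le> p'" "C \<le> C'" "0 \<le> C'"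
  shows "norm f \<le> C' * w ^ p'"
proof -
  have "C * w ^ p \<le> C' * w ^ p'"
    using assms by (intro mult_mono power_increasing) auto
  then show ?thesis using assms by linarith
qed

lemma tame_nonneg:
  assumes "tame f"
  obtains C p where "C \<ge> 0" "\<And>z. Im z \<noteq> 0 \<Longrightarrow> norm (f z) \<le> C * ((1 + norm z) * (1 + 1 / \<bar>Im z\<bar>)) ^ p"
proof -
  obtain C p where *: "\<And>z. Im z \<noteq> 0 \<Longrightarrow> norm (f z) \<le> C * ((1 + norm z) * (1 + 1 / \<bar>Im z\<bar>)) ^ p"
    using assms unfolding tame_def by blast
  have "norm (f z) \<le> max C 0 * ((1 + norm z) * (1 + 1 / \<bar>Im z\<bar>)) ^ p" if "Im z \<noteq> 0" for z
    by (rule tame_bound_mono[OF *[OF that] tame_weight_ge(1)[OF that]]) auto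
  then show ?thesis
    using that[of "max C 0" p] by simp
qed

lemma tame_add:
  assumes "tame f" "tame g"
  shows "tame (\<lambda>z. f z + g z)"
proof -
  obtain C p where f: "C \<ge> 0" "\<And>z. Im z \<noteq> 0 \<Longrightarrow> norm (f z) \<le> C * ((1 + norm z) * (1 + 1 / \<bar>Im z\<bar>)) ^ p"
    by (rule tame_nonneg[OF assms(1)], rule that)
  obtain D q where g: "D \<ge> 0" "\<And>z. Im z \<noteq> 0 \<Longrightarrow> norm (g z) \<le> D * ((1 + norm z) * (1 + 1 / \<bar>Im z\<bar>)) ^ q"
    by (rule tame_nonneg[OF assms(2)], rule that)
  have "norm (f z + g z) \<le> (C + D) * ((1 + norm z) * (1 + 1 / \<bar>Im z\<bar>)) ^ (p + q)" if z: "Im z \<noteq> 0" for z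
  proof -
    have "norm (f z) \<le> C * ((1 + norm z) * (1 + 1 / \<bar>Im z\<bar>)) ^ (p + q)"
      using f(1) by (intro tame_bound_mono[OF f(2)[OF z] tame_weight_ge(1)[OF z]]) auto
    moreover have "norm (g z) \<le> D * ((1 + norm z) * (1 + 1 / \<bar>Im z\<bar>)) ^ (p + q)"
      using g(1) by (intro tame_bound_mono[OF g(2)[OF z] tame_weight_ge(1)[OF z]]) auto
    ultimately show ?thesis
      using norm_triangle_ineq[of "f z" "g z"] by (simp add: distrib_right)
  qed
  then show ?thesis unfolding tame_def by blast
qed

lemma tame_mult:
  assumes "tame f" "tame g"
  shows "tame (\<lambda>z. f z * g z)"
proof -
  obtain C p where f: "C \<ge> 0" "\<And>z. Im z \<noteq> 0 \<Longrightarrow> norm (f z) \<le> C * ((1 + norm z) * (1 + 1 / \<bar>Im z\<bar>)) ^ p"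
    by (rule tame_nonneg[OF assms(1)], rule that)
  obtain D q where g: "D \<ge> 0" "\<And>z. Im z \<noteq> 0 \<Longrightarrow> norm (g z) \<le> D * ((1 + norm z) * (1 + 1 / \<bar>Im z\<bar>)) ^ q"
    by (rule tame_nonneg[OF assms(2)], rule that)
  have "norm (f z * g z) \<le> (C * D) * ((1 + norm z) * (1 + 1 / \<bar>Im z\<bar>)) ^ (p + q)" if z: "Im z \<noteq> 0" for z
    using mult_mono[OF f(2)[OF z] g(2)[OF z]] f(1) g(1)
    by (simp add: norm_mult power_add mult_ac)
  then show ?thesis unfolding tame_def by blast
qed

lemma tame_const: "tame (\<lambda>_. c)"
  unfolding tame_def by (rule exI[of _ "norm c"], rule exI[of _ 0]) simp

lemma tame_ident: "tame (\<lambda>z. z)"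
  unfolding tame_def by (rule exI[of _ 1], rule exI[of _ 1]) (use tame_weight_ge in auto)

lemma tame_power: "tame f \<Longrightarrow> tame (\<lambda>z. f z ^ n)"
  by (induction n) (auto intro: tame_const tame_mult)

lemma tame_minus: "tame f \<Longrightarrow> tame (\<lambda>z. - f z)"
  unfolding tame_def by simp

lemma tame_diff: "tame f \<Longrightarrow> tame g \<Longrightarrow> tame (\<lambda>z. f z - g z)"
  using tame_add[of f "\<lambda>z. - g z"] tame_minus[of g] by simp

lemma tame_reflect: "tame f \<Longrightarrow> tame (\<lambda>z. f (- z))"
proof -
  assume "tame f"
  then obtain C p where *: "\<And>z. Im z \<noteq> 0 \<Longrightarrow> norm (f z) \<le> C * ((1 + norm z) * (1 + 1 / \<bar>Im z\<bar>)) ^ p"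
    unfolding tame_def by blast
  have "norm (f (- z)) \<le> C * ((1 + norm z) * (1 + 1 / \<bar>Im z\<bar>)) ^ p" if "Im z \<noteq> 0" for z
    using *[of "- z"] that by simp
  then show ?thesis
    unfolding tame_def by blast
qed

lemma tame_poly: "tame (poly p)"
proof (induction p)
  case 0
  then show ?case by (simp add: tame_const)
next
  case (pCons a p)
  then have "tame (\<lambda>z. a + z * poly p z)"
    by (intro tame_add tame_mult tame_const tame_ident)
  then show ?case by (simp add: poly_pCons[abs_def] cong: if_cong)
qed

lemma tame_cong: "(\<And>z. Im z \<noteq> 0 \<Longrightarrow> f z = g z) \<Longrightarrow> tame f = tame g"
  unfolding tame_def by (intro ex_cong1 all_cong1) auto

text \<open>
  On the circle of radius 2 about a real point \<open>x\<close> one has \<open>|(z - x)\<^sup>2 - 4| = 4 |Im z|\<close>, so multiplying by a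
  power of \<open>(z - x)\<^sup>2 - 4\<close> removes the blow-up at the real axis and the maximum principle applies.
\<close>

lemma entire_tame_bound:
  assumes F: "F holomorphic_on UNIV" and "tame F"
  obtains C p where "\<And>z. norm (F z) \<le> C * (4 + norm z) ^ p"
proof -
  obtain C p0 where C: "C \<ge> 0" and
    b0: "\<And>z. Im z \<noteq> 0 \<Longrightarrow> norm (F z) \<le> C * ((1 + norm z) * (1 + 1 / \<bar>Im z\<bar>)) ^ p0"
    by (rule tame_nonneg[OF assms(2)], rule that)
  \<comment> \<open>A positive exponent makes the factor vanish at the two real points of the
    circle, where no bound for \<open>F\<close> is available.\<close>
  define p where "p = Suc p0"
  have b: "norm (F z) \<le> C * ((1 + norm z) * (1 + 1 / \<bar>Im z\<bar>)) ^ p" if "Im z \<noteq> 0" for z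
    using C by (intro tame_bound_mono[OF b0[OF that] tame_weight_ge(1)[OF that]]) (auto simp: p_def)
  have "norm (F z) \<le> C * 12 ^ p * (4 + norm z) ^ p" for z
  proof (cases "\<bar>Im z\<bar> \<ge> 1")
    case True
    have "(1 + norm z) * (1 + 1 / \<bar>Im z\<bar>) \<le> (4 + norm z) * 12"
      using True by (intro mult_mono) (auto simp: field_simps)
    then have "C * ((1 + norm z) * (1 + 1 / \<bar>Im z\<bar>)) ^ p \<le> C * ((4 + norm z) * 12) ^ p"
      using C by (intro mult_left_mono power_mono) auto
    also have "\<dots> = C * 12 ^ p * (4 + norm z) ^ p"
      by (simp only: power_mult_distrib mult_ac)
    finally show ?thesis
      using b[of z] True by force
  next
    case False
    define x where "x = complex_of_real (Re z)"
    define G where "G = (\<lambda>u. F u * ((u - x)\<^sup>2 - 4) ^ p)"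
    have G: "G holomorphic_on UNIV"
      unfolding G_def by (intro holomorphic_intros F)
    have zx: "z - x = \<i> * of_real (Im z)"
      by (simp add: x_def complex_eq_iff)
    have "norm (G z) \<le> C * 12 ^ p * (4 + norm z) ^ p"
    proof (rule maximum_modulus_frontier[of G "cball x 2"])
      show "G holomorphic_on interior (cball x 2)" "continuous_on (closure (cball x 2)) G"
        using G holomorphic_on_imp_continuous_on holomorphic_on_subset by blast+
      show "bounded (cball x 2)" by simp
      have "norm (z - x) = \<bar>Im z\<bar>"
        by (simp add: zx norm_mult)
      then show "z \<in> cball x 2"
        using False by (simp add: dist_norm norm_minus_commute)
      fix u assume "u \<in> frontier (cball x 2)"
      then have u: "norm (u - x) = 2"
        by (simp add: dist_norm norm_minus_commute)
      define t where "t = u - x"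
      have imt: "Im t = Im u" by (simp add: t_def x_def)
      have tt: "(Re t)\<^sup>2 + (Im t)\<^sup>2 = 4"
        using cmod_power2[of t] u unfolding t_def by simp
      have "norm (t\<^sup>2 - 4) = 4 * \<bar>Im t\<bar>"
      proof -
        have re: "Re (t\<^sup>2 - 4) = - 2 * (Im t)\<^sup>2" and im: "Im (t\<^sup>2 - 4) = 2 * Re t * Im t"
          using tt by (auto simp: power2_eq_square)
        have "(norm (t\<^sup>2 - 4))\<^sup>2 = 4 * (Im t)\<^sup>2 * ((Re t)\<^sup>2 + (Im t)\<^sup>2)"
          unfolding cmod_power2 re im by (simp add: power2_eq_square algebra_simps)
        also have "\<dots> = (4 * \<bar>Im t\<bar>)\<^sup>2"
          by (simp add: tt power_mult_distrib)
        finally show ?thesis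
          by (rule power2_eq_imp_eq) auto
      qed
      then have Gu: "norm (G u) = norm (F u) * (4 * \<bar>Im u\<bar>) ^ p"
        by (simp add: G_def norm_mult norm_power t_def[symmetric] imt)
      show "norm (G u) \<le> C * 12 ^ p * (4 + norm z) ^ p"
      proof (cases "Im u = 0")
        case True
        then show ?thesis using Gu C by (simp add: p_def)
      next
        case nz: False
        have "norm u \<le> norm z + 3"
        proof -
          have "norm u \<le> norm x + 2"
            using norm_triangle_ineq[of x "u - x"] u by simp
          moreover have "norm x \<le> norm z"
            by (simp add: x_def abs_Re_le_cmod)
          ultimately show ?thesis by simp
        qed
        moreover have "\<bar>Im u\<bar> \<le> 2"
          using abs_Im_le_cmod[of t] u imt by (simp add: t_def)
        ultimately have "(1 + norm u) * (4 * \<bar>Im u\<bar> + 4) \<le> (4 + norm z) * 12"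
          by (intro mult_mono) auto
        moreover have "(1 + 1 / \<bar>Im u\<bar>) * (4 * \<bar>Im u\<bar>) = 4 * \<bar>Im u\<bar> + 4"
          using nz by (simp add: distrib_right)
        ultimately have w: "(1 + norm u) * (1 + 1 / \<bar>Im u\<bar>) * (4 * \<bar>Im u\<bar>) \<le> (4 + norm z) * 12"
          by (simp only: mult.assoc)
        have "norm (G u) \<le> C * ((1 + norm u) * (1 + 1 / \<bar>Im u\<bar>)) ^ p * (4 * \<bar>Im u\<bar>) ^ p"
          unfolding Gu by (rule mult_right_mono[OF b[OF nz]]) simp
        also have "\<dots> = C * ((1 + norm u) * (1 + 1 / \<bar>Im u\<bar>) * (4 * \<bar>Im u\<bar>)) ^ p"
          by (simp only: power_mult_distrib mult.assoc)
        also have "\<dots> \<le> C * ((4 + norm z) * 12) ^ p"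
          using C w by (intro mult_left_mono power_mono) auto
        also have "\<dots> = C * 12 ^ p * (4 + norm z) ^ p"
          by (simp only: power_mult_distrib mult_ac)
        finally show ?thesis .
      qed
    qed
    \<comment> \<open>At z the factor has modulus (Im z)^2 + 4 \<ge> 1 before the power is taken, so
      removing it costs nothing.\<close>
    moreover have "norm (F z) \<le> norm (G z)"
    proof -
      have "(z - x)\<^sup>2 - 4 = - of_real ((Im z)\<^sup>2 + 4)"
        by (simp add: zx power_mult_distrib)
      then have "norm ((z - x)\<^sup>2 - 4) = (Im z)\<^sup>2 + 4"
        by (simp only: norm_minus_cancel norm_of_real) simp
      then have "norm (((z - x)\<^sup>2 - 4) ^ p) \<ge> 1"
        by (simp add: norm_power one_le_power)
      then show ?thesis
        by (simp add: G_def norm_mult mult_le_cancel_left1)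
    qed
    ultimately show ?thesis by linarith
  qed
  then show ?thesis using that by blast
qed

lemma entire_tame_imp_poly:
  assumes "F holomorphic_on UNIV" and "tame F"
  obtains P where "\<And>z. F z = poly P z"
proof -
  obtain C p where C: "\<And>z. norm (F z) \<le> C * (4 + norm z) ^ p"
    using entire_tame_bound assms by blast
  have C0: "C \<ge> 0"
    using C[of 0] by (smt (verit, best) norm_ge_zero zero_less_power mult_less_0_iff norm_zero)
  have "norm (F z) \<le> C * 5 ^ p * norm z ^ p" if "1 \<le> norm z" for z
  proof -
    have "C * (4 + norm z) ^ p \<le> C * (5 * norm z) ^ p"
      using that C0 by (intro mult_left_mono power_mono) auto
    then show ?thesis using C[of z] by (simp add: power_mult_distrib mult_ac)
  qed
  then have L: "F z = (\<Sum>k\<le>p. (deriv ^^ k) F 0 / fact k * z ^ k)" for z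
    using assms(1) by (intro Liouville_polynomial[of F 1 "C * 5 ^ p" p]) auto
  show ?thesis
    by (rule that[of "\<Sum>k\<le>p. monom ((deriv ^^ k) F 0 / fact k) k"])
      (simp only: L poly_sum poly_monom)
qed

subsection \<open>The Phragmen-Lindelof principle\<close>

lemma entire_rescale:
  assumes "F holomorphic_on UNIV"
  shows "(\<lambda>u. F (c * u)) holomorphic_on UNIV"
  using holomorphic_on_compose_gen[of "\<lambda>u. c * u" UNIV F UNIV] assms
  by (simp add: o_def holomorphic_on_mult)

lemma entire_reflect:
  assumes "F holomorphic_on UNIV"
  shows "(\<lambda>u. F (- u)) holomorphic_on UNIV"
  using entire_rescale[OF assms, of "-1"] by simp

text \<open>Growth of order 1 lies below the critical order 2 of a quadrant. A barrier
  exp(-\<epsilon> (1 + \<omega> u)^(3/2)) of intermediate order makes the far arc negligible, and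
  \<epsilon> \<rightarrow> 0 removes it at the end. The factor \<omega> = exp(-i pi/4) centres the
  quadrant on the positive real axis, and the shift by 1 keeps the origin away from the branch
  point.\<close>

lemma phragmen_lindelof_quadrant:
  fixes F :: "complex \<Rightarrow> complex"
  assumes F: "F holomorphic_on UNIV" and growth: "\<And>z. norm (F z) \<le> A * exp (B * norm z)"
    and re: "\<And>x. x \<ge> 0 \<Longrightarrow> norm (F (of_real x)) \<le> M"
    and im: "\<And>y. y \<ge> 0 \<Longrightarrow> norm (F (\<i> * of_real y)) \<le> M"
    and z: "Re z \<ge> 0" "Im z \<ge> 0"
  shows "norm (F z) \<le> M"
proof -
  define \<omega> where "\<omega> = (1 - \<i>) / of_real (sqrt 2)"
  have om: "norm \<omega> = 1"
  proof -
    have "norm (1 - \<i>) = sqrt 2" by (simp add: cmod_def)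
    then show ?thesis by (simp add: \<omega>_def norm_divide)
  qed
  have A0: "A \<ge> 0"
    using order_trans[OF norm_ge_zero growth[of 0]] by simp
  have M0: "M \<ge> 0"
    using order_trans[OF norm_ge_zero re[of 0]] by simp
  text \<open>The barrier: on the quadrant \<open>1 + \<omega>u\<close> lies in the sector \<open>|arg| \<le> \<pi>/4\<close>, so its power \<open>3/2\<close> has real
    part comparable to \<open>|u|^(3/2)\<close>, which beats the exponential type.\<close>
  define S where "S = (\<lambda>u. csqrt (1 + \<omega> * u))"
  have rect: "Re (\<omega> * u) = (Re u + Im u) / sqrt 2" "Im (\<omega> * u) = (Im u - Re u) / sqrt 2" for u
    by (simp_all add: \<omega>_def complex_eq_iff Re_divide_of_real Im_divide_of_real field_simps)
  have bar: "Re (S u ^ 3) \<ge> (1 / 4) * norm (S u) ^ 3" "Re (1 + \<omega> * u) > 0"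
    if "Re u \<ge> 0" "Im u \<ge> 0" for u
  proof -
    show pos: "Re (1 + \<omega> * u) > 0"
      using that by (simp add: rect add_pos_nonneg del: times_complex.sel)
    define p q where "p = Re (S u)" and "q = Im (S u)"
    have sq: "S u ^ 2 = 1 + \<omega> * u"
      by (simp add: S_def)
    have "Re (S u ^ 2) = p\<^sup>2 - q\<^sup>2" "Im (S u ^ 2) = 2 * p * q"
      by (simp_all add: p_def q_def power2_eq_square)
    moreover have "\<bar>Im (1 + \<omega> * u)\<bar> \<le> Re (1 + \<omega> * u)"
      using that by (simp add: rect abs_if field_simps del: times_complex.sel)
    ultimately have ineq: "\<bar>2 * p * q\<bar> \<le> p\<^sup>2 - q\<^sup>2"
      using sq by simp
    have p0: "p \<ge> 0"
      unfolding p_def S_def by (rule Re_csqrt)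
    have pq: "2 * p * \<bar>q\<bar> \<le> p\<^sup>2 - \<bar>q\<bar>\<^sup>2"
      using ineq p0 by (simp add: abs_mult)
    \<comment> \<open>A crude form of |q| \<le> p tan(pi/8). It yields q^2 \<le> p^2/5, and the
      remaining constants follow: Re(S^3) = p(p^2 - 3q^2) \<ge> (2/5) p^3, while |S|^2 \<le> (6/5)
      p^2 \<le> (11p/10)^2 gives |S|^3 \<le> (8/5) p^3, and (2/5) / (8/5) = 1/4.\<close>
    have q: "\<bar>q\<bar> \<le> p / 2"
    proof (rule ccontr)
      assume "\<not> ?thesis"
      then have l: "p < 2 * \<bar>q\<bar>" by simp
      have "0 < \<bar>q\<bar>" using l p0 by linarith
      then have "0 < \<bar>q\<bar> * \<bar>q\<bar>" by (rule mult_pos_pos) fact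
      moreover have "p * p \<le> p * (2 * \<bar>q\<bar>)"
        using p0 l by (intro mult_left_mono) auto
      ultimately show False
        using pq by (simp add: power2_eq_square)
    qed
    have "q\<^sup>2 \<le> p\<^sup>2 / 5"
    proof -
      have "2 * p * \<bar>q\<bar> \<ge> 4 * \<bar>q\<bar> * \<bar>q\<bar>"
        using q p0 by (intro mult_right_mono) auto
      then show ?thesis using pq by (simp add: power2_eq_square)
    qed
    have "Re (S u ^ 3) = p * (p\<^sup>2 - 3 * q\<^sup>2)"
      by (simp add: p_def q_def power2_eq_square power3_eq_cube algebra_simps)
    also have "\<dots> \<ge> p * (p\<^sup>2 * (2 / 5))"
      using p0 \<open>q\<^sup>2 \<le> p\<^sup>2 / 5\<close> by (intro mult_left_mono) auto
    finally have 1: "Re (S u ^ 3) \<ge> p ^ 3 * (2 / 5)"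
      by (simp add: power2_eq_square power3_eq_cube)
    have "(norm (S u))\<^sup>2 \<le> (11 / 10 * p)\<^sup>2"
    proof -
      have "(11 / 10 * p)\<^sup>2 = 121 / 100 * p\<^sup>2"
        by (simp add: power_mult_distrib power_divide)
      then show ?thesis
        unfolding cmod_power2 p_def[symmetric] q_def[symmetric]
        using \<open>q\<^sup>2 \<le> p\<^sup>2 / 5\<close> zero_le_power2[of p] by linarith
    qed
    then have "norm (S u) \<le> 11 / 10 * p"
      using p0 by (simp add: power2_le_iff_abs_le abs_le_square_iff[symmetric])
    then have "norm (S u) ^ 3 \<le> (11 / 10 * p) ^ 3"
      by (intro power_mono) auto
    also have "\<dots> \<le> 8 / 5 * p ^ 3"
      using p0 by (simp add: power_mult_distrib power3_eq_cube)
    finally show "Re (S u ^ 3) \<ge> (1 / 4) * norm (S u) ^ 3"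
      using 1 by simp
  qed
  have bound: "norm (F z) \<le> M * exp (\<epsilon> * norm (S z) ^ 3)" if "\<epsilon> > 0" for \<epsilon>
  proof -
    define G where "G = (\<lambda>u. F u * exp (- of_real \<epsilon> * S u ^ 3))"
    have GF: "norm (G u) \<le> norm (F u) * exp (- (\<epsilon> / 4) * norm (S u) ^ 3)" if "Re u \<ge> 0" "Im u \<ge> 0" for u
      using bar(1)[OF that] \<open>\<epsilon> > 0\<close> by (simp add: G_def norm_mult mult_left_mono)
    have GF1: "norm (G u) \<le> norm (F u)" if "Re u \<ge> 0" "Im u \<ge> 0" for u
    proof -
      have "exp (- (\<epsilon> / 4) * norm (S u) ^ 3) \<le> 1"
        using \<open>\<epsilon> > 0\<close> by simp
      then show ?thesis
        using GF[OF that] mult_left_mono[OF _ norm_ge_zero, of "exp (- (\<epsilon> / 4) * norm (S u) ^ 3)" 1 "F u"] by simp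
    qed
    have Sn: "norm (S u) = sqrt (norm (1 + \<omega> * u))" for u
      by (simp add: S_def norm_csqrt)
    have Sge: "norm (S u) \<ge> sqrt (norm u - 1)" for u
    proof -
      have "norm u - 1 \<le> norm (1 + \<omega> * u)"
        using norm_triangle_ineq4[of "1 + \<omega> * u" 1] om by (simp add: norm_mult)
      then show ?thesis by (simp add: Sn)
    qed
    have "((\<lambda>r::real. A * exp (B * r - \<epsilon> / 4 * (sqrt (r - 1)) ^ 3)) \<longlongrightarrow> 0) at_top"
      using \<open>\<epsilon> > 0\<close> by real_asymp
    then have ev: "\<forall>\<^sub>F r in at_top. A * exp (B * r - \<epsilon> / 4 * (sqrt (r - 1)) ^ 3) \<le> M + \<delta>" if "\<delta> > 0" for \<delta>
      using order_tendstoD(2)[of _ 0 at_top "M + \<delta>"] M0 that by (fastforce elim!: eventually_mono)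
    have "norm (G z) \<le> M + \<delta>" if \<delta>: "\<delta> > 0" for \<delta>
    proof -
      obtain r0 where r0: "\<And>r. r \<ge> r0 \<Longrightarrow> A * exp (B * r - \<epsilon> / 4 * (sqrt (r - 1)) ^ 3) \<le> M + \<delta>"
        using ev[OF \<delta>] unfolding eventually_at_top_linorder by blast
      define r where "r = max r0 (norm z + 1)"
      define D where "D = {u. Re u \<ge> 0} \<inter> {u. Im u \<ge> 0} \<inter> cball 0 r"
      show ?thesis
      proof (rule maximum_modulus_frontier[of G D])
        show "bounded D" unfolding D_def by (intro bounded_Int) auto
        have cl: "closed D"
          unfolding D_def by (intro closed_Int closed_halfspace_Re_ge closed_halfspace_Im_ge closed_cball)
        have op: "open {u. Re (1 + \<omega> * u) > 0}"
          by (intro open_Collect_less continuous_intros)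
        have "S holomorphic_on {u. Re (1 + \<omega> * u) > 0}"
          unfolding S_def by (intro holomorphic_on_csqrt' holomorphic_intros) (auto simp: complex_nonpos_Reals_iff)
        then have hol: "G holomorphic_on {u. Re (1 + \<omega> * u) > 0}"
          unfolding G_def using F by (intro holomorphic_intros) (auto intro: holomorphic_on_subset)
        have sub: "D \<subseteq> {u. Re (1 + \<omega> * u) > 0}"
          unfolding D_def using bar(2) by auto
        show "G holomorphic_on interior D"
          using hol sub interior_subset by (meson holomorphic_on_subset subset_trans)
        show "continuous_on (closure D) G"
          using hol sub cl holomorphic_on_imp_continuous_on holomorphic_on_subset closure_closed by metis
        show "z \<in> D"
          using z by (simp add: D_def r_def)
        fix u assume "u \<in> frontier D"
        then have uD: "u \<in> D" and nint: "u \<notin> interior D"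
          using cl frontier_def[of D] by (auto simp: closure_closed)
        consider "Re u = 0" | "Im u = 0" | "norm u = r"
        proof -
          have "open ({u. Re u > 0} \<inter> {u. Im u > 0} \<inter> ball 0 r)"
            by (intro open_Int open_halfspace_Re_gt open_halfspace_Im_gt open_ball)
          moreover have "{u. Re u > 0} \<inter> {u. Im u > 0} \<inter> ball 0 r \<subseteq> D"
            by (auto simp: D_def)
          ultimately have "u \<notin> {u. Re u > 0} \<inter> {u. Im u > 0} \<inter> ball 0 r"
            using nint interior_maximal by blast
          then show ?thesis using uD that by (auto simp: D_def)
        qed
        then show "norm (G u) \<le> M + \<delta>"
        proof cases
          case 1
          then have "u = \<i> * of_real (Im u)" by (simp add: complex_eq_iff)
          then show ?thesis
            using GF1[of u] im[of "Im u"] uD \<open>\<delta> > 0\<close> by (fastforce simp: D_def)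
        next
          case 2
          then have "u = of_real (Re u)" by (simp add: complex_eq_iff)
          then show ?thesis
            using GF1[of u] re[of "Re u"] uD \<open>\<delta> > 0\<close> by (fastforce simp: D_def)
        next
          case 3
          have "norm (G u) \<le> norm (F u) * exp (- (\<epsilon> / 4) * norm (S u) ^ 3)"
            using GF uD by (simp add: D_def)
          also have "\<dots> \<le> (A * exp (B * r)) * exp (- (\<epsilon> / 4) * sqrt (r - 1) ^ 3)"
          proof (intro mult_mono)
            have "r \<ge> 1" unfolding r_def using norm_ge_zero[of z] by linarith
            then have "sqrt (r - 1) ^ 3 \<le> norm (S u) ^ 3"
              using Sge[of u] 3 by (intro power_mono) auto
            then show "exp (- (\<epsilon> / 4) * norm (S u) ^ 3) \<le> exp (- (\<epsilon> / 4) * sqrt (r - 1) ^ 3)"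
              using \<open>\<epsilon> > 0\<close> by simp
          qed (use growth[of u] 3 A0 in auto)
          also have "\<dots> = A * exp (B * r - \<epsilon> / 4 * (sqrt (r - 1)) ^ 3)"
            by (simp add: mult_exp_exp)
          also have "\<dots> \<le> M + \<delta>"
            by (rule r0) (simp add: r_def)
          finally show ?thesis .
        qed
      qed
    qed
    then have "norm (G z) \<le> M"
      by (rule field_le_epsilon)
    moreover have "norm (F z) = norm (G z) * norm (exp (of_real \<epsilon> * S z ^ 3))"
    proof -
      have "exp (- of_real \<epsilon> * S z ^ 3) * exp (of_real \<epsilon> * S z ^ 3) = 1"
        by (simp flip: exp_add)
      then have "F z = G z * exp (of_real \<epsilon> * S z ^ 3)"
        by (simp only: G_def mult.assoc mult_1_right)
      then show ?thesis by (simp only: norm_mult)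
    qed
    moreover have "norm (exp (of_real \<epsilon> * S z ^ 3)) \<le> exp (\<epsilon> * norm (S z) ^ 3)"
      using norm_exp[of "of_real \<epsilon> * S z ^ 3"] \<open>\<epsilon> > 0\<close> by (simp add: norm_mult norm_power)
    ultimately show ?thesis
      using M0 by (simp add: mult_mono)
  qed
  have "((\<lambda>n. M * exp (inverse (real (Suc n)) * norm (S z) ^ 3)) \<longlonglongrightarrow> M * exp (0 * norm (S z) ^ 3))"
    by (intro tendsto_intros LIMSEQ_inverse_real_of_nat)
  moreover have "norm (F z) \<le> M * exp (inverse (real (Suc n)) * norm (S z) ^ 3)" for n
    by (rule bound) simp
  ultimately have "norm (F z) \<le> M * exp (0 * norm (S z) ^ 3)"
    by (intro LIMSEQ_le_const) auto
  then show ?thesis by simp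
qed

text \<open>Multiplication by exp(iBz) cancels the growth along the positive imaginary axis, so the
  two quadrants give the provisional bound max A M in the half-plane. For a bounded function the
  weak barrier 1/(1 - i \<epsilon> z) then suffices to bring the bound down to the one on the real
  line.\<close>

lemma phragmen_lindelof_upper:
  fixes F :: "complex \<Rightarrow> complex"
  assumes F: "F holomorphic_on UNIV" and growth: "\<And>z. norm (F z) \<le> A * exp (B * norm z)" and "B \<ge> 0"
    and re: "\<And>x. norm (F (of_real x)) \<le> M"
    and z: "Im z \<ge> 0"
  shows "norm (F z) \<le> M * exp (B * Im z)"
proof -
  define H where "H = (\<lambda>u. F u * exp (\<i> * of_real B * u))"
  have H: "H holomorphic_on UNIV"
    unfolding H_def by (intro holomorphic_intros F)
  have nH: "norm (H u) = norm (F u) * exp (- B * Im u)" for u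
    by (simp add: H_def norm_mult)
  have A0: "A \<ge> 0"
    using order_trans[OF norm_ge_zero growth[of 0]] by simp
  have M0: "M \<ge> 0"
    using order_trans[OF norm_ge_zero re[of 0]] .
  define M' where "M' = max A M"
  have growthH: "norm (H u) \<le> A * exp (2 * B * norm u)" for u
  proof -
    have "B * (- Im u) \<le> B * norm u"
      using abs_Im_le_cmod[of u] \<open>B \<ge> 0\<close> by (intro mult_left_mono) auto
    then have "exp (- B * Im u) \<le> exp (B * norm u)" by simp
    then have "norm (H u) \<le> (A * exp (B * norm u)) * exp (B * norm u)"
      unfolding nH using growth A0 by (intro mult_mono) auto
    also have "\<dots> = A * exp (2 * B * norm u)"
    proof -
      have "exp (2 * B * norm u) = exp (B * norm u + B * norm u)" by simp
      then show ?thesis by (simp only: exp_add mult.assoc)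
    qed
    finally show ?thesis .
  qed
  have reH: "norm (H (of_real x)) \<le> M'" for x
    using re[of x] by (simp add: nH M'_def)
  have imH: "norm (H (\<i> * of_real y)) \<le> M'" if "y \<ge> 0" for y
  proof -
    have "norm (H (\<i> * of_real y)) \<le> A * exp (B * y) * exp (- B * y)"
      unfolding nH using growth[of "\<i> * of_real y"] that by (simp add: norm_mult)
    also have "\<dots> = A" by (simp add: exp_minus)
    finally show ?thesis by (simp add: M'_def)
  qed
  have bdd: "norm (H u) \<le> M'" if "Im u \<ge> 0" for u
  proof (cases "Re u \<ge> 0")
    case True
    show ?thesis
      by (rule phragmen_lindelof_quadrant[OF H growthH]) (use reH imH True that in auto)
  next
    case False
    \<comment> \<open>The second quadrant is rotated onto the first by u \<mapsto> -iu.\<close>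
    have "norm (H (\<i> * (- \<i> * u))) \<le> M'"
    proof (rule phragmen_lindelof_quadrant[of "\<lambda>u. H (\<i> * u)" A "2 * B"])
      show "(\<lambda>u. H (\<i> * u)) holomorphic_on UNIV"
        by (rule entire_rescale[OF H])
      show "norm (H (\<i> * u)) \<le> A * exp (2 * B * norm u)" for u
        using growthH[of "\<i> * u"] by (simp add: norm_mult)
      show "norm (H (\<i> * complex_of_real x)) \<le> M'" if "x \<ge> 0" for x
        by (rule imH[OF that])
      show "norm (H (\<i> * (\<i> * complex_of_real y))) \<le> M'" for y
      proof -
        have "\<i> * (\<i> * complex_of_real y) = of_real (- y)"
          by (simp add: mult.assoc[symmetric])
        then show ?thesis using reH[of "- y"] by simp
      qed
    qed (use False that in auto)
    moreover have "\<i> * (- \<i> * u) = u" by (simp add: mult.assoc[symmetric])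
    ultimately show ?thesis by simp
  qed
  have M'0: "M' \<ge> 0" using A0 by (simp add: M'_def)
  have bound: "norm (H z) \<le> (M + \<epsilon>) * norm (1 - \<i> * of_real \<epsilon> * z)" if "\<epsilon> > 0" for \<epsilon>
  proof -
    define G where "G = (\<lambda>u. H u / (1 - \<i> * of_real \<epsilon> * u))"
    have ge1: "norm (1 - \<i> * of_real \<epsilon> * u) \<ge> 1" if "Im u \<ge> 0" for u
    proof -
      have "Re (1 - \<i> * of_real \<epsilon> * u) = 1 + \<epsilon> * Im u" by simp
      moreover have "\<epsilon> * Im u \<ge> 0"
        using that \<open>\<epsilon> > 0\<close> by (intro mult_nonneg_nonneg) auto
      ultimately show ?thesis
        using complex_Re_le_cmod[of "1 - \<i> * of_real \<epsilon> * u"] by linarith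
    qed
    \<comment> \<open>This radius gives \<epsilon> r - 1 \<ge> M'/\<epsilon> + 1, so on the arc the
      provisional bound divided by the modulus of 1 - i \<epsilon> u is at most \<epsilon>.\<close>
    define r where "r = max (norm z) ((M' / \<epsilon> + 2) / \<epsilon>)"
    define D where "D = {u. Im u \<ge> 0} \<inter> cball 0 r"
    have "norm (G z) \<le> M + \<epsilon>"
    proof (rule maximum_modulus_frontier[of G D])
      show "bounded D" unfolding D_def by (intro bounded_Int) auto
      have cl: "closed D"
        unfolding D_def by (intro closed_Int closed_halfspace_Im_ge closed_cball)
      have hol: "G holomorphic_on D"
      proof -
        have "1 - \<i> * of_real \<epsilon> * u \<noteq> 0" if "u \<in> D" for u
          using ge1[of u] that by (auto simp: D_def)
        then show ?thesis
          unfolding G_def by (intro holomorphic_intros holomorphic_on_subset[OF H]) auto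
      qed
      show "G holomorphic_on interior D"
        using hol interior_subset holomorphic_on_subset by metis
      show "continuous_on (closure D) G"
        using hol cl holomorphic_on_imp_continuous_on closure_closed by metis
      show "z \<in> D"
        using z by (simp add: D_def r_def)
      fix u assume "u \<in> frontier D"
      then have uD: "u \<in> D" and nint: "u \<notin> interior D"
        using cl frontier_def[of D] by (auto simp: closure_closed)
      consider "Im u = 0" | "norm u = r"
      proof -
        have "open ({u. Im u > 0} \<inter> ball 0 r)"
          by (intro open_Int open_halfspace_Im_gt open_ball)
        moreover have "{u. Im u > 0} \<inter> ball 0 r \<subseteq> D"
          by (auto simp: D_def)
        ultimately have "u \<notin> {u. Im u > 0} \<inter> ball 0 r"
          using nint interior_maximal by blast
        then show ?thesis using uD that by (auto simp: D_def)
      qed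
      then show "norm (G u) \<le> M + \<epsilon>"
      proof cases
        case 1
        then have u: "u = of_real (Re u)" by (simp add: complex_eq_iff)
        have "norm (H u) \<le> M"
          using re[of "Re u"] u nH[of u] 1 by simp
        moreover have "norm (G u) \<le> norm (H u)"
          using ge1[of u] 1 by (simp add: G_def norm_divide divide_le_eq mult_le_cancel_left1)
        ultimately show ?thesis using \<open>\<epsilon> > 0\<close> by linarith
      next
        case 2
        have "norm (1 - \<i> * of_real \<epsilon> * u) \<ge> \<epsilon> * r - 1"
          using norm_triangle_ineq2[of "\<i> * of_real \<epsilon> * u" 1] 2 \<open>\<epsilon> > 0\<close>
          by (simp add: norm_mult norm_minus_commute)
        moreover have "\<epsilon> * r \<ge> M' / \<epsilon> + 2"
        proof -
          have "r \<ge> (M' / \<epsilon> + 2) / \<epsilon>" by (simp add: r_def)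
          then show ?thesis using \<open>\<epsilon> > 0\<close> by (simp add: divide_le_eq mult.commute)
        qed
        ultimately have "norm (1 - \<i> * of_real \<epsilon> * u) \<ge> M' / \<epsilon>"
          by linarith
        then have "M' \<le> \<epsilon> * norm (1 - \<i> * of_real \<epsilon> * u)"
          using \<open>\<epsilon> > 0\<close> by (simp add: divide_le_eq mult.commute)
        moreover have "norm (H u) \<le> M'"
          using bdd uD by (simp add: D_def)
        ultimately have "norm (G u) \<le> \<epsilon>"
          using ge1[of u] uD \<open>\<epsilon> > 0\<close> by (simp add: D_def G_def norm_divide divide_le_eq)
        then show ?thesis using M0 by linarith
      qed
    qed
    then show ?thesis
      using ge1[OF z] by (simp add: G_def norm_divide divide_le_eq split: if_splits)
  qed
  have "(\<lambda>n. (M + inverse (real (Suc n))) * norm (1 - \<i> * of_real (inverse (real (Suc n))) * z))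
    \<longlonglongrightarrow> (M + 0) * norm (1 - \<i> * of_real 0 * z)"
    by (intro tendsto_intros LIMSEQ_inverse_real_of_nat)
  moreover have "norm (H z) \<le> (M + inverse (real (Suc n))) * norm (1 - \<i> * of_real (inverse (real (Suc n))) * z)" for n
    by (rule bound) simp
  ultimately have "norm (H z) \<le> (M + 0) * norm (1 - \<i> * of_real 0 * z)"
    by (intro LIMSEQ_le_const) auto
  then have "norm (F z) * exp (- B * Im z) * exp (B * Im z) \<le> M * exp (B * Im z)"
    by (intro mult_right_mono) (auto simp: nH)
  moreover have "exp (- B * Im z) * exp (B * Im z) = 1"
    by (simp flip: exp_add)
  ultimately show ?thesis by (simp only: mult.assoc mult_1_right)
qed

lemma phragmen_lindelof:
  fixes F :: "complex \<Rightarrow> complex"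
  assumes F: "F holomorphic_on UNIV" and growth: "\<And>z. norm (F z) \<le> A * exp (B * norm z)" and "B \<ge> 0"
    and re: "\<And>x. norm (F (of_real x)) \<le> M"
  shows "norm (F z) \<le> M * exp (B * \<bar>Im z\<bar>)"
proof (cases "Im z \<ge> 0")
  case True
  then show ?thesis using phragmen_lindelof_upper[OF assms] by simp
next
  case False
  have "norm (F (- (- z))) \<le> M * exp (B * Im (- z))"
  proof (rule phragmen_lindelof_upper[of "\<lambda>u. F (- u)" A B])
    show "(\<lambda>u. F (- u)) holomorphic_on UNIV"
      by (rule entire_reflect[OF F])
    show "norm (F (- u)) \<le> A * exp (B * norm u)" for u
      using growth[of "- u"] by simp
    show "norm (F (- of_real x)) \<le> M" for x
      using re[of "- x"] by simp
  qed (use assms False in auto)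
  then show ?thesis using False by simp
qed

subsection \<open>The Bernstein inequality in mean\<close>

text \<open>Exhaustion by symmetric intervals and monotone convergence; it converts interval bounds,
  stated for the gauge integral, into Lebesgue integrability on the line.\<close>

lemma integrable_lborel_if_bounded_on_intervals:
  fixes f :: "real \<Rightarrow> complex"
  assumes f: "continuous_on UNIV f" and K: "\<And>n::nat. n > 0 \<Longrightarrow> integral {- real n..real n} (\<lambda>x. norm (f x)) \<le> K"
  shows "integrable lborel f"
proof (rule integrableI_bounded)
  show "f \<in> borel_measurable lborel"
    using borel_measurable_continuous_onI[OF f] by simp
  then have [measurable]: "f \<in> borel_measurable borel" by simp
  let ?g = "\<lambda>n x. ennreal (norm (f x)) * indicator {- real (Suc n)..real (Suc n)} x"
  have "(\<integral>\<^sup>+ x. ennreal (norm (f x)) \<partial>lborel) = (\<integral>\<^sup>+ x. (SUP n. ?g n x) \<partial>lborel)"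
  proof (rule nn_integral_cong)
    fix x
    have "?g (nat \<lceil>\<bar>x\<bar>\<rceil>) x \<le> (SUP n. ?g n x)"
      by (rule SUP_upper) simp
    moreover have "x \<in> {- real (Suc (nat \<lceil>\<bar>x\<bar>\<rceil>))..real (Suc (nat \<lceil>\<bar>x\<bar>\<rceil>))}"
      by (auto simp: abs_le_iff) linarith+
    ultimately have "ennreal (norm (f x)) \<le> (SUP n. ?g n x)" by simp
    moreover have "(SUP n. ?g n x) \<le> ennreal (norm (f x))"
      by (rule SUP_least) (simp add: indicator_def)
    ultimately show "ennreal (norm (f x)) = (SUP n. ?g n x)" by (rule antisym)
  qed
  also have "\<dots> = (SUP n. \<integral>\<^sup>+ x. ?g n x \<partial>lborel)"
    by (rule nn_integral_monotone_convergence_SUP)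
      (auto simp: incseq_def le_fun_def indicator_def intro!: mult_left_mono)
  also have "\<dots> \<le> ennreal K"
  proof (rule SUP_least)
    fix n
    let ?I = "{- real (Suc n)..real (Suc n)}"
    have c: "continuous_on ?I (\<lambda>x. norm (f x))"
      using f by (intro continuous_on_norm) (auto intro: continuous_on_subset)
    have si: "set_integrable lborel ?I (\<lambda>x. norm (f x))"
      by (rule borel_integrable_atLeastAtMost'[OF c])
    have "(\<integral>\<^sup>+ x. ?g n x \<partial>lborel) = (\<integral>\<^sup>+ x. ennreal (indicator ?I x *\<^sub>R norm (f x)) \<partial>lborel)"
      by (intro nn_integral_cong) (simp add: indicator_def)
    also have "\<dots> = ennreal (LINT x:?I|lborel. norm (f x))"
      using si unfolding set_integrable_def set_lebesgue_integral_def
      by (intro nn_integral_eq_integral) auto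
    also have "\<dots> = ennreal (integral ?I (\<lambda>x. norm (f x)))"
      using set_borel_integral_eq_integral(2)[OF si] by simp
    also have "\<dots> \<le> ennreal K"
      using K[of "Suc n"] by (intro ennreal_leI) auto
    finally show "(\<integral>\<^sup>+ x. ?g n x \<partial>lborel) \<le> ennreal K" .
  qed
  finally show "(\<integral>\<^sup>+ x. ennreal (norm (f x)) \<partial>lborel) < \<infinity>"
    by (simp add: order_le_less_trans)
qed

text \<open>
  Test \<open>u\<close> against \<open>c = conj u' / (|u'| + \<delta>)\<close> on \<open>[-T, T]\<close>: the convolution is bounded by the
  \<open>L\<^sup>1\<close> norm of \<open>u\<close> on the real line, hence on the unit disc by Phragmen-Lindelof, and its derivative at
  \<open>0\<close> dominates the integral of \<open>|u'|\<close> up to \<open>2T\<delta>\<close>.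
\<close>

lemma bernstein_L1_interval:
  fixes u :: "complex \<Rightarrow> complex"
  assumes u: "u holomorphic_on UNIV" and growth: "\<And>z. norm (u z) \<le> A * exp (B * norm z)" and B: "B \<ge> 0"
    and int: "integrable lborel (\<lambda>x. u (of_real x))" and T: "T > 0"
  shows "integral {- T..T} (\<lambda>x. norm (deriv u (of_real x))) \<le> (LINT x|lborel. norm (u (of_real x))) * exp B + 2"
proof -
  define M where "M = (LINT x|lborel. norm (u (of_real x)))"
  \<comment> \<open>With this choice the loss
    \<open>integral {- T..T} (\<lambda>t. \<delta>)\<close> equals 2 whatever T is, which makes the
    final bound uniform in T.\<close>
  define \<delta> where "\<delta> = 1 / T"
  have \<delta>: "\<delta> > 0" using T by (simp add: \<delta>_def)
  define u' where "u' = (\<lambda>x::real. deriv u (of_real x))"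
  define c where "c = (\<lambda>x. cnj (u' x) / of_real (norm (u' x) + \<delta>))"
  have A0: "A \<ge> 0"
    using order_trans[OF norm_ge_zero growth[of 0]] by simp
  have du: "deriv u holomorphic_on UNIV"
    using u by (simp add: holomorphic_deriv)
  have cu: "continuous_on UNIV u" and cdu: "continuous_on UNIV (deriv u)"
    using u du holomorphic_on_imp_continuous_on by blast+
  have cu': "continuous_on UNIV u'"
    unfolding u'_def by (rule continuous_on_compose2[OF cdu]) (auto intro: continuous_intros)
  have pos: "norm (u' x) + \<delta> > 0" for x
    using \<delta> norm_ge_zero[of "u' x"] by linarith
  then have nz: "complex_of_real (norm (u' x) + \<delta>) \<noteq> 0" for x
    by (metis less_irrefl of_real_eq_0_iff)
  have cc: "continuous_on UNIV c"
    unfolding c_def using nz by (intro continuous_intros cu') auto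
  have nc: "norm (c x) \<le> 1" for x
    using pos[of x] \<delta> by (simp add: c_def norm_divide del: of_real_add)
  define F where "F = (\<lambda>z. integral (cbox (- T) T) (\<lambda>t. u (z + of_real t) * c t))"
  have cont1: "continuous_on S (\<lambda>t. u (z + of_real t) * c t)" for z S
    by (intro continuous_intros continuous_on_compose2[OF cu] continuous_on_subset[OF cc]) auto
  have cont2: "continuous_on S (\<lambda>t. u (z + of_real t))" for z and S :: "real set"
    by (intro continuous_intros continuous_on_compose2[OF cu]) auto
  have F': "(F has_field_derivative integral (cbox (- T) T) (\<lambda>t. deriv u (z + of_real t) * c t)) (at z)" for z
    unfolding F_def
  proof (rule leibniz_rule_field_derivative[where U = UNIV])
    show "((\<lambda>z. u (z + of_real t) * c t) has_field_derivative deriv u (z + of_real t) * c t) (at z)" for z t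
    proof -
      have "(u has_field_derivative deriv u (z + of_real t)) (at (z + of_real t))"
        using u by (simp add: holomorphic_derivI)
      then have "((\<lambda>z. u (z + of_real t)) has_field_derivative deriv u (z + of_real t)) (at z)"
        by (simp add: DERIV_shift)
      then show ?thesis
        by (rule DERIV_cmult_right)
    qed
    show "(\<lambda>t. u (z + of_real t) * c t) integrable_on cbox (- T) T" for z
      by (intro integrable_continuous cont1)
    have "continuous_on (UNIV \<times> cbox (- T) T) (\<lambda>p. deriv u (fst p + of_real (snd p)) * c (snd p))"
      by (intro continuous_intros continuous_on_compose2[OF cdu] continuous_on_compose2[OF cc]) auto
    then show "continuous_on (UNIV \<times> cbox (- T) T) (\<lambda>(z, t). deriv u (z + of_real t) * c t)"
      by (simp add: case_prod_unfold)
  qed auto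
  have Fh: "F holomorphic_on UNIV"
    using F' by (auto simp: holomorphic_on_open)
  have nF: "norm (F z) \<le> integral {- T..T} (\<lambda>t. norm (u (z + of_real t)))" for z
    unfolding F_def cbox_interval
  proof (rule integral_norm_bound_integral)
    show "(\<lambda>t. u (z + of_real t) * c t) integrable_on {- T..T}"
      by (intro integrable_continuous_interval cont1)
    show "(\<lambda>t. norm (u (z + of_real t))) integrable_on {- T..T}"
      by (intro integrable_continuous_interval continuous_on_norm cont2)
    show "norm (u (z + of_real t) * c t) \<le> norm (u (z + of_real t))" for t
      using nc[of t] by (simp add: norm_mult mult_left_le)
  qed
  have grow: "norm (F z) \<le> (2 * T * A * exp (B * T)) * exp (B * norm z)" for z
  proof -
    have "norm (u (z + of_real t)) \<le> A * exp (B * (norm z + T))" if "t \<in> {- T..T}" for t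
    proof -
      have "norm (z + of_real t) \<le> norm z + T"
        using norm_triangle_ineq[of z "of_real t"] that by auto
      then have "A * exp (B * norm (z + of_real t)) \<le> A * exp (B * (norm z + T))"
        using A0 B by (intro mult_left_mono) (auto intro: mult_left_mono)
      then show ?thesis using growth[of "z + of_real t"] by linarith
    qed
    then have "integral {- T..T} (\<lambda>t. norm (u (z + of_real t))) \<le> integral {- T..T} (\<lambda>t. A * exp (B * (norm z + T)))"
      by (intro integral_le integrable_continuous_interval continuous_on_norm cont2 continuous_intros) auto
    also have "\<dots> = (2 * T * A * exp (B * T)) * exp (B * norm z)"
      using T by (simp add: distrib_left exp_add mult_ac)
    finally show ?thesis using nF[of z] by linarith
  qed
  have real: "norm (F (of_real x)) \<le> M" for x
  proof -
    have iu: "integrable lborel (\<lambda>t. norm (u (of_real x + of_real t)))"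
      using lborel_integrable_real_affine[OF integrable_norm[OF int], of 1 x] by simp
    have si: "set_integrable lborel {- T..T} (\<lambda>t. norm (u (of_real x + of_real t)))"
      unfolding set_integrable_def by (intro integrable_mult_indicator iu) auto
    have "integral {- T..T} (\<lambda>t. norm (u (of_real x + of_real t))) = (LINT t:{- T..T}|lborel. norm (u (of_real x + of_real t)))"
      using set_borel_integral_eq_integral(2)[OF si] by simp
    also have "\<dots> \<le> (LINT t|lborel. norm (u (of_real x + of_real t)))"
      unfolding set_lebesgue_integral_def
      using si iu by (intro integral_mono) (auto simp: set_integrable_def indicator_def)
    also have "\<dots> = M"
      using lborel_integral_real_affine[of 1 "\<lambda>t. norm (u (of_real t))" x] by (simp add: M_def)
    finally show ?thesis using nF[of "of_real x"] by linarith
  qed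
  have M0: "M \<ge> 0" by (simp add: M_def)
  have "norm ((deriv ^^ 1) F 0) \<le> fact 1 * (M * exp B) / 1 ^ 1"
  proof (rule Cauchy_inequality)
    show "F holomorphic_on ball 0 1" "continuous_on (cball 0 1) F"
      using Fh holomorphic_on_imp_continuous_on holomorphic_on_subset by blast+
    fix z :: complex assume "norm (0 - z) = 1"
    then have "\<bar>Im z\<bar> \<le> 1" using abs_Im_le_cmod[of z] by simp
    then have "M * exp (B * \<bar>Im z\<bar>) \<le> M * exp B"
      using M0 B by (intro mult_left_mono) (auto simp: mult_left_le)
    then show "norm (F z) \<le> M * exp B"
      using phragmen_lindelof[OF Fh grow B real, of z] by linarith
  qed simp
  moreover have "deriv F 0 = integral {- T..T} (\<lambda>t. u' t * c t)"
    using DERIV_imp_deriv[OF F'[of 0]] by (simp add: u'_def)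
  ultimately have le: "norm (integral {- T..T} (\<lambda>t. u' t * c t)) \<le> M * exp B"
    by simp
  have uc: "u' t * c t = of_real ((norm (u' t))\<^sup>2 / (norm (u' t) + \<delta>))" for t
    by (simp only: c_def times_divide_eq_right of_real_divide complex_norm_square)
  have contr: "continuous_on S (\<lambda>t. (norm (u' t))\<^sup>2 / (norm (u' t) + \<delta>))" for S
    using pos by (intro continuous_intros continuous_on_subset[OF cu']) (auto simp: less_imp_neq[symmetric])
  have "integral {- T..T} (\<lambda>t. norm (u' t) - \<delta>) \<le> integral {- T..T} (\<lambda>t. (norm (u' t))\<^sup>2 / (norm (u' t) + \<delta>))"
  proof (rule integral_le)
    show "(\<lambda>t. norm (u' t) - \<delta>) integrable_on {- T..T}"
      by (intro integrable_continuous_interval continuous_intros continuous_on_subset[OF cu']) auto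
    show "(\<lambda>t. (norm (u' t))\<^sup>2 / (norm (u' t) + \<delta>)) integrable_on {- T..T}"
      by (intro integrable_continuous_interval contr)
    show "norm (u' t) - \<delta> \<le> (norm (u' t))\<^sup>2 / (norm (u' t) + \<delta>)" for t
      unfolding pos_le_divide_eq[OF pos] using zero_le_power2[of \<delta>] by (simp add: power2_eq_square algebra_simps)
  qed
  also have "\<dots> = norm (integral {- T..T} (\<lambda>t. u' t * c t))"
  proof -
    have nn: "integral {- T..T} (\<lambda>t. (norm (u' t))\<^sup>2 / (norm (u' t) + \<delta>)) \<ge> 0"
      using pos by (intro integral_nonneg integrable_continuous_interval contr) (auto simp: less_imp_le)
    have "((\<lambda>t. complex_of_real ((norm (u' t))\<^sup>2 / (norm (u' t) + \<delta>))) has_integral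
        of_real (integral {- T..T} (\<lambda>t. (norm (u' t))\<^sup>2 / (norm (u' t) + \<delta>)))) {- T..T}"
      by (intro has_integral_of_real integrable_integral integrable_continuous_interval contr)
    then have "integral {- T..T} (\<lambda>t. u' t * c t) = of_real (integral {- T..T} (\<lambda>t. (norm (u' t))\<^sup>2 / (norm (u' t) + \<delta>)))"
      unfolding uc by (rule integral_unique)
    then show ?thesis using nn by (simp only: norm_of_real abs_of_nonneg)
  qed
  also have "\<dots> \<le> M * exp B" by (rule le)
  finally have "integral {- T..T} (\<lambda>t. norm (u' t) - \<delta>) \<le> M * exp B" .
  moreover have "integral {- T..T} (\<lambda>t. norm (u' t) - \<delta>) = integral {- T..T} (\<lambda>t. norm (u' t)) - integral {- T..T} (\<lambda>t. \<delta>)"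
    by (intro Henstock_Kurzweil_Integration.integral_diff integrable_continuous_interval continuous_intros continuous_on_subset[OF cu']) auto
  moreover have "integral {- T..T} (\<lambda>t. \<delta>) = 2"
    using T by (simp add: \<delta>_def)
  ultimately show ?thesis
    by (simp add: u'_def M_def)
qed

text \<open>The interval bound does not depend on T, whence integrability; the fundamental theorem
  of calculus then bounds u by |u(0)| plus the L^1 norm of u'. In the quadrature formula the first
  makes the test function integrable, the second removes the boundary term.\<close>

lemma bernstein_L1:
  fixes u :: "complex \<Rightarrow> complex"
  assumes u: "u holomorphic_on UNIV" and growth: "\<And>z. norm (u z) \<le> A * exp (B * norm z)" and B: "B \<ge> 0"
    and int: "integrable lborel (\<lambda>x. u (of_real x))"
  shows "integrable lborel (\<lambda>x. deriv u (of_real x))" "\<exists>K. \<forall>x::real. norm (u (of_real x)) \<le> K"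
proof -
  have "continuous_on UNIV (deriv u)"
    using u holomorphic_deriv[of u UNIV] holomorphic_on_imp_continuous_on by blast
  then have c: "continuous_on S (\<lambda>x. deriv u (of_real x))" for S :: "real set"
    by (rule continuous_on_compose2) (auto intro: continuous_intros)
  show *: "integrable lborel (\<lambda>x. deriv u (of_real x))"
    by (rule integrable_lborel_if_bounded_on_intervals[OF c bernstein_L1_interval[OF assms]]) simp
  have "norm (u (of_real x)) \<le> norm (u 0) + (LINT t|lborel. norm (deriv u (of_real t)))" for x
  proof -
    define a b where "a = min 0 x" and "b = max 0 x"
    have ab: "a \<le> b" "u (of_real b) - u (of_real a) = u (of_real x) - u 0 \<or> u (of_real b) - u (of_real a) = - (u (of_real x) - u 0)"
      by (auto simp: a_def b_def min_def max_def)
    have "((\<lambda>t. deriv u (of_real t)) has_integral u (of_real b) - u (of_real a)) {a..b}"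
    proof (rule fundamental_theorem_of_calculus[OF ab(1)])
      fix t :: real
      have "(u has_field_derivative deriv u (of_real t)) (at (of_real t))"
        using u by (simp add: holomorphic_derivI)
      then show "((\<lambda>t. u (of_real t)) has_vector_derivative deriv u (of_real t)) (at t within {a..b})"
        by (rule has_vector_derivative_real_field)
    qed
    then have "u (of_real b) - u (of_real a) = integral {a..b} (\<lambda>t. deriv u (of_real t))"
      by (simp add: integral_unique)
    also have "norm \<dots> \<le> integral {a..b} (\<lambda>t. norm (deriv u (of_real t)))"
      by (intro integral_norm_bound_integral integrable_continuous_interval continuous_on_norm c) auto
    also have "\<dots> = (LINT t:{a..b}|lborel. norm (deriv u (of_real t)))"
      by (intro set_borel_integral_eq_integral(2)[symmetric] borel_integrable_atLeastAtMost' continuous_on_norm c)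
    also have "\<dots> \<le> (LINT t|lborel. norm (deriv u (of_real t)))"
      unfolding set_lebesgue_integral_def
      using integrable_norm[OF *] by (intro integral_mono integrable_mult_indicator) (auto simp: indicator_def)
    finally have "norm (u (of_real x) - u 0) \<le> (LINT t|lborel. norm (deriv u (of_real t)))"
      using ab(2) by (metis norm_minus_cancel)
    then show ?thesis
      using norm_triangle_ineq[of "u 0" "u (of_real x) - u 0"] by simp
  qed
  then show "\<exists>K. \<forall>x::real. norm (u (of_real x)) \<le> K" by blast
qed

subsection \<open>The alternating canonical product\<close>

locale alternating_zeros =
  fixes \<tau> :: "nat \<Rightarrow> real"
  assumes tau_pos: "\<And>k. k \<ge> 1 \<Longrightarrow> \<tau> k > 0"
    and tau_mono: "strict_mono_on {1..} \<tau>"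
    and tau_asymp: "\<tau> \<sim>[at_top] (\<lambda>k. pi * real k)"
begin

text \<open>The zeros of \<open>Phi \<tau>\<close>: the factor with index k is 1 - z /
  \<open>lam k\<close>, and the signs run +, -, +, ... starting with
  \<open>lam 1 = \<tau> 1\<close>.\<close>

definition lam :: "nat \<Rightarrow> real" where "lam k = (-1) ^ (k + 1) * \<tau> k"

lemma lam_square [simp]: "(lam k)\<^sup>2 = (\<tau> k)\<^sup>2"
  by (simp add: lam_def power_mult_distrib flip: power_mult)

lemma abs_lam: "k \<ge> 1 \<Longrightarrow> \<bar>lam k\<bar> = \<tau> k"
  using tau_pos[of k] by (simp add: lam_def abs_mult power_abs)

lemma lam_nonzero: "k \<ge> 1 \<Longrightarrow> lam k \<noteq> 0"
  using abs_lam[of k] tau_pos[of k] by auto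

lemma tau_ratio: "(\<lambda>k. \<tau> k / real k) \<longlonglongrightarrow> pi"
proof -
  have "\<forall>\<^sub>F k in sequentially. \<tau> k \<noteq> 0 \<or> pi * real k \<noteq> 0"
    using eventually_gt_at_top[of 0] by eventually_elim auto
  then have "(\<lambda>k. \<tau> k / (pi * real k)) \<longlonglongrightarrow> 1"
    by (rule asymp_equivD_strong[OF tau_asymp])
  then have "(\<lambda>k. pi * (\<tau> k / (pi * real k))) \<longlonglongrightarrow> pi * 1"
    by (intro tendsto_intros)
  then show ?thesis by simp
qed

lemma tau_between:
  assumes "c1 < pi" "pi < c2"
  obtains k0 where "k0 \<ge> 1" "\<And>k. k \<ge> k0 \<Longrightarrow> c1 * real k \<le> \<tau> k \<and> \<tau> k \<le> c2 * real k"
proof -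
  have "\<forall>\<^sub>F k in sequentially. c1 < \<tau> k / real k \<and> \<tau> k / real k < c2 \<and> k \<ge> 1"
    using order_tendstoD(1)[OF tau_ratio assms(1)] order_tendstoD(2)[OF tau_ratio assms(2)] eventually_ge_at_top[of 1]
    by eventually_elim auto
  then obtain k1 where k1: "\<And>k. k \<ge> k1 \<Longrightarrow> c1 < \<tau> k / real k \<and> \<tau> k / real k < c2 \<and> k \<ge> 1"
    unfolding eventually_at_top_linorder by blast
  have "c1 * real k \<le> \<tau> k \<and> \<tau> k \<le> c2 * real k" if "k \<ge> max k1 1" for k
    using k1[of k] that by (simp add: field_simps)
  then show ?thesis using that[of "max k1 1"] by auto
qed

lemma tau_lower:
  obtains k0 where "k0 \<ge> 1" "\<And>k. k \<ge> k0 \<Longrightarrow> real k \<le> \<tau> k"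
proof (rule tau_between[of 1 4])
  show "1 < pi" "pi < 4" using pi_gt3 pi_less_4 by auto
qed (use that in auto)

lemma tau_at_top: "filterlim \<tau> at_top at_top"
proof -
  obtain k0 where k0: "\<And>k. k \<ge> k0 \<Longrightarrow> real k \<le> \<tau> k"
    using tau_lower by blast
  then have "\<forall>\<^sub>F k in sequentially. real k \<le> \<tau> k"
    unfolding eventually_at_top_linorder by blast
  then show ?thesis
    using filterlim_at_top_mono filterlim_real_sequentially by blast
qed

lemma summable_inverse_tau_square: "summable (\<lambda>k. 1 / (\<tau> (Suc k))\<^sup>2)"
proof -
  obtain k0 where k0: "k0 \<ge> 1" "\<And>k. k \<ge> k0 \<Longrightarrow> real k \<le> \<tau> k"
    using tau_lower by blast
  have "summable (\<lambda>k. 1 / (\<tau> k)\<^sup>2)"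
  proof (rule summable_comparison_test_ev)
    show "\<forall>\<^sub>F k in sequentially. norm (1 / (\<tau> k)\<^sup>2) \<le> 1 / (real k)\<^sup>2"
      using eventually_ge_at_top[of k0]
    proof eventually_elim
      case (elim k)
      show ?case
      proof -
        have "0 < real k" "real k \<le> \<tau> k"
          using k0(2)[OF elim] k0(1) elim by auto
        then have "0 < (real k)\<^sup>2" "(real k)\<^sup>2 \<le> (\<tau> k)\<^sup>2"
          by (simp_all add: power_mono)
        then show ?thesis
          by (simp add: frac_le)
      qed
    qed
    show "summable (\<lambda>k. 1 / (real k)\<^sup>2)"
      using inverse_power_summable[of 2, where 'a = real] by (simp add: inverse_eq_divide power_one_over)
  qed
  then show ?thesis
    by (subst summable_Suc_iff)
qed

definition T2 :: real where "T2 = (\<Sum>k. 1 / (\<tau> (Suc k))\<^sup>2)"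

lemma sum_inverse_tau_square_le: "(\<Sum>k=1..n. 1 / (\<tau> k)\<^sup>2) \<le> T2"
proof -
  have "(\<Sum>k=1..n. 1 / (\<tau> k)\<^sup>2) = (\<Sum>k<n. 1 / (\<tau> (Suc k))\<^sup>2)"
    by (rule sum.reindex_bij_witness[of _ Suc "\<lambda>k. k - 1"]) auto
  also have "\<dots> \<le> T2"
    unfolding T2_def by (rule sum_le_suminf[OF summable_inverse_tau_square]) auto
  finally show ?thesis .
qed

lemma T2_nonneg: "T2 \<ge> 0"
  using sum_inverse_tau_square_le[of 0] by simp

text \<open>Since \<tau>_k ~ pi k, the series of the 1/\<tau>_k diverges; with alternating signs
  Leibniz' criterion gives convergence in the natural order, which is the order in which the product
  defining \<Phi> is taken.\<close>

lemma convergent_sum_inverse_lam: "convergent (\<lambda>n. \<Sum>k=1..n. 1 / lam k)"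
proof -
  have a0: "(\<lambda>k. 1 / \<tau> (Suc k)) \<longlonglongrightarrow> 0"
    using tendsto_inverse_0_at_top[OF tau_at_top] LIMSEQ_Suc by (auto simp: inverse_eq_divide)
  have "decseq (\<lambda>k. 1 / \<tau> (Suc k))"
  proof (rule decseq_SucI)
    fix k
    have "\<tau> (Suc k) < \<tau> (Suc (Suc k))"
      using tau_mono by (auto simp: strict_mono_on_def)
    then show "1 / \<tau> (Suc (Suc k)) \<le> 1 / \<tau> (Suc k)"
      using tau_pos[of "Suc k"] by (intro divide_left_mono) (auto simp: mult_pos_pos)
  qed
  then have "summable (\<lambda>k. (-1) ^ k * (1 / \<tau> (Suc k)))"
    by (intro summable_Leibniz(1)[OF a0] decseq_imp_monoseq)
  moreover have "(-1) ^ k * (1 / \<tau> (Suc k)) = 1 / lam (Suc k)" for k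
    by (cases "even k") (auto simp: lam_def)
  ultimately have "summable (\<lambda>k. 1 / lam (Suc k))" by simp
  then have "convergent (\<lambda>n. \<Sum>k<n. 1 / lam (Suc k))"
    by (simp add: summable_iff_convergent)
  moreover have "(\<Sum>k<n. 1 / lam (Suc k)) = (\<Sum>k=1..n. 1 / lam k)" for n
    by (rule sum.reindex_bij_witness[of _ "\<lambda>k. k - 1" Suc]) auto
  ultimately show ?thesis by simp
qed

text \<open>Genus 1 suffices because the 1/\<tau>_k^2 are summable. The canonical factors carry
  extra exponentials exp(z / \<open>lam k\<close>), whose product converges by the alternating
  series, so \<Phi> differs from the canonical product only by the factor exp(-z
  \<open>lamsum\<close>).\<close>

sublocale W: weierstrass_product "\<lambda>n. complex_of_real (lam (Suc n))" "\<lambda>_. 1"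
proof
  show "complex_of_real (lam (Suc n)) \<noteq> 0" for n
    using lam_nonzero by simp
  have "filterlim (\<lambda>n. \<tau> (Suc n)) at_top at_top"
    using tau_at_top by (simp add: filterlim_sequentially_Suc)
  then show "filterlim (\<lambda>n. complex_of_real (lam (Suc n))) at_infinity at_top"
    by (simp add: filterlim_at_infinity_conv_norm_at_top abs_lam)
  fix r :: real assume "r > 0"
  show "summable (\<lambda>n. (r / norm (complex_of_real (lam (Suc n)))) ^ Suc 1)"
  proof -
    have "(r / norm (complex_of_real (lam (Suc n)))) ^ Suc 1 = r\<^sup>2 * (1 / (\<tau> (Suc n))\<^sup>2)" for n
      by (simp add: power2_eq_square abs_lam)
    then show ?thesis
      using summable_mult[OF summable_inverse_tau_square, of "r\<^sup>2"] by (simp only:)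
  qed
qed

definition lamsum :: real where "lamsum = lim (\<lambda>n. \<Sum>k=1..n. 1 / lam k)"

lemma lamsum_tendsto: "(\<lambda>n. \<Sum>k=1..n. 1 / lam k) \<longlonglongrightarrow> lamsum"
  unfolding lamsum_def using convergent_sum_inverse_lam by (simp add: convergent_LIMSEQ_iff)

lemma Phi_factor: "k \<ge> 1 \<Longrightarrow> 1 + (-1) ^ k * (z / complex_of_real (\<tau> k)) = 1 - z / of_real (lam k)"
  by (cases "even k") (auto simp: lam_def)

lemma Phi_partial_product:
  "(\<Prod>k=1..n. 1 + (-1) ^ k * (z / complex_of_real (\<tau> k))) =
     exp (- z * of_real (\<Sum>k=1..n. 1 / lam k)) * (\<Prod>k<n. weierstrass_factor 1 (z / of_real (lam (Suc k))))"
proof -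
  have "(\<Prod>k<n. weierstrass_factor 1 (z / of_real (lam (Suc k)))) =
      (\<Prod>k=1..n. weierstrass_factor 1 (z / of_real (lam k)))"
    by (rule prod.reindex_bij_witness[of _ "\<lambda>k. k - 1" Suc]) auto
  also have "\<dots> = (\<Prod>k=1..n. 1 + (-1) ^ k * (z / complex_of_real (\<tau> k))) * (\<Prod>k=1..n. exp (z / of_real (lam k)))"
    unfolding prod.distrib[symmetric]
  proof (rule prod.cong)
    fix k assume "k \<in> {1..n}"
    then have "k \<ge> 1" by simp
    show "weierstrass_factor 1 (z / of_real (lam k)) =
        (1 + (-1) ^ k * (z / complex_of_real (\<tau> k))) * exp (z / of_real (lam k))"
      unfolding weierstrass_factor_def Phi_factor[OF \<open>k \<ge> 1\<close>] by simp
  qed simp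
  also have "(\<Prod>k=1..n. exp (z / of_real (lam k))) = exp (z * of_real (\<Sum>k=1..n. 1 / lam k))"
    by (simp add: exp_sum sum_distrib_left)
  finally show ?thesis
    by (simp add: exp_minus field_simps)
qed

lemma W_tendsto: "(\<lambda>n. \<Prod>k<n. weierstrass_factor 1 (z / of_real (lam (Suc k)))) \<longlonglongrightarrow> W.f z"
  using tendsto_uniform_limitI[OF W.uniform_limit[of "norm z + 1"], of z]
  by (simp add: add_nonneg_pos)

lemma Phi_tendsto: "(\<lambda>n. \<Prod>k=1..n. 1 + (-1) ^ k * (z / complex_of_real (\<tau> k))) \<longlonglongrightarrow> Phi \<tau> z"
  and Phi_eq: "Phi \<tau> z = exp (- z * of_real lamsum) * W.f z"
proof -
  have *: "(\<lambda>n. \<Prod>k=1..n. 1 + (-1) ^ k * (z / complex_of_real (\<tau> k))) \<longlonglongrightarrow> exp (- z * of_real lamsum) * W.f z"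
    unfolding Phi_partial_product by (intro tendsto_intros lamsum_tendsto W_tendsto)
  then show "Phi \<tau> z = exp (- z * of_real lamsum) * W.f z"
    unfolding Phi_def by (rule limI)
  with * show "(\<lambda>n. \<Prod>k=1..n. 1 + (-1) ^ k * (z / complex_of_real (\<tau> k))) \<longlonglongrightarrow> Phi \<tau> z"
    by simp
qed

lemma Phi_holomorphic: "Phi \<tau> holomorphic_on UNIV"
proof -
  have "(\<lambda>z. exp (- z * of_real lamsum) * W.f z) holomorphic_on UNIV"
    by (intro holomorphic_intros)
  moreover have "Phi \<tau> = (\<lambda>z. exp (- z * of_real lamsum) * W.f z)"
    by (rule ext, rule Phi_eq)
  ultimately show ?thesis by simp
qed

lemma Phi_nonzero: "Im z \<noteq> 0 \<Longrightarrow> Phi \<tau> z \<noteq> 0"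
  using W.zero[of z] by (auto simp: Phi_eq simp del: One_nat_def)

lemma Phi_lam: assumes "k \<ge> 1" shows "Phi \<tau> (of_real (lam k)) = 0"
proof -
  have "W.f (of_real (lam (Suc (k - 1)))) = 0"
    unfolding W.zero by blast
  then show ?thesis using assms by (simp add: Phi_eq)
qed

lemma Phi_times_reflection:
  assumes "\<And>z. (\<lambda>n. \<Prod>k=1..n. 1 - z\<^sup>2 / (complex_of_real (\<tau> k))\<^sup>2) \<longlonglongrightarrow> \<phi> z"
  shows "\<phi> z = Phi \<tau> z * Phi \<tau> (- z)"
proof -
  have "(\<lambda>n. (\<Prod>k=1..n. 1 + (-1) ^ k * (z / complex_of_real (\<tau> k))) *
      (\<Prod>k=1..n. 1 + (-1) ^ k * (- z / complex_of_real (\<tau> k)))) \<longlonglongrightarrow> Phi \<tau> z * Phi \<tau> (- z)"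
    by (intro tendsto_mult Phi_tendsto)
  moreover have "(\<Prod>k=1..n. 1 + (-1) ^ k * (z / complex_of_real (\<tau> k))) *
      (\<Prod>k=1..n. 1 + (-1) ^ k * (- z / complex_of_real (\<tau> k))) = (\<Prod>k=1..n. 1 - z\<^sup>2 / (complex_of_real (\<tau> k))\<^sup>2)" for n
  proof -
    have "(1 + (-1) ^ k * (z / complex_of_real (\<tau> k))) * (1 + (-1) ^ k * (- z / complex_of_real (\<tau> k)))
        = 1 - z\<^sup>2 / (complex_of_real (\<tau> k))\<^sup>2" for k
      by (cases "even k") (simp_all add: power2_eq_square algebra_simps)
    then show ?thesis by (simp only: prod.distrib[symmetric])
  qed
  ultimately show ?thesis
    using assms[of z] LIMSEQ_unique by simp
qed

section \<open>Logarithmic derivatives of the product\<close>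

definition Wn :: "nat \<Rightarrow> complex \<Rightarrow> complex" where
  "Wn n z = (\<Prod>k<n. weierstrass_factor 1 (z / of_real (lam (Suc k))))"

text \<open>The logarithmic derivative of \<open>Wn n\<close>: a genus-one factor with zero
  \<lambda> contributes 1/(z - \<lambda>) from its zero and 1/\<lambda> from its
  exponential.\<close>

definition Vn :: "nat \<Rightarrow> complex \<Rightarrow> complex" where
  "Vn n z = (\<Sum>k<n. 1 / (z - of_real (lam (Suc k))) + 1 / of_real (lam (Suc k)))"

lemma off_real_neq: "Im z \<noteq> 0 \<Longrightarrow> z - of_real x \<noteq> 0"
  by (auto simp: complex_eq_iff)

lemma Wn_has_derivative:
  assumes "Im z \<noteq> 0"
  shows "(Wn n has_field_derivative Vn n z * Wn n z) (at z)"
proof (induction n)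
  case 0
  then show ?case by (simp add: Wn_def[abs_def] Vn_def)
next
  case (Suc n)
  define a where "a = complex_of_real (lam (Suc n))"
  have a: "a \<noteq> 0" "z - a \<noteq> 0"
    using lam_nonzero[of "Suc n"] off_real_neq[OF assms] by (simp_all add: a_def)
  have "((\<lambda>z. weierstrass_factor 1 (z / a)) has_field_derivative
      (1 / (z - a) + 1 / a) * weierstrass_factor 1 (z / a)) (at z)"
    unfolding weierstrass_factor_def using a
    by (auto intro!: derivative_eq_intros simp: field_simps)
  then have "((\<lambda>z. Wn n z * weierstrass_factor 1 (z / a)) has_field_derivative
      Vn n z * Wn n z * weierstrass_factor 1 (z / a) +
      (1 / (z - a) + 1 / a) * weierstrass_factor 1 (z / a) * Wn n z) (at z)"
    by (rule DERIV_mult[OF Suc])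
  moreover have "Wn (Suc n) = (\<lambda>z. Wn n z * weierstrass_factor 1 (z / a))"
    by (simp add: Wn_def[abs_def] a_def)
  ultimately show ?case
    by (simp add: Vn_def a_def algebra_simps)
qed

lemma Vn_has_derivative:
  assumes "Im z \<noteq> 0"
  shows "(Vn n has_field_derivative - (\<Sum>k<n. 1 / (z - of_real (lam (Suc k)))\<^sup>2)) (at z)"
  unfolding Vn_def[abs_def] sum_negf[symmetric]
proof (rule DERIV_sum)
  fix k
  show "((\<lambda>z. 1 / (z - of_real (lam (Suc k))) + 1 / of_real (lam (Suc k))) has_field_derivative
      - (1 / (z - of_real (lam (Suc k)))\<^sup>2)) (at z)"
    using off_real_neq[OF assms] by (auto intro!: derivative_eq_intros simp: power2_eq_square)
qed

lemma open_off_real: "open {z. Im z \<noteq> 0}"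
  by (intro open_Collect_neq continuous_intros)

lemma Wn_deriv_tendsto: "(\<lambda>n. (deriv ^^ m) (Wn n) z) \<longlonglongrightarrow> (deriv ^^ m) W.f z"
proof (rule higher_deriv_complex_uniform_limit)
  show "uniform_limit (ball 0 (norm z + 1)) Wn W.f sequentially"
    unfolding Wn_def[abs_def] by (rule uniform_limit_on_subset[OF W.uniform_limit[of "norm z + 1"]])
      (auto simp: add_nonneg_pos)
  have "Wn n holomorphic_on ball 0 (norm z + 1)" for n
    unfolding Wn_def[abs_def] using lam_nonzero by (intro holomorphic_intros) auto
  then show "\<forall>\<^sub>F n in sequentially. Wn n holomorphic_on ball 0 (norm z + 1)"
    by simp
qed auto

text \<open>Locally uniform convergence passes to the derivatives of the canonical products, and
  division by nonzero values to their quotients. The exponential prefactor contributes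
  -\<open>lamsum\<close>, which cancels the terms 1/\<open>lam k\<close> and leaves bare partial
  fractions. The second limit is -(\<Phi>'/\<Phi>)', in which the prefactor drops out.\<close>

lemma Phi_log_derivatives:
  assumes z: "Im z \<noteq> 0"
  shows "(\<lambda>n. \<Sum>k=1..n. 1 / (z - of_real (lam k))) \<longlonglongrightarrow> deriv (Phi \<tau>) z / Phi \<tau> z"
    and "(\<lambda>n. \<Sum>k=1..n. 1 / (z - of_real (lam k))\<^sup>2) \<longlonglongrightarrow>
      (deriv (Phi \<tau>) z / Phi \<tau> z)\<^sup>2 - deriv (deriv (Phi \<tau>)) z / Phi \<tau> z"
proof -
  define f where "f = W.f"
  have f: "f holomorphic_on UNIV" unfolding f_def by (rule W.holomorphic)
  define b where "b = complex_of_real lamsum"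
  have Pe: "Phi \<tau> = (\<lambda>z. exp (- z * b) * f z)"
    using Phi_eq by (auto simp: f_def b_def)
  have fz: "f z \<noteq> 0" using Phi_nonzero[OF z] by (simp add: Pe)
  have df: "(f has_field_derivative deriv f z) (at z)" for z
    using f by (simp add: holomorphic_derivI)
  have ddf: "(deriv f has_field_derivative deriv (deriv f) z) (at z)" for z
    using holomorphic_deriv[OF f] by (simp add: holomorphic_derivI)
  have d1: "deriv (Phi \<tau>) = (\<lambda>z. exp (- z * b) * (deriv f z - b * f z))"
    unfolding Pe by (rule ext, rule DERIV_imp_deriv) (auto intro!: derivative_eq_intros df simp: algebra_simps)
  have d2: "deriv (deriv (Phi \<tau>)) z = exp (- z * b) * (deriv (deriv f) z - 2 * b * deriv f z + b\<^sup>2 * f z)"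
    unfolding d1 by (rule DERIV_imp_deriv)
      (auto intro!: derivative_eq_intros df ddf simp: algebra_simps power2_eq_square)
  have p0: "Phi \<tau> z = exp (- z * b) * f z"
    by (simp add: Pe)
  have p1: "deriv (Phi \<tau>) z = exp (- z * b) * (deriv f z - b * f z)"
    by (simp add: d1)
  have r1: "deriv (Phi \<tau>) z / Phi \<tau> z = deriv f z / f z - b"
    unfolding p0 p1 using fz by (simp add: field_simps)
  have r2: "(deriv (Phi \<tau>) z / Phi \<tau> z)\<^sup>2 - deriv (deriv (Phi \<tau>)) z / Phi \<tau> z
      = (deriv f z / f z)\<^sup>2 - deriv (deriv f) z / f z"
  proof -
    have "deriv (deriv (Phi \<tau>)) z / Phi \<tau> z = deriv (deriv f) z / f z - 2 * b * (deriv f z / f z) + b\<^sup>2"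
      unfolding d2 p0 using fz by (simp add: field_simps)
    then show ?thesis unfolding r1 by (simp add: power2_eq_square algebra_simps)
  qed
  have dW: "deriv (Wn n) w = Vn n w * Wn n w" if "Im w \<noteq> 0" for n w
    using Wn_has_derivative[OF that] by (rule DERIV_imp_deriv)
  have ddW: "deriv (deriv (Wn n)) z = - (\<Sum>k<n. 1 / (z - of_real (lam (Suc k)))\<^sup>2) * Wn n z + (Vn n z)\<^sup>2 * Wn n z" for n
  proof -
    have "((\<lambda>w. Vn n w * Wn n w) has_field_derivative
        - (\<Sum>k<n. 1 / (z - of_real (lam (Suc k)))\<^sup>2) * Wn n z + (Vn n z * Wn n z) * Vn n z) (at z)"
      by (rule DERIV_mult[OF Vn_has_derivative[OF z] Wn_has_derivative[OF z]])
    moreover have ev: "\<forall>\<^sub>F w in nhds z. deriv (Wn n) w = Vn n w * Wn n w"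
      using eventually_nhds_in_open[OF open_off_real, of z] z by (auto elim!: eventually_mono simp: dW)
    ultimately have "(deriv (Wn n) has_field_derivative
        - (\<Sum>k<n. 1 / (z - of_real (lam (Suc k)))\<^sup>2) * Wn n z + (Vn n z * Wn n z) * Vn n z) (at z)"
      using DERIV_cong_ev[OF refl ev refl] by simp
    then show ?thesis
      by (simp add: DERIV_imp_deriv power2_eq_square mult_ac)
  qed
  have t0: "(\<lambda>n. Wn n z) \<longlonglongrightarrow> f z" and t1: "(\<lambda>n. deriv (Wn n) z) \<longlonglongrightarrow> deriv f z"
    and t2: "(\<lambda>n. deriv (deriv (Wn n)) z) \<longlonglongrightarrow> deriv (deriv f) z"
    using Wn_deriv_tendsto[of 0 z] Wn_deriv_tendsto[of 1 z] Wn_deriv_tendsto[of 2 z]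
    by (simp_all add: f_def numeral_2_eq_2)
  have Wnz: "Wn n z \<noteq> 0" for n
    using off_real_neq[OF z, of "lam _"] lam_nonzero by (auto simp: Wn_def)
  have v1: "(\<lambda>n. Vn n z) \<longlonglongrightarrow> deriv f z / f z"
    using tendsto_divide[OF t1 t0 fz] Wnz by (simp add: dW[OF z])
  have "(\<lambda>n. (Vn n z)\<^sup>2 - deriv (deriv (Wn n)) z / Wn n z) \<longlonglongrightarrow> (deriv f z / f z)\<^sup>2 - deriv (deriv f) z / f z"
    by (intro tendsto_intros v1 t2 t0 fz)
  moreover have "(Vn n z)\<^sup>2 - deriv (deriv (Wn n)) z / Wn n z = (\<Sum>k=1..n. 1 / (z - of_real (lam k))\<^sup>2)" for n
  proof -
    have "deriv (deriv (Wn n)) z / Wn n z = (Vn n z)\<^sup>2 - (\<Sum>k<n. 1 / (z - of_real (lam (Suc k)))\<^sup>2)"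
      using Wnz[of n] by (simp add: ddW field_simps)
    moreover have "(\<Sum>k<n. 1 / (z - of_real (lam (Suc k)))\<^sup>2) = (\<Sum>k=1..n. 1 / (z - of_real (lam k))\<^sup>2)"
      by (rule sum.reindex_bij_witness[of _ "\<lambda>k. k - 1" Suc]) auto
    ultimately show ?thesis by simp
  qed
  ultimately show "(\<lambda>n. \<Sum>k=1..n. 1 / (z - of_real (lam k))\<^sup>2) \<longlonglongrightarrow>
      (deriv (Phi \<tau>) z / Phi \<tau> z)\<^sup>2 - deriv (deriv (Phi \<tau>)) z / Phi \<tau> z"
    unfolding r2 by simp
  have "(\<lambda>n. Vn n z - of_real (\<Sum>k=1..n. 1 / lam k)) \<longlonglongrightarrow> deriv f z / f z - b"
    unfolding b_def by (intro tendsto_intros v1 lamsum_tendsto)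
  moreover have "Vn n z - of_real (\<Sum>k=1..n. 1 / lam k) = (\<Sum>k=1..n. 1 / (z - of_real (lam k)))" for n
  proof -
    have "Vn n z = (\<Sum>k=1..n. 1 / (z - of_real (lam k)) + 1 / of_real (lam k))"
      unfolding Vn_def by (rule sum.reindex_bij_witness[of _ "\<lambda>k. k - 1" Suc]) auto
    then show ?thesis by (simp add: sum.distrib)
  qed
  ultimately show "(\<lambda>n. \<Sum>k=1..n. 1 / (z - of_real (lam k))) \<longlonglongrightarrow> deriv (Phi \<tau>) z / Phi \<tau> z"
    unfolding r1 by simp
qed

end

section \<open>Bounds for the logarithmic derivatives off the real axis\<close>

context alternating_zeros
begin

text \<open>The triangle inequality gives |x| \<le> |z - x| + |z|, and |z| \<le> |z - x| |z|/|Im z|.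
  Thus distances to the zeros may be replaced by the moduli of the zeros, at a cost that the weight
  in \<open>tame\<close> absorbs.\<close>

lemma inverse_dist_real_le:
  assumes "Im z \<noteq> 0" "x \<noteq> 0"
  shows "1 / norm (z - of_real x) \<le> (1 + norm z / \<bar>Im z\<bar>) / \<bar>x\<bar>"
proof -
  have ge: "\<bar>Im z\<bar> \<le> norm (z - of_real x)"
    using abs_Im_le_cmod[of "z - of_real x"] by simp
  then have pos: "norm (z - of_real x) > 0"
    using assms by linarith
  have "\<bar>x\<bar> \<le> norm (z - of_real x) + norm z"
    using norm_triangle_ineq4[of z "z - of_real x"] by simp
  also have "norm z \<le> norm (z - of_real x) * (norm z / \<bar>Im z\<bar>)"
    using mult_right_mono[OF ge, of "norm z / \<bar>Im z\<bar>"] assms by simp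
  finally have "\<bar>x\<bar> \<le> norm (z - of_real x) * (1 + norm z / \<bar>Im z\<bar>)"
    by (simp add: distrib_left)
  then show "1 / norm (z - of_real x) \<le> (1 + norm z / \<bar>Im z\<bar>) / \<bar>x\<bar>"
    using pos \<open>x \<noteq> 0\<close> by (simp add: divide_le_eq pos_le_divide_eq mult.commute)
qed

text \<open>The partial fractions are not absolutely summable. Writing 1/(z - \<lambda>) =
  z/(\<lambda>(z - \<lambda>)) - 1/\<lambda> separates a part dominated by the sum of the
  1/\<tau>_k^2 from the bounded partial sums of the alternating series.\<close>

lemma tame_log_derivative: "tame (\<lambda>z. deriv (Phi \<tau>) z / Phi \<tau> z)"
proof -
  obtain b where b: "\<And>n. \<bar>\<Sum>k=1..n. 1 / lam k\<bar> \<le> b"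
    using convergent_imp_Bseq[OF convergent_sum_inverse_lam] by (auto simp: Bseq_def)
  have "norm (deriv (Phi \<tau>) z / Phi \<tau> z) \<le> (b + 2 * T2) * ((1 + norm z) * (1 + 1 / \<bar>Im z\<bar>)) ^ 2"
    if z: "Im z \<noteq> 0" for z
  proof (rule LIMSEQ_le_const2[OF tendsto_norm[OF Phi_log_derivatives(1)[OF z]]], intro exI allI impI)
    fix n
    let ?w = "(1 + norm z) * (1 + 1 / \<bar>Im z\<bar>)"
    have eq: "1 / (z - of_real (lam k)) = z * (1 / (z - of_real (lam k))) * of_real (1 / lam k) - of_real (1 / lam k)"
      if "k \<in> {1..n}" for k
      using off_real_neq[OF z, of "lam k"] lam_nonzero[of k] that by (simp add: field_simps)
    have "(\<Sum>k=1..n. 1 / (z - of_real (lam k))) =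
        (\<Sum>k=1..n. z * (1 / (z - of_real (lam k))) * of_real (1 / lam k) - of_real (1 / lam k))"
      by (rule sum.cong[OF refl eq])
    also have "\<dots> = (\<Sum>k=1..n. z * (1 / (z - of_real (lam k))) * of_real (1 / lam k)) - of_real (\<Sum>k=1..n. 1 / lam k)"
      by (simp only: sum_subtractf of_real_sum)
    also have "norm \<dots> \<le> norm (\<Sum>k=1..n. z * (1 / (z - of_real (lam k))) * of_real (1 / lam k)) + norm (complex_of_real (\<Sum>k=1..n. 1 / lam k))"
      by (rule norm_triangle_ineq4)
    also have "norm (complex_of_real (\<Sum>k=1..n. 1 / lam k)) \<le> b"
      unfolding norm_of_real by (rule b)
    also have "norm (\<Sum>k=1..n. z * (1 / (z - of_real (lam k))) * of_real (1 / lam k)) \<le>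
        (\<Sum>k=1..n. (norm z * (1 + norm z / \<bar>Im z\<bar>)) * (1 / (\<tau> k)\<^sup>2))"
    proof (rule sum_norm_le)
      fix k assume k: "k \<in> {1..n}"
      have "norm (z * (1 / (z - of_real (lam k))) * of_real (1 / lam k)) = norm z * (1 / norm (z - of_real (lam k))) * (1 / \<bar>lam k\<bar>)"
        by (simp add: norm_mult norm_divide)
      also have "\<dots> \<le> norm z * ((1 + norm z / \<bar>Im z\<bar>) / \<bar>lam k\<bar>) * (1 / \<bar>lam k\<bar>)"
        using inverse_dist_real_le[OF z, of "lam k"] lam_nonzero[of k] k
        by (intro mult_right_mono mult_left_mono) auto
      also have "\<dots> = (norm z * (1 + norm z / \<bar>Im z\<bar>)) * (1 / (\<tau> k)\<^sup>2)"
        using k by (simp add: abs_lam power2_eq_square)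
      finally show "norm (z * (1 / (z - of_real (lam k))) * of_real (1 / lam k)) \<le> \<dots>" .
    qed
    also have "\<dots> = (norm z * (1 + norm z / \<bar>Im z\<bar>)) * (\<Sum>k=1..n. 1 / (\<tau> k)\<^sup>2)"
      by (simp only: sum_distrib_left)
    also have "\<dots> \<le> (?w * (2 * ?w)) * T2"
    proof (intro mult_mono sum_inverse_tau_square_le)
      show "norm z \<le> ?w" using tame_weight_ge[OF z] by blast
      show "1 + norm z / \<bar>Im z\<bar> \<le> 2 * ?w"
        using tame_weight_ge[OF z] by linarith
    qed (use z in \<open>auto intro: sum_nonneg\<close>)
    also have "b \<le> b * ?w ^ 2"
    proof -
      have "0 \<le> b" using order_trans[OF abs_ge_zero b[of 0]] .
      moreover have "1 \<le> ?w ^ 2" using tame_weight_ge(1)[OF z] by (rule one_le_power)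
      ultimately show ?thesis using mult_left_mono[of 1 "?w ^ 2" b] by simp
    qed
    finally have "norm (\<Sum>k=1..n. 1 / (z - of_real (lam k))) \<le> (?w * (2 * ?w)) * T2 + b * ?w ^ 2"
      by simp
    moreover have "(x * (2 * x)) * T2 + b * x ^ 2 = (b + 2 * T2) * x ^ 2" for x
      by (simp add: power2_eq_square algebra_simps)
    ultimately show "norm (\<Sum>k=1..n. 1 / (z - of_real (lam k))) \<le> (b + 2 * T2) * ?w ^ 2"
      by (simp only:)
  qed
  then show ?thesis unfolding tame_def by blast
qed

text \<open>The derivative of \<Phi>'/\<Phi> is, up to sign, an absolutely convergent sum of inverse
  squares, and \<Phi>''/\<Phi> is recovered from it and from the square of \<Phi>'/\<Phi>.\<close>

lemma tame_log_derivative2: "tame (\<lambda>z. deriv (deriv (Phi \<tau>)) z / Phi \<tau> z)"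
proof -
  have "tame (\<lambda>z. (deriv (Phi \<tau>) z / Phi \<tau> z)\<^sup>2 - deriv (deriv (Phi \<tau>)) z / Phi \<tau> z)"
    unfolding tame_def
  proof (intro exI allI impI)
    fix z :: complex assume z: "Im z \<noteq> 0"
    let ?w = "(1 + norm z) * (1 + 1 / \<bar>Im z\<bar>)"
    show "norm ((deriv (Phi \<tau>) z / Phi \<tau> z)\<^sup>2 - deriv (deriv (Phi \<tau>)) z / Phi \<tau> z) \<le> (4 * T2) * ?w ^ 2"
    proof (rule LIMSEQ_le_const2[OF tendsto_norm[OF Phi_log_derivatives(2)[OF z]]], intro exI allI impI)
      fix n
      have "norm (\<Sum>k=1..n. 1 / (z - of_real (lam k))\<^sup>2) \<le> (\<Sum>k=1..n. (2 * ?w)\<^sup>2 * (1 / (\<tau> k)\<^sup>2))"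
      proof (rule sum_norm_le)
        fix k assume k: "k \<in> {1..n}"
        have "1 / norm (z - of_real (lam k)) \<le> (1 + norm z / \<bar>Im z\<bar>) / \<bar>lam k\<bar>"
          using inverse_dist_real_le[OF z, of "lam k"] lam_nonzero[of k] k by auto
        also have "\<dots> \<le> (2 * ?w) / \<bar>lam k\<bar>"
          using tame_weight_ge[OF z] by (intro divide_right_mono) auto
        finally have "(1 / norm (z - of_real (lam k)))\<^sup>2 \<le> ((2 * ?w) / \<bar>lam k\<bar>)\<^sup>2"
          by (intro power_mono) auto
        then show "norm (1 / (z - of_real (lam k))\<^sup>2) \<le> (2 * ?w)\<^sup>2 * (1 / (\<tau> k)\<^sup>2)"
          by (simp add: norm_divide norm_power power_divide)
      qed
      also have "\<dots> = (2 * ?w)\<^sup>2 * (\<Sum>k=1..n. 1 / (\<tau> k)\<^sup>2)"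
        by (simp only: sum_distrib_left)
      also have "\<dots> \<le> (2 * ?w)\<^sup>2 * T2"
        by (intro mult_left_mono sum_inverse_tau_square_le) auto
      finally show "norm (\<Sum>k=1..n. 1 / (z - of_real (lam k))\<^sup>2) \<le> (4 * T2) * ?w ^ 2"
        by (simp add: power_mult_distrib mult_ac)
    qed
  qed
  from tame_diff[OF tame_power[OF tame_log_derivative, of 2] this] show ?thesis
    by (simp only: diff_diff_eq2 add_diff_cancel_left')
qed

text \<open>
  Along the imaginary axis the real part of the logarithmic derivative is an alternating sum of values of
  \<open>t \<mapsto> t / (y\<^sup>2 + t\<^sup>2)\<close>, controlled by the total variation of this function, which \<open>arctan (t / y) / y\<close> dominates.
\<close>

lemma kernel_variation:
  assumes "(y::real) > 0" "s \<le> t"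
  shows "\<bar>t / (y\<^sup>2 + t\<^sup>2) - s / (y\<^sup>2 + s\<^sup>2)\<bar> \<le> (arctan (t / y) - arctan (s / y)) / y"
proof -
  have pos: "y\<^sup>2 + u\<^sup>2 > 0" for u
    using assms by (simp add: add_pos_nonneg)
  have dk: "((\<lambda>u. u / (y\<^sup>2 + u\<^sup>2)) has_real_derivative (y\<^sup>2 - u\<^sup>2) / (y\<^sup>2 + u\<^sup>2)\<^sup>2) (at u)" for u
    using pos[of u] by (auto intro!: derivative_eq_intros simp: power2_eq_square algebra_simps)
  have da: "((\<lambda>u. arctan (u / y) / y) has_real_derivative 1 / (y\<^sup>2 + u\<^sup>2)) (at u)" for u
  proof -
    have "((\<lambda>u. arctan (u / y) / y) has_real_derivative (1 / y * inverse (1 + (u / y)\<^sup>2)) / y) (at u)"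
      using assms by (auto intro!: derivative_eq_intros)
    moreover have "(1 / y * inverse (1 + (u / y)\<^sup>2)) / y = 1 / (y\<^sup>2 + u\<^sup>2)"
      using assms pos[of u] by (simp add: power_divide divide_simps) (simp add: power2_eq_square)
    ultimately show ?thesis by simp
  qed
  have e: "1 / (y\<^sup>2 + u\<^sup>2) = (y\<^sup>2 + u\<^sup>2) / (y\<^sup>2 + u\<^sup>2)\<^sup>2" for u
    using pos[of u] by (simp add: power2_eq_square)
  have "arctan (s / y) / y - s / (y\<^sup>2 + s\<^sup>2) \<le> arctan (t / y) / y - t / (y\<^sup>2 + t\<^sup>2)"
  proof (rule DERIV_nonneg_imp_nondecreasing[OF assms(2)])
    fix u
    have "1 / (y\<^sup>2 + u\<^sup>2) - (y\<^sup>2 - u\<^sup>2) / (y\<^sup>2 + u\<^sup>2)\<^sup>2 \<ge> 0"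
      unfolding e diff_divide_distrib[symmetric] by simp
    then show "\<exists>d. ((\<lambda>u. arctan (u / y) / y - u / (y\<^sup>2 + u\<^sup>2)) has_real_derivative d) (at u) \<and> 0 \<le> d"
      using DERIV_diff[OF da dk] by blast
  qed
  moreover have "arctan (s / y) / y + s / (y\<^sup>2 + s\<^sup>2) \<le> arctan (t / y) / y + t / (y\<^sup>2 + t\<^sup>2)"
  proof (rule DERIV_nonneg_imp_nondecreasing[OF assms(2)])
    fix u
    have "1 / (y\<^sup>2 + u\<^sup>2) + (y\<^sup>2 - u\<^sup>2) / (y\<^sup>2 + u\<^sup>2)\<^sup>2 \<ge> 0"
      unfolding e add_divide_distrib[symmetric] by simp
    then show "\<exists>d. ((\<lambda>u. arctan (u / y) / y + u / (y\<^sup>2 + u\<^sup>2)) has_real_derivative d) (at u) \<and> 0 \<le> d"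
      using DERIV_add[OF da dk] by blast
  qed
  ultimately show ?thesis
    by (simp add: diff_divide_distrib abs_le_iff)
qed

text \<open>Induction in steps of two: neighbouring terms carry opposite signs, so a pair
  contributes only an increment of b.\<close>

lemma alternating_sum_variation:
  fixes b :: "nat \<Rightarrow> real"
  shows "\<bar>\<Sum>k=1..n. (-1) ^ k * b k\<bar> \<le> \<bar>b 1\<bar> + (\<Sum>k=1..<n. \<bar>b (Suc k) - b k\<bar>)"
proof (induction n rule: induct_nat_012)
  case (ge2 n)
  show ?case
  proof (cases "n = 0")
    case True
    then show ?thesis by (simp add: numeral_2_eq_2)
  next
    case False
    have "(\<Sum>k=1..Suc (Suc n). (-1) ^ k * b k) = (\<Sum>k=1..n. (-1) ^ k * b k) + (-1) ^ n * (b (Suc (Suc n)) - b (Suc n))"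
      by (simp add: algebra_simps)
    then have "\<bar>\<Sum>k=1..Suc (Suc n). (-1) ^ k * b k\<bar> \<le> \<bar>\<Sum>k=1..n. (-1) ^ k * b k\<bar> + \<bar>b (Suc (Suc n)) - b (Suc n)\<bar>"
      using abs_triangle_ineq[of "\<Sum>k=1..n. (-1) ^ k * b k" "(-1) ^ n * (b (Suc (Suc n)) - b (Suc n))"]
      by (simp only: abs_mult power_abs abs_neg_one power_one mult_1)
    also have "\<dots> \<le> \<bar>b 1\<bar> + (\<Sum>k=1..<n. \<bar>b (Suc k) - b k\<bar>) + \<bar>b (Suc (Suc n)) - b (Suc n)\<bar>"
      using ge2(1) by simp
    also have "\<dots> \<le> \<bar>b 1\<bar> + (\<Sum>k=1..<Suc (Suc n). \<bar>b (Suc k) - b k\<bar>)"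
      using False by simp
    finally show ?thesis .
  qed
qed auto

text \<open>The 1 pays for the first term, the pi for the total variation of the kernel, since
  arctan ranges over an interval of length pi. The bound is uniform in n, so it survives the
  limit.\<close>

lemma alternating_kernel_sum_le:
  assumes y: "(y::real) > 0"
  shows "\<bar>\<Sum>k=1..n. lam k / (y\<^sup>2 + (\<tau> k)\<^sup>2)\<bar> \<le> (1 + pi) / y"
proof -
  define b where "b = (\<lambda>k. \<tau> k / (y\<^sup>2 + (\<tau> k)\<^sup>2))"
  have "(\<Sum>k=1..n. lam k / (y\<^sup>2 + (\<tau> k)\<^sup>2)) = - (\<Sum>k=1..n. (-1) ^ k * b k)"
    unfolding sum_negf[symmetric] by (intro sum.cong) (simp_all add: lam_def b_def)
  then have "\<bar>\<Sum>k=1..n. lam k / (y\<^sup>2 + (\<tau> k)\<^sup>2)\<bar> \<le> \<bar>b 1\<bar> + (\<Sum>k=1..<n. \<bar>b (Suc k) - b k\<bar>)"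
    using alternating_sum_variation[where b = b and n = n] by simp
  also have "\<bar>b 1\<bar> \<le> 1 / y"
  proof -
    have "y * \<tau> 1 \<le> y\<^sup>2 + (\<tau> 1)\<^sup>2"
      using mult_nonneg_nonneg[of y "\<tau> 1"] y tau_pos[of 1] zero_le_power2[of "y - \<tau> 1"]
      unfolding power2_diff by linarith
    moreover have "y\<^sup>2 + (\<tau> 1)\<^sup>2 > 0" using y by (simp add: add_pos_nonneg)
    ultimately show ?thesis
      using y tau_pos[of 1] by (simp add: b_def abs_mult field_simps)
  qed
  also have "(\<Sum>k=1..<n. \<bar>b (Suc k) - b k\<bar>) \<le> (\<Sum>k=1..<n. arctan (\<tau> (Suc k) / y) / y - arctan (\<tau> k / y) / y)"
  proof (rule sum_mono)
    fix k assume "k \<in> {1..<n}"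
    then have "\<tau> k \<le> \<tau> (Suc k)"
      using tau_mono by (auto simp: strict_mono_on_def less_imp_le)
    then show "\<bar>b (Suc k) - b k\<bar> \<le> arctan (\<tau> (Suc k) / y) / y - arctan (\<tau> k / y) / y"
      using kernel_variation[OF y] by (simp add: b_def diff_divide_distrib)
  qed
  also have "\<dots> \<le> pi / y"
  proof (cases "n \<ge> 1")
    case True
    have "(\<Sum>k=1..<n. arctan (\<tau> (Suc k) / y) / y - arctan (\<tau> k / y) / y) = arctan (\<tau> n / y) / y - arctan (\<tau> 1 / y) / y"
      using sum_Suc_diff'[OF True, of "\<lambda>k. arctan (\<tau> k / y) / y"] by simp
    also have "\<dots> = (arctan (\<tau> n / y) - arctan (\<tau> 1 / y)) / y"
      by (simp add: diff_divide_distrib)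
    also have "\<dots> \<le> pi / y"
      using y arctan_ubound[of "\<tau> n / y"] arctan_lbound[of "\<tau> 1 / y"] by (intro divide_right_mono) auto
    finally show ?thesis .
  qed (use y in simp)
  finally show ?thesis
    by (simp add: add_divide_distrib)
qed

text \<open>Integral test: the decreasing kernel u \<mapsto> y/(y^2 + (cu)^2) has the antiderivative
  arctan(cu/y)/c, and the mean value theorem compares its increments with the terms of the
  sum.\<close>

lemma arctan_sum_bounds:
  assumes y: "(y::real) > 0" and c: "c > 0"
  shows "(\<Sum>k=1..n. y / (y\<^sup>2 + (c * real k)\<^sup>2)) \<le> arctan (c * real n / y) / c"
    "arctan (c * real (Suc n) / y) / c - arctan (c / y) / c \<le> (\<Sum>k=1..n. y / (y\<^sup>2 + (c * real k)\<^sup>2))"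
proof -
  have pos: "y\<^sup>2 + (c * u)\<^sup>2 > 0" for u
    using y by (simp add: add_pos_nonneg)
  have da: "((\<lambda>u. arctan (c * u / y) / c) has_real_derivative y / (y\<^sup>2 + (c * u)\<^sup>2)) (at u)" for u
  proof -
    have "((\<lambda>u. arctan (c * u / y) / c) has_real_derivative (c / y * inverse (1 + (c * u / y)\<^sup>2)) / c) (at u)"
      using y c by (auto intro!: derivative_eq_intros)
    moreover have "(c / y * inverse (1 + (c * u / y)\<^sup>2)) / c = y / (y\<^sup>2 + (c * u)\<^sup>2)"
      using y c pos[of u] by (simp add: power_divide divide_simps) (simp add: power2_eq_square algebra_simps)
    ultimately show ?thesis by simp
  qed
  have step: "y / (y\<^sup>2 + (c * real (Suc k))\<^sup>2) \<le> arctan (c * real (Suc k) / y) / c - arctan (c * real k / y) / c"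
    "arctan (c * real (Suc k) / y) / c - arctan (c * real k / y) / c \<le> y / (y\<^sup>2 + (c * real k)\<^sup>2)" for k
  proof -
    obtain u where u: "real k < u" "u < real (Suc k)"
      "arctan (c * real (Suc k) / y) / c - arctan (c * real k / y) / c = (real (Suc k) - real k) * (y / (y\<^sup>2 + (c * u)\<^sup>2))"
      using MVT2[of "real k" "real (Suc k)" "\<lambda>u. arctan (c * u / y) / c" "\<lambda>u. y / (y\<^sup>2 + (c * u)\<^sup>2)"] da by auto
    have "(c * u)\<^sup>2 \<le> (c * real (Suc k))\<^sup>2" "(c * real k)\<^sup>2 \<le> (c * u)\<^sup>2"
      using u c by (auto intro!: power_mono mult_left_mono)
    then have "y / (y\<^sup>2 + (c * real (Suc k))\<^sup>2) \<le> y / (y\<^sup>2 + (c * u)\<^sup>2)" "y / (y\<^sup>2 + (c * u)\<^sup>2) \<le> y / (y\<^sup>2 + (c * real k)\<^sup>2)"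
      using y pos by (intro divide_left_mono; simp add: mult_pos_pos)+
    then show "y / (y\<^sup>2 + (c * real (Suc k))\<^sup>2) \<le> arctan (c * real (Suc k) / y) / c - arctan (c * real k / y) / c"
      "arctan (c * real (Suc k) / y) / c - arctan (c * real k / y) / c \<le> y / (y\<^sup>2 + (c * real k)\<^sup>2)"
      unfolding u(3) by simp_all
  qed
  show "(\<Sum>k=1..n. y / (y\<^sup>2 + (c * real k)\<^sup>2)) \<le> arctan (c * real n / y) / c"
  proof (induction n)
    case (Suc n)
    then show ?case using step(1)[of n] by simp
  qed simp
  show "arctan (c * real (Suc n) / y) / c - arctan (c / y) / c \<le> (\<Sum>k=1..n. y / (y\<^sup>2 + (c * real k)\<^sup>2))"
  proof (induction n)
    case (Suc n)
    then show ?case using step(2)[of "Suc n"] by simp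
  qed simp
qed

end

subsection \<open>Asymptotics on the imaginary axis\<close>

context alternating_zeros
begin

text \<open>For y > 0 this is -Im(\<Phi>'/\<Phi>) at iy; the signs of the zeros drop out because
  only their squares enter.\<close>

definition density :: "real \<Rightarrow> real" where
  "density y = (\<Sum>k. y / (y\<^sup>2 + (\<tau> (Suc k))\<^sup>2))"

lemma density_sums:
  assumes "y > 0"
  shows "(\<lambda>n. \<Sum>k=1..n. y / (y\<^sup>2 + (\<tau> k)\<^sup>2)) \<longlonglongrightarrow> density y"
proof -
  have "summable (\<lambda>k. y / (y\<^sup>2 + (\<tau> (Suc k))\<^sup>2))"
  proof (rule summable_comparison_test')
    show "summable (\<lambda>k. y * (1 / (\<tau> (Suc k))\<^sup>2))"
      by (intro summable_mult summable_inverse_tau_square)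
    fix k
    have "0 < (\<tau> (Suc k))\<^sup>2" using tau_pos[of "Suc k"] by simp
    then show "norm (y / (y\<^sup>2 + (\<tau> (Suc k))\<^sup>2)) \<le> y * (1 / (\<tau> (Suc k))\<^sup>2)"
      using assms by (simp add: frac_le)
  qed
  then have "(\<lambda>n. \<Sum>k<n. y / (y\<^sup>2 + (\<tau> (Suc k))\<^sup>2)) \<longlonglongrightarrow> density y"
    unfolding density_def by (rule summable_LIMSEQ)
  moreover have "(\<Sum>k<n. y / (y\<^sup>2 + (\<tau> (Suc k))\<^sup>2)) = (\<Sum>k=1..n. y / (y\<^sup>2 + (\<tau> k)\<^sup>2))" for n
    by (rule sum.reindex_bij_witness[of _ "\<lambda>k. k - 1" Suc]) auto
  ultimately show ?thesis by simp
qed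

lemma head_sum_le:
  assumes "(y::real) > 0"
  shows "(\<Sum>k=1..n. if k < k0 then 1 / y else 0) \<le> real k0 / y"
proof -
  have "(\<Sum>k=1..n. if k < k0 then 1 / y else 0) = (\<Sum>k\<in>{1..n} \<inter> {..<k0}. 1 / y)"
    by (simp only: sum.inter_restrict[OF finite_atLeastAtMost] lessThan_iff)
  also have "\<dots> \<le> (\<Sum>k\<in>{..<k0}. 1 / y)"
    using assms by (intro sum_mono2) auto
  finally show ?thesis by simp
qed

lemma term_le_inverse:
  assumes "(y::real) > 0"
  shows "y / (y\<^sup>2 + x\<^sup>2) \<le> 1 / y"
proof -
  have "y / (y\<^sup>2 + x\<^sup>2) \<le> y / y\<^sup>2"
    using assms by (intro divide_left_mono mult_pos_pos add_pos_nonneg) auto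
  then show ?thesis using assms by (simp add: power2_eq_square)
qed

text \<open>From some index on \<tau>_k \<ge> ck, where comparison with the arctan bound applies;
  each of the finitely many earlier terms is at most 1/y.\<close>

lemma density_upper:
  assumes c: "0 < c" "c < pi"
  obtains k0 where "\<And>y. y > 0 \<Longrightarrow> density y \<le> real k0 / y + pi / (2 * c)"
proof -
  obtain k0 where k0: "\<And>k. k \<ge> k0 \<Longrightarrow> c * real k \<le> \<tau> k"
    using tau_between[of c 4] c pi_less_4 by metis
  have "density y \<le> real k0 / y + pi / (2 * c)" if y: "y > 0" for y
  proof (rule LIMSEQ_le_const2[OF density_sums[OF y]], intro exI allI impI)
    fix n
    have "(\<Sum>k=1..n. y / (y\<^sup>2 + (\<tau> k)\<^sup>2)) \<le> (\<Sum>k=1..n. y / (y\<^sup>2 + (c * real k)\<^sup>2) + (if k < k0 then 1 / y else 0))"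
    proof (rule sum_mono)
      fix k
      have pos: "y\<^sup>2 + (c * real k)\<^sup>2 > 0" using y by (simp add: add_pos_nonneg)
      show "y / (y\<^sup>2 + (\<tau> k)\<^sup>2) \<le> y / (y\<^sup>2 + (c * real k)\<^sup>2) + (if k < k0 then 1 / y else 0)"
      proof (cases "k < k0")
        case True
        have "0 \<le> y / (y\<^sup>2 + (c * real k)\<^sup>2)" using y pos by (intro divide_nonneg_pos) auto
        then show ?thesis using term_le_inverse[OF y, of "\<tau> k"] True by simp
      next
        case False
        then have "(c * real k)\<^sup>2 \<le> (\<tau> k)\<^sup>2"
          using k0[of k] c by (intro power_mono) auto
        then show ?thesis using False y pos by (simp add: frac_le)
      qed
    qed
    also have "\<dots> \<le> arctan (c * real n / y) / c + real k0 / y"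
      unfolding sum.distrib by (intro add_mono arctan_sum_bounds head_sum_le y c)
    also have "arctan (c * real n / y) / c \<le> (pi / 2) / c"
      using c arctan_ubound[of "c * real n / y"] by (intro divide_right_mono) auto
    finally show "(\<Sum>k=1..n. y / (y\<^sup>2 + (\<tau> k)\<^sup>2)) \<le> real k0 / y + pi / (2 * c)"
      by simp
  qed
  then show ?thesis using that by blast
qed

lemma density_lower:
  assumes c: "c > pi"
  obtains k0 where "\<And>y. y > 0 \<Longrightarrow> pi / (2 * c) - arctan (c / y) / c - real k0 / y \<le> density y"
proof -
  have c0: "c > 0" using c pi_gt_zero by linarith
  obtain k0 where k0: "k0 \<ge> 1" "\<And>k. k \<ge> k0 \<Longrightarrow> \<tau> k \<le> c * real k"
    using tau_between[of 1 c] c pi_gt3 by (metis less_trans numeral_eq_one_iff one_less_numeral_iff semiring_norm(77))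
  have "pi / (2 * c) - arctan (c / y) / c - real k0 / y \<le> density y" if y: "y > 0" for y
  proof (rule LIMSEQ_le[OF _ density_sums[OF y]])
    have "filterlim (\<lambda>n. (c / y) * real (Suc n)) at_top at_top"
      using c0 y by (intro filterlim_tendsto_pos_mult_at_top[OF tendsto_const] filterlim_compose[OF filterlim_real_sequentially filterlim_Suc]) auto
    then have "(\<lambda>n. arctan (c * real (Suc n) / y)) \<longlonglongrightarrow> pi / 2"
      using filterlim_compose[OF tendsto_arctan_at_top] by fastforce
    then have "(\<lambda>n. arctan (c * real (Suc n) / y) / c - arctan (c / y) / c - real k0 / y) \<longlonglongrightarrow> pi / 2 / c - arctan (c / y) / c - real k0 / y"
      using c0 by (intro tendsto_intros) auto
    then show "(\<lambda>n. arctan (c * real (Suc n) / y) / c - arctan (c / y) / c - real k0 / y) \<longlonglongrightarrow> pi / (2 * c) - arctan (c / y) / c - real k0 / y"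
      by simp
    have "arctan (c * real (Suc n) / y) / c - arctan (c / y) / c - real k0 / y \<le> (\<Sum>k=1..n. y / (y\<^sup>2 + (\<tau> k)\<^sup>2))" for n
    proof -
      have "(\<Sum>k=1..n. y / (y\<^sup>2 + (c * real k)\<^sup>2)) \<le> (\<Sum>k=1..n. y / (y\<^sup>2 + (\<tau> k)\<^sup>2) + (if k < k0 then 1 / y else 0))"
      proof (rule sum_mono)
        fix k assume k: "k \<in> {1..n}"
        have pos: "y\<^sup>2 + (\<tau> k)\<^sup>2 > 0" using y by (simp add: add_pos_nonneg)
        show "y / (y\<^sup>2 + (c * real k)\<^sup>2) \<le> y / (y\<^sup>2 + (\<tau> k)\<^sup>2) + (if k < k0 then 1 / y else 0)"
        proof (cases "k < k0")
          case True
          have "0 \<le> y / (y\<^sup>2 + (\<tau> k)\<^sup>2)" using y pos by (intro divide_nonneg_pos) auto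
          then show ?thesis using term_le_inverse[OF y, of "c * real k"] True by simp
        next
          case False
          then have "(\<tau> k)\<^sup>2 \<le> (c * real k)\<^sup>2"
            using k0(2)[of k] tau_pos[of k] k by (intro power_mono) auto
          then show ?thesis using False y pos by (simp add: frac_le)
        qed
      qed
      also have "\<dots> \<le> (\<Sum>k=1..n. y / (y\<^sup>2 + (\<tau> k)\<^sup>2)) + real k0 / y"
        unfolding sum.distrib by (intro add_left_mono head_sum_le y)
      finally show ?thesis
        using arctan_sum_bounds(2)[OF y c0, of n] by linarith
    qed
    then show "\<exists>N. \<forall>n\<ge>N. arctan (c * real (Suc n) / y) / c - arctan (c / y) / c - real k0 / y \<le> (\<Sum>k=1..n. y / (y\<^sup>2 + (\<tau> k)\<^sup>2))"
      by blast
  qed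
  then show ?thesis using that by blast
qed

text \<open>pi/(2c) tends to 1/2 as c tends to pi from either side; this is where the density 1/pi
  of the zeros enters.\<close>

lemma density_tendsto: "(density \<longlongrightarrow> 1 / 2) at_top"
proof (rule order_tendstoI)
  fix a :: real assume a: "a < 1 / 2"
  define a' where "a' = max a 0"
  \<comment> \<open>Chosen so that pi/(2c) is the midpoint of \<open>a'\<close> and 1/2; passing
    from \<open>a\<close> to \<open>a'\<close> \<ge> 0 keeps c positive.\<close>
  define c where "c = pi / (a' + 1 / 2)"
  have a': "0 \<le> a'" "a' < 1 / 2" "a \<le> a'" using a by (auto simp: a'_def)
  have c: "c > pi" using a' pi_gt_zero by (simp add: c_def less_divide_eq mult_less_cancel_left1)
  obtain k0 where k0: "\<And>y. y > 0 \<Longrightarrow> pi / (2 * c) - arctan (c / y) / c - real k0 / y \<le> density y"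
    using density_lower[OF c] by blast
  have "((\<lambda>y. c / y) \<longlongrightarrow> 0) at_top" "((\<lambda>y. real k0 / y) \<longlongrightarrow> 0) at_top"
    by (intro tendsto_divide_0[OF tendsto_const] filterlim_at_top_imp_at_infinity filterlim_ident)+
  then have "((\<lambda>y. pi / (2 * c) - arctan (c / y) / c - real k0 / y) \<longlongrightarrow> pi / (2 * c) - arctan 0 / c - 0) at_top"
    using c pi_gt_zero by (intro tendsto_intros) auto
  moreover have "pi / (2 * c) - arctan 0 / c - 0 > a"
  proof -
    have "pi / (2 * c) = (a' + 1 / 2) / 2" using a' by (simp add: c_def)
    then show ?thesis using a' by simp
  qed
  ultimately have "\<forall>\<^sub>F y in at_top. a < pi / (2 * c) - arctan (c / y) / c - real k0 / y"
    by (rule order_tendstoD(1))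
  then show "\<forall>\<^sub>F y in at_top. a < density y"
    using eventually_gt_at_top[of 0] by eventually_elim (use k0 less_le_trans in blast)
next
  fix a :: real assume a: "a > 1 / 2"
  define c where "c = pi / (a + 1 / 2)"
  have c: "0 < c" "c < pi" using a by (simp_all add: c_def divide_less_eq mult_less_cancel_left1 not_le)
  obtain k0 where k0: "\<And>y. y > 0 \<Longrightarrow> density y \<le> real k0 / y + pi / (2 * c)"
    using density_upper[OF c] by blast
  have "((\<lambda>y. real k0 / y) \<longlongrightarrow> 0) at_top"
    by (intro tendsto_divide_0[OF tendsto_const] filterlim_at_top_imp_at_infinity filterlim_ident)
  then have "((\<lambda>y. real k0 / y + pi / (2 * c)) \<longlongrightarrow> 0 + pi / (2 * c)) at_top"
    by (intro tendsto_intros)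
  moreover have "0 + pi / (2 * c) < a"
  proof -
    have "pi / (2 * c) = (a + 1 / 2) / 2" using a by (simp add: c_def)
    then show ?thesis using a by simp
  qed
  ultimately have "\<forall>\<^sub>F y in at_top. real k0 / y + pi / (2 * c) < a"
    by (rule order_tendstoD(2))
  then show "\<forall>\<^sub>F y in at_top. density y < a"
    using eventually_gt_at_top[of 0] by eventually_elim (use k0 le_less_trans in blast)
qed

text \<open>The imaginary part is -\<open>density y\<close> and hence tends to -1/2; the real part
  is the alternating kernel sum, which is O(1/y).\<close>

lemma log_derivative_imag_axis: "((\<lambda>y. deriv (Phi \<tau>) (\<i> * of_real y) / Phi \<tau> (\<i> * of_real y)) \<longlongrightarrow> - \<i> / 2) at_top"
proof -
  have eq: "norm (deriv (Phi \<tau>) (\<i> * of_real y) / Phi \<tau> (\<i> * of_real y) + \<i> * of_real (density y)) \<le> (1 + pi) / y"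
    if y: "y > 0" for y
  proof (rule LIMSEQ_le_const2, rule tendsto_norm, rule tendsto_add)
    have z: "Im (\<i> * of_real y) \<noteq> 0" using y by simp
    show "(\<lambda>n. \<Sum>k=1..n. 1 / (\<i> * of_real y - of_real (lam k))) \<longlonglongrightarrow> deriv (Phi \<tau>) (\<i> * of_real y) / Phi \<tau> (\<i> * of_real y)"
      by (rule Phi_log_derivatives(1)[OF z])
    show "(\<lambda>n. \<i> * of_real (\<Sum>k=1..n. y / (y\<^sup>2 + (\<tau> k)\<^sup>2))) \<longlonglongrightarrow> \<i> * of_real (density y)"
      by (intro tendsto_intros density_sums y)
    have "(\<Sum>k=1..n. 1 / (\<i> * of_real y - of_real (lam k))) + \<i> * of_real (\<Sum>k=1..n. y / (y\<^sup>2 + (\<tau> k)\<^sup>2))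
        = - of_real (\<Sum>k=1..n. lam k / (y\<^sup>2 + (\<tau> k)\<^sup>2))" for n
    proof -
      have "1 / (\<i> * of_real y - of_real (lam k)) = - \<i> * of_real (y / (y\<^sup>2 + (\<tau> k)\<^sup>2)) - of_real (lam k / (y\<^sup>2 + (\<tau> k)\<^sup>2))" for k
      proof -
        have nz: "y\<^sup>2 + (\<tau> k)\<^sup>2 \<noteq> 0"
          using y by (simp add: sum_power2_eq_zero_iff)
        have "(\<i> * of_real y - of_real (lam k)) * (- \<i> * of_real y - of_real (lam k)) = of_real (y\<^sup>2 + (\<tau> k)\<^sup>2)"
          unfolding lam_square[symmetric] by (simp add: power2_eq_square algebra_simps)
        moreover have "\<i> * of_real y - of_real (lam k) \<noteq> 0"
          using off_real_neq[OF z] .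
        ultimately have "1 / (\<i> * of_real y - of_real (lam k)) = (- \<i> * of_real y - of_real (lam k)) / of_real (y\<^sup>2 + (\<tau> k)\<^sup>2)"
          using nz by (metis (no_types, lifting) nonzero_divide_mult_cancel_left nonzero_eq_divide_eq mult.commute mult_zero_right div_by_0 of_real_eq_0_iff)
        then show ?thesis
          by (simp add: diff_divide_distrib)
      qed
      then show ?thesis
        by (simp add: sum_subtractf sum_negf sum_distrib_left)
    qed
    then have "norm ((\<Sum>k=1..n. 1 / (\<i> * of_real y - of_real (lam k))) + \<i> * of_real (\<Sum>k=1..n. y / (y\<^sup>2 + (\<tau> k)\<^sup>2))) \<le> (1 + pi) / y" for n
      using alternating_kernel_sum_le[OF y, of n] by (simp only: norm_minus_cancel norm_of_real)
    then show "\<exists>N. \<forall>n\<ge>N. norm ((\<Sum>k=1..n. 1 / (\<i> * of_real y - of_real (lam k))) + \<i> * of_real (\<Sum>k=1..n. y / (y\<^sup>2 + (\<tau> k)\<^sup>2))) \<le> (1 + pi) / y"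
      by blast
  qed
  have ev: "\<forall>\<^sub>F y in at_top. norm (deriv (Phi \<tau>) (\<i> * of_real y) / Phi \<tau> (\<i> * of_real y) + \<i> * of_real (density y)) \<le> (1 + pi) / y"
    by (rule eventually_mono[OF eventually_gt_at_top[of 0]]) (rule eq)
  have "((\<lambda>y. (1 + pi) / y) \<longlongrightarrow> 0) at_top"
    by (intro tendsto_divide_0[OF tendsto_const] filterlim_at_top_imp_at_infinity filterlim_ident)
  then have "((\<lambda>y. deriv (Phi \<tau>) (\<i> * of_real y) / Phi \<tau> (\<i> * of_real y) + \<i> * of_real (density y)) \<longlongrightarrow> 0) at_top"
    by (rule Lim_null_comparison[OF ev])
  moreover have "((\<lambda>y. \<i> * of_real (density y)) \<longlongrightarrow> \<i> * of_real (1 / 2)) at_top"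
    by (intro tendsto_intros density_tendsto)
  ultimately have "((\<lambda>y. (deriv (Phi \<tau>) (\<i> * of_real y) / Phi \<tau> (\<i> * of_real y) + \<i> * of_real (density y)) - \<i> * of_real (density y))
      \<longlongrightarrow> 0 - \<i> * of_real (1 / 2)) at_top"
    by (rule tendsto_diff)
  then show ?thesis by simp
qed

text \<open>(\<Phi>'/\<Phi>)^2 - \<Phi>''/\<Phi> is a sum of inverse squares of modulus at most
  \<open>density y / y\<close>, so it vanishes in the limit and \<Phi>''/\<Phi> tends to (-i/2)^2.
  This is the source of the leading coefficient 1/4 of K.\<close>

lemma second_log_derivative_imag_axis:
  "((\<lambda>y. deriv (deriv (Phi \<tau>)) (\<i> * of_real y) / Phi \<tau> (\<i> * of_real y)) \<longlongrightarrow> - 1 / 4) at_top"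
proof -
  let ?l = "\<lambda>y. deriv (Phi \<tau>) (\<i> * of_real y) / Phi \<tau> (\<i> * of_real y)"
  let ?m = "\<lambda>y. deriv (deriv (Phi \<tau>)) (\<i> * of_real y) / Phi \<tau> (\<i> * of_real y)"
  have eq: "norm ((?l y)\<^sup>2 - ?m y) \<le> density y / y" if y: "y > 0" for y
  proof (rule LIMSEQ_le[OF tendsto_norm[OF Phi_log_derivatives(2)]])
    show "Im (\<i> * of_real y) \<noteq> 0" using y by simp
    show "(\<lambda>n. (\<Sum>k=1..n. y / (y\<^sup>2 + (\<tau> k)\<^sup>2)) / y) \<longlonglongrightarrow> density y / y"
      using y by (intro tendsto_intros density_sums) auto
    have "norm (\<Sum>k=1..n. 1 / (\<i> * of_real y - of_real (lam k))\<^sup>2) \<le> (\<Sum>k=1..n. y / (y\<^sup>2 + (\<tau> k)\<^sup>2)) / y" for n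
      unfolding sum_divide_distrib
    proof (rule sum_norm_le)
      fix k
      show "norm (1 / (\<i> * of_real y - of_real (lam k))\<^sup>2) \<le> y / (y\<^sup>2 + (\<tau> k)\<^sup>2) / y"
        using y by (simp add: norm_divide norm_power cmod_power2 add.commute)
    qed
    then show "\<exists>N. \<forall>n\<ge>N. norm (\<Sum>k=1..n. 1 / (\<i> * of_real y - of_real (lam k))\<^sup>2) \<le> (\<Sum>k=1..n. y / (y\<^sup>2 + (\<tau> k)\<^sup>2)) / y"
      by blast
  qed
  have ev: "\<forall>\<^sub>F y in at_top. norm ((?l y)\<^sup>2 - ?m y) \<le> density y / y"
    by (rule eventually_mono[OF eventually_gt_at_top[of 0]]) (rule eq)
  have "((\<lambda>y. density y / y) \<longlongrightarrow> 0) at_top"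
    by (rule tendsto_divide_0[OF density_tendsto]) (intro filterlim_at_top_imp_at_infinity filterlim_ident)
  then have "((\<lambda>y. (?l y)\<^sup>2 - ?m y) \<longlongrightarrow> 0) at_top"
    by (rule Lim_null_comparison[OF ev])
  then have "((\<lambda>y. (?l y)\<^sup>2 - ((?l y)\<^sup>2 - ?m y)) \<longlongrightarrow> (- \<i> / 2)\<^sup>2 - 0) at_top"
    by (intro tendsto_intros log_derivative_imag_axis)
  then show ?thesis
    by (simp add: diff_diff_eq2 power_divide)
qed

end

subsection \<open>Growth of solutions of the differential equation\<close>

lemma poly_norm_le_power:
  fixes p :: "complex poly"
  assumes "degree p \<le> n"
  obtains C where "C \<ge> 0" "\<And>z. norm z \<ge> 1 \<Longrightarrow> norm (poly p z) \<le> C * norm z ^ n"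
proof
  show "(\<Sum>i\<le>degree p. norm (coeff p i)) \<ge> 0"
    by (intro sum_nonneg) auto
  fix z :: complex assume z: "norm z \<ge> 1"
  have "norm (poly p z) \<le> (\<Sum>i\<le>degree p. norm (coeff p i) * norm z ^ n)"
    unfolding poly_altdef
  proof (rule sum_norm_le)
    fix i assume "i \<in> {..degree p}"
    then have "norm z ^ i \<le> norm z ^ n"
      using assms z by (intro power_increasing) auto
    then show "norm (coeff p i * z ^ i) \<le> norm (coeff p i) * norm z ^ n"
      by (simp add: norm_mult norm_power mult_left_mono)
  qed
  then show "norm (poly p z) \<le> (\<Sum>i\<le>degree p. norm (coeff p i)) * norm z ^ n"
    by (simp only: sum_distrib_right)
qed

text \<open>For g'' = -g/4 the energy |g'|^2 + |g|^2/4 grows along the ray of unit direction e at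
  rate at most |Im e|. The perturbation is O(1/r^2), integrable at infinity, and costs only a
  constant factor. The energy is thus O(exp(|Im z|)), and taking the square root halves the
  exponent.\<close>

lemma ode_energy_growth:
  fixes g g1 g2 :: "complex \<Rightarrow> complex"
  assumes d1: "\<And>z. (g has_field_derivative g1 z) (at z)" and d2: "\<And>z. (g1 has_field_derivative g2 z) (at z)"
    and C: "C \<ge> 0" and ode: "\<And>z. norm z \<ge> 1 \<Longrightarrow> norm (g2 z + g z / 4) \<le> C / (norm z)\<^sup>2 * (norm (g1 z) + norm (g z))"
  obtains M where "M \<ge> 0" "\<And>z. norm z \<ge> 1 \<Longrightarrow> norm (g z) \<le> M * exp (\<bar>Im z\<bar> / 2)"
proof -
  define E where "E = (\<lambda>z. (norm (g1 z))\<^sup>2 + (norm (g z))\<^sup>2 / 4)"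
  have "isCont g z" "isCont g1 z" for z
    using d1 d2 DERIV_isCont by blast+
  then have "continuous_on (sphere 0 1) E"
    unfolding E_def by (intro continuous_intros continuous_at_imp_continuous_on) auto
  then have "bounded (E ` sphere 0 1)"
    by (intro compact_imp_bounded compact_continuous_image) auto
  then obtain B where B: "\<And>z. norm z = 1 \<Longrightarrow> E z \<le> B"
    unfolding bounded_iff by (metis abs_le_D1 image_eqI mem_sphere_0 real_norm_def)
  define M where "M = 2 * sqrt (B * exp (4 * C))"
  have "E 1 \<ge> 0" by (simp add: E_def)
  then have B0: "B \<ge> 0" using B[of 1] by simp
  have prod_le: "norm (g z) * norm (g1 z) \<le> E z" for z
    using zero_le_power2[of "norm (g1 z) - norm (g z) / 2"] 
    by (simp add: E_def power2_eq_square algebra_simps)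
  have main: "norm (g z) \<le> M * exp (\<bar>Im z\<bar> / 2)" if z: "norm z \<ge> 1" for z
  proof -
    define e where "e = z / of_real (norm z)"
    have "norm z \<noteq> 0" using z by linarith
    then have ez: "z = of_real (norm z) * e" and e1: "norm e = 1"
      by (simp_all add: e_def norm_divide)
    define \<kappa> where "\<kappa> = \<bar>Im e\<bar>"
    have vd: "((\<lambda>r. k (of_real r * e)) has_vector_derivative e * k1 (of_real r * e)) (at r)"
      if "\<And>z. (k has_field_derivative k1 z) (at z)" for k k1 :: "complex \<Rightarrow> complex" and r :: real
    proof -
      have "((\<lambda>u. k (u * e)) has_field_derivative k1 (of_real r * e) * e) (at (of_real r))"
        by (rule DERIV_chain2[OF that]) (auto intro!: derivative_eq_intros)
      then show ?thesis
        using has_vector_derivative_real_field[of "\<lambda>u. k (u * e)"] by (simp add: mult.commute)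
    qed
    have sq: "((\<lambda>r. (norm (k (of_real r * e)))\<^sup>2) has_real_derivative 2 * (k (of_real r * e) \<bullet> (e * k1 (of_real r * e)))) (at r)"
      if "\<And>z. (k has_field_derivative k1 z) (at z)" for k k1 :: "complex \<Rightarrow> complex" and r :: real
      using bounded_bilinear.has_vector_derivative[OF bounded_bilinear_inner vd[OF that] vd[OF that], of r]
      by (simp add: has_real_derivative_iff_has_vector_derivative dot_square_norm[symmetric] inner_commute)
    \<comment> \<open>The exponent has derivative -\<kappa> - 4C/r^2, the negative of the growth
      rate of the energy; the term 4C/r stays between 0 and 4C for r \<ge> 1.\<close>
    define L where "L = (\<lambda>r::real. E (of_real r * e) * exp (- \<kappa> * r + 4 * C / r))"
    have "L (norm z) \<le> L 1"
    proof (rule DERIV_nonpos_imp_nonincreasing[OF z])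
      fix r :: real assume r: "1 \<le> r" "r \<le> norm z"
      let ?u = "of_real r * e"
      define E' where "E' = 2 * (g1 ?u \<bullet> (e * g2 ?u)) + 2 * (g ?u \<bullet> (e * g1 ?u)) / 4"
      have dE: "((\<lambda>r. E (of_real r * e)) has_real_derivative E') (at r)"
        unfolding E_def E'_def by (intro DERIV_add DERIV_cdivide sq d1 d2)
      have nu: "norm ?u = r" using r e1 by (simp add: norm_mult)
      define err where "err = g2 ?u + g ?u / 4"
      have g2: "g2 ?u = err - g ?u / 4" by (simp add: err_def)
      \<comment> \<open>After inserting g'' = -g/4 + err, the contributions of Re e cancel between
        the two terms of the energy, so only Im e appears in the unperturbed part.\<close>
      have "E' = - Im e * Im (cnj (g ?u) * g1 ?u) + 2 * (g1 ?u \<bullet> (e * err))"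
        unfolding E'_def g2 by (simp add: inner_complex_def algebra_simps add_divide_distrib diff_divide_distrib)
      also have "\<dots> \<le> \<kappa> * E ?u + 4 * C / r\<^sup>2 * E ?u"
      proof (rule add_mono)
        have "- Im e * Im (cnj (g ?u) * g1 ?u) \<le> \<bar>- Im e * Im (cnj (g ?u) * g1 ?u)\<bar>"
          by (rule abs_ge_self)
        also have "\<dots> = \<kappa> * \<bar>Im (cnj (g ?u) * g1 ?u)\<bar>"
          by (simp only: abs_mult abs_minus_cancel \<kappa>_def)
        also have "\<bar>Im (cnj (g ?u) * g1 ?u)\<bar> \<le> norm (cnj (g ?u) * g1 ?u)"
          by (rule abs_Im_le_cmod)
        also have "\<dots> \<le> E ?u"
          using prod_le[of ?u] by (simp add: norm_mult)
        finally show "- Im e * Im (cnj (g ?u) * g1 ?u) \<le> \<kappa> * E ?u"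
          by (simp add: \<kappa>_def mult_left_mono)
        have "g1 ?u \<bullet> (e * err) \<le> norm (g1 ?u) * norm (e * err)"
          by (rule norm_cauchy_schwarz)
        also have "\<dots> = norm (g1 ?u) * norm err"
          using e1 by (simp add: norm_mult)
        also have "\<dots> \<le> norm (g1 ?u) * (C / r\<^sup>2 * (norm (g1 ?u) + norm (g ?u)))"
          using ode[of ?u] r nu by (intro mult_left_mono) (auto simp: err_def)
        also have "\<dots> = C / r\<^sup>2 * ((norm (g1 ?u))\<^sup>2 + norm (g ?u) * norm (g1 ?u))"
          by (simp add: power2_eq_square algebra_simps add_divide_distrib)
        also have "\<dots> \<le> C / r\<^sup>2 * (E ?u + E ?u)"
          using prod_le[of ?u] C by (intro mult_left_mono add_mono) (auto simp: E_def)
        finally show "2 * (g1 ?u \<bullet> (e * err)) \<le> 4 * C / r\<^sup>2 * E ?u"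
          by simp
      qed
      finally have E': "E' \<le> (\<kappa> + 4 * C / r\<^sup>2) * E ?u"
        by (simp add: distrib_right)
      have de: "((\<lambda>r. exp (- \<kappa> * r + 4 * C / r)) has_real_derivative
          - (\<kappa> + 4 * C / r\<^sup>2) * exp (- \<kappa> * r + 4 * C / r)) (at r)"
        using r by (auto intro!: derivative_eq_intros simp: power2_eq_square algebra_simps)
      have "(L has_real_derivative
          (E' * exp (- \<kappa> * r + 4 * C / r) + - (\<kappa> + 4 * C / r\<^sup>2) * exp (- \<kappa> * r + 4 * C / r) * E ?u)) (at r)"
        unfolding L_def by (rule DERIV_mult[OF dE de])
      moreover have "E' * exp (- \<kappa> * r + 4 * C / r) + - (\<kappa> + 4 * C / r\<^sup>2) * exp (- \<kappa> * r + 4 * C / r) * E ?u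
          = (E' - (\<kappa> + 4 * C / r\<^sup>2) * E ?u) * exp (- \<kappa> * r + 4 * C / r)"
        by (simp add: algebra_simps)
      moreover have "\<dots> \<le> 0"
        using E' by (intro mult_nonpos_nonneg) auto
      ultimately show "\<exists>y. (L has_real_derivative y) (at r) \<and> y \<le> 0"
        by metis
    qed
    also have "L 1 \<le> B * exp (4 * C)"
    proof -
      have "L 1 = E e * exp (- \<kappa> + 4 * C)" by (simp add: L_def)
      also have "\<dots> \<le> B * exp (4 * C)"
        using B[OF e1] B0 by (intro mult_mono) (auto simp: \<kappa>_def)
      finally show ?thesis .
    qed
    finally have LB: "L (norm z) \<le> B * exp (4 * C)" .
    have Lz: "L (norm z) = E z * exp (- \<kappa> * norm z + 4 * C / norm z)"
      by (simp only: L_def ez[symmetric])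
    have \<kappa>z: "\<kappa> * norm z = \<bar>Im z\<bar>"
    proof -
      have "Im z = norm z * Im e" by (subst ez) simp
      then show ?thesis by (simp add: \<kappa>_def abs_mult)
    qed
    have "E z * exp (- \<bar>Im z\<bar>) \<le> L (norm z)"
      unfolding Lz \<kappa>z[symmetric] using C by (intro mult_left_mono) (auto simp: E_def)
    then have "E z * exp (- \<bar>Im z\<bar>) * exp \<bar>Im z\<bar> \<le> B * exp (4 * C) * exp \<bar>Im z\<bar>"
      using LB by (intro mult_right_mono) auto
    moreover have "exp (- \<bar>Im z\<bar>) * exp \<bar>Im z\<bar> = 1"
      by (simp flip: exp_add)
    ultimately have "E z \<le> B * exp (4 * C) * exp \<bar>Im z\<bar>"
      by (simp only: mult.assoc mult_1_right)
    moreover have "(norm (g z))\<^sup>2 / 4 \<le> E z"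
      by (simp add: E_def)
    ultimately have "(norm (g z))\<^sup>2 \<le> 4 * (B * exp (4 * C)) * exp \<bar>Im z\<bar>"
      by linarith
    also have "\<dots> = (M * exp (\<bar>Im z\<bar> / 2))\<^sup>2"
      using B0 by (simp add: M_def power_mult_distrib flip: exp_double)
    finally show ?thesis
      by (rule power2_le_imp_le) (use B0 in \<open>simp add: M_def\<close>)
  qed
  have "M \<ge> 0" using B0 by (simp add: M_def)
  then show ?thesis using that main by blast
qed

text \<open>
  The substitution \<open>g(z) = z\<^sup>s f(z)\<close> removes the first-order term \<open>2 s / z\<close> and leaves
  \<open>g'' + g / 4 = O(1 / z\<^sup>2)\<close>.
\<close>

lemma ode_solution_growth:
  fixes f :: "complex \<Rightarrow> complex"
  assumes f: "f holomorphic_on UNIV" and s: "s \<ge> 1"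
    and ode: "\<And>z. z ^ (2 * s) * deriv (deriv f) z + (of_nat (2 * s) * z ^ (2 * s - 1) - 2 * poly R z) * deriv f z
      + (poly K z - poly (pderiv R) z) * f z = 0"
    and R: "degree R \<le> 2 * s - 2" and K: "degree (K - monom (1 / 4) (2 * s)) \<le> 2 * s - 2"
  obtains M where "M \<ge> 0" "\<And>z. norm z \<ge> 1 \<Longrightarrow> norm z ^ s * norm (f z) \<le> M * exp (\<bar>Im z\<bar> / 2)"
proof -
  define g where "g = (\<lambda>z. z ^ s * f z)"
  define g1 where "g1 = (\<lambda>z. of_nat s * z ^ (s - 1) * f z + z ^ s * deriv f z)"
  define g2 where "g2 = (\<lambda>z. of_nat s * (of_nat (s - 1) * z ^ (s - 1 - 1)) * f z + 2 * (of_nat s * z ^ (s - 1) * deriv f z) + z ^ s * deriv (deriv f) z)"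
  have df: "(f has_field_derivative deriv f z) (at z)" for z
    using f by (simp add: holomorphic_derivI)
  have ddf: "(deriv f has_field_derivative deriv (deriv f) z) (at z)" for z
    using holomorphic_deriv[OF f] by (simp add: holomorphic_derivI)
  have d1: "(g has_field_derivative g1 z) (at z)" for z
    unfolding g_def g1_def by (auto intro!: derivative_eq_intros df simp: algebra_simps)
  have d2: "(g1 has_field_derivative g2 z) (at z)" for z
    unfolding g1_def g2_def by (auto intro!: derivative_eq_intros df ddf simp: algebra_simps)
  \<comment> \<open>What remains of K - R' after the leading term z^(2s)/4; its degree is at most 2s
    - 2, which makes K1 / z^(2s) of size O(1/z^2).\<close>
  define K1 where "K1 = K - monom (1 / 4) (2 * s) - pderiv R"
  have "degree (pderiv R) \<le> 2 * s - 2"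
    using R by (simp add: degree_pderiv)
  then have "degree K1 \<le> 2 * s - 2"
    unfolding K1_def by (rule degree_diff_le[OF K])
  then obtain c2 where c2: "c2 \<ge> 0" "\<And>z. norm z \<ge> 1 \<Longrightarrow> norm (poly K1 z) \<le> c2 * norm z ^ (2 * s - 2)"
    using poly_norm_le_power by blast
  obtain c1 where c1: "c1 \<ge> 0" "\<And>z. norm z \<ge> 1 \<Longrightarrow> norm (poly R z) \<le> c1 * norm z ^ (2 * s - 2)"
    using poly_norm_le_power[OF R] by blast
  define C where "C = 2 * c1 + (real s * real (s - 1) + 2 * real s * c1 + c2)"
  have C0: "C \<ge> 0" unfolding C_def using c1(1) c2(1) by simp
  have err: "norm (g2 z + g z / 4) \<le> C / (norm z)\<^sup>2 * (norm (g1 z) + norm (g z))" if z: "norm z \<ge> 1" for z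
  proof -
    have z0: "z \<noteq> 0" using z by auto
    define p where "p = z ^ s"
    have p0: "p \<noteq> 0" using z0 by (simp add: p_def)
    have zs1: "z ^ (s - 1) = p / z"
      using s z0 by (simp add: p_def power_diff)
    \<comment> \<open>For s = 1 the exponent truncates to 0, but the vanishing factor s - 1 keeps
      the formula valid.\<close>
    have zs2: "of_nat (s - 1) * z ^ (s - 1 - 1) = of_nat (s - 1) * (p / z\<^sup>2)"
    proof (cases "s = 1")
      case False
      then have "z ^ (s - 2) = p / z\<^sup>2" using s z0 by (simp add: p_def power_diff)
      then show ?thesis by (simp add: numeral_2_eq_2)
    qed simp
    have z2s: "z ^ (2 * s) = p\<^sup>2" by (simp add: p_def power_mult[symmetric] mult.commute)
    have z2s1: "z ^ (2 * s - 1) = p\<^sup>2 / z"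
      using s z0 z2s by (simp add: power_diff)
    \<comment> \<open>The transformed equation reads g'' + g/4 = \<alpha> g' + \<beta> g, and both
      coefficients are O(1/z^2).\<close>
    define \<alpha> where "\<alpha> = 2 * poly R z / p\<^sup>2"
    define \<beta> where "\<beta> = of_nat s * of_nat (s - 1) / z\<^sup>2 - 2 * of_nat s * poly R z / (p\<^sup>2 * z) - poly K1 z / p\<^sup>2"
    have Kz: "poly K z - poly (pderiv R) z = poly K1 z + p\<^sup>2 / 4"
      by (simp add: K1_def poly_monom z2s)
    have e: "p\<^sup>2 * deriv (deriv f) z = - (of_nat (2 * s) * (p\<^sup>2 / z) - 2 * poly R z) * deriv f z - (poly K1 z + p\<^sup>2 / 4) * f z"
      using ode[of z] unfolding z2s z2s1 Kz by (simp add: eq_neg_iff_add_eq_0 algebra_simps)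
    have "p * deriv (deriv f) z = (p\<^sup>2 * deriv (deriv f) z) / p"
      using p0 by (simp add: power2_eq_square)
    then have f2: "p * deriv (deriv f) z = - 2 * of_nat s * (p / z) * deriv f z + 2 * poly R z * deriv f z / p - poly K1 z * f z / p - p / 4 * f z"
      unfolding e using p0 z0 by (simp add: add_divide_distrib diff_divide_distrib power2_eq_square algebra_simps)
    have g1z: "g1 z = of_nat s * (p / z) * f z + p * deriv f z"
      by (simp only: g1_def zs1 p_def)
    have g2z: "g2 z = of_nat s * (of_nat (s - 1) * (p / z\<^sup>2)) * f z + 2 * (of_nat s * (p / z) * deriv f z) + p * deriv (deriv f) z"
      by (simp only: g2_def zs1 zs2 p_def)
    have gz: "g z = p * f z"
      by (simp only: g_def p_def)
    have id: "g2 z + g z / 4 = \<alpha> * g1 z + \<beta> * g z"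
      unfolding gz g1z g2z f2 \<alpha>_def \<beta>_def
      using p0 z0 by (simp add: divide_simps) (simp add: algebra_simps power2_eq_square)
    have np: "norm p ^ 2 = norm z ^ (2 * s - 2) * (norm z)\<^sup>2"
      unfolding p_def norm_power power_mult[symmetric] power_add[symmetric]
      using s by (intro arg_cong[where f = "power (norm z)"]) linarith
    have rat: "norm (x / p\<^sup>2) \<le> c / (norm z)\<^sup>2" if "norm x \<le> c * norm z ^ (2 * s - 2)" for x c
    proof -
      have "norm (x / p\<^sup>2) = norm x / (norm z ^ (2 * s - 2) * (norm z)\<^sup>2)"
        by (simp add: norm_divide norm_power np)
      also have "\<dots> \<le> (c * norm z ^ (2 * s - 2)) / (norm z ^ (2 * s - 2) * (norm z)\<^sup>2)"
        by (intro divide_right_mono that) auto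
      also have "\<dots> = c / (norm z)\<^sup>2"
        using z0 by simp
      finally show ?thesis .
    qed
    have a: "norm \<alpha> \<le> 2 * c1 / (norm z)\<^sup>2"
      unfolding \<alpha>_def using c1(2)[OF z] by (intro rat) (simp add: norm_mult)
    have b: "norm \<beta> \<le> (real s * real (s - 1) + 2 * real s * c1 + c2) / (norm z)\<^sup>2"
    proof -
      have "norm \<beta> \<le> norm (of_nat s * of_nat (s - 1) / z\<^sup>2) + norm (2 * of_nat s * poly R z / (p\<^sup>2 * z)) + norm (poly K1 z / p\<^sup>2)"
        unfolding \<beta>_def by (rule order_trans[OF norm_triangle_ineq4 add_right_mono[OF norm_triangle_ineq4]])
      moreover have "norm (of_nat s * of_nat (s - 1) / z\<^sup>2) = real s * real (s - 1) / (norm z)\<^sup>2"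
        by (simp add: norm_divide norm_mult norm_power)
      moreover have "norm (2 * of_nat s * poly R z / (p\<^sup>2 * z)) \<le> 2 * real s * c1 / (norm z)\<^sup>2"
      proof -
        have "norm (2 * of_nat s * poly R z / (p\<^sup>2 * z)) = norm (2 * of_nat s * poly R z / p\<^sup>2) / norm z"
          by (simp add: norm_divide norm_mult)
        also have "\<dots> \<le> norm (2 * of_nat s * poly R z / p\<^sup>2)"
          using z mult_left_mono[OF z, of "norm (2 * of_nat s * poly R z / p\<^sup>2)"] by (subst divide_le_eq) auto
        also have "\<dots> \<le> 2 * real s * c1 / (norm z)\<^sup>2"
          using mult_left_mono[OF c1(2)[OF z], of "2 * real s"] by (intro rat) (simp add: norm_mult mult_ac)
        finally show ?thesis .
      qed
      moreover have "norm (poly K1 z / p\<^sup>2) \<le> c2 / (norm z)\<^sup>2"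
        by (intro rat c2(2) z)
      ultimately show ?thesis
        by (simp add: add_divide_distrib)
    qed
    have "norm (g2 z + g z / 4) \<le> norm \<alpha> * norm (g1 z) + norm \<beta> * norm (g z)"
      unfolding id using norm_triangle_ineq[of "\<alpha> * g1 z" "\<beta> * g z"] by (simp only: norm_mult)
    also have "\<dots> \<le> C / (norm z)\<^sup>2 * norm (g1 z) + C / (norm z)\<^sup>2 * norm (g z)"
    proof (intro add_mono mult_right_mono)
      show "norm \<alpha> \<le> C / (norm z)\<^sup>2"
        using a by (rule order_trans) (intro divide_right_mono; use c1(1) c2(1) in \<open>simp add: C_def\<close>)
      show "norm \<beta> \<le> C / (norm z)\<^sup>2"
        using b by (rule order_trans) (intro divide_right_mono; use c1(1) c2(1) in \<open>simp add: C_def\<close>)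
    qed auto
    finally show ?thesis by (simp add: distrib_left)
  qed
  obtain M where "M \<ge> 0" "\<And>z. norm z \<ge> 1 \<Longrightarrow> norm (g z) \<le> M * exp (\<bar>Im z\<bar> / 2)"
    using ode_energy_growth[OF d1 d2 C0 err] by blast
  then show ?thesis
    using that by (simp add: g_def norm_mult norm_power)
qed

subsection \<open>Radial functions\<close>

text \<open>Evenness makes the value independent of the choice of root. Off the negative axis the
  principal branch is holomorphic, on it the branch i sqrt(-w) serves instead, and the isolated
  singularity at 0 is removable by continuity.\<close>

lemma even_entire_square_root:
  fixes f :: "complex \<Rightarrow> complex"
  assumes f: "f holomorphic_on UNIV" and even: "\<And>z. f (- z) = f z"
  shows "(\<lambda>w. f (csqrt w)) holomorphic_on UNIV"
proof -
  have sq: "f u = f v" if "u\<^sup>2 = v\<^sup>2" for u v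
  proof -
    have "u = v \<or> u = - v" using that by (simp add: power2_eq_iff)
    then show ?thesis using even[of v] by (elim disjE) simp_all
  qed
  have "(\<lambda>w. f (csqrt w)) holomorphic_on UNIV - {0}"
    unfolding holomorphic_on_def
  proof
    fix w :: complex assume w: "w \<in> UNIV - {0}"
    have df: "f field_differentiable at u" for u
      using f by (simp add: holomorphic_on_imp_differentiable_at)
    have "(\<lambda>w. f (csqrt w)) field_differentiable at w"
    proof (cases "w \<in> \<real>\<^sub>\<le>\<^sub>0")
      case False
      have "csqrt field_differentiable at w"
        using False by (rule field_differentiable_at_csqrt)
      then have "(f \<circ> csqrt) field_differentiable at w"
        using df by (rule field_differentiable_compose)
      then show ?thesis by (simp add: o_def)
    next
      case True
      have "f (csqrt u) = f (\<i> * csqrt (- u))" for u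
        by (rule sq) (simp add: power_mult_distrib)
      then have eq: "(\<lambda>w. f (csqrt w)) = f \<circ> (\<lambda>w. \<i> * csqrt (- w))" by auto
      have "- w \<notin> \<real>\<^sub>\<le>\<^sub>0"
        using True w by (auto simp: complex_nonpos_Reals_iff complex_eq_iff)
      then have "csqrt field_differentiable at (- w)"
        by (rule field_differentiable_at_csqrt)
      with field_differentiable_minus[OF field_differentiable_ident]
      have "(csqrt \<circ> (\<lambda>u. - u)) field_differentiable at w"
        by (rule field_differentiable_compose)
      then have "(\<lambda>w. \<i> * csqrt (- w)) field_differentiable at w"
        unfolding o_def by (rule field_differentiable_mult[OF field_differentiable_const])
      then show ?thesis
        unfolding eq using df by (rule field_differentiable_compose)
    qed
    then show "(\<lambda>w. f (csqrt w)) field_differentiable at w within UNIV - {0}"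
      by (rule field_differentiable_at_within)
  qed
  moreover have "((\<lambda>w. f (csqrt w)) \<longlongrightarrow> f (csqrt 0)) (at 0)"
  proof -
    have "((\<lambda>w. norm (csqrt w)) \<longlongrightarrow> 0) (at 0)"
      using tendsto_real_sqrt[OF tendsto_norm[OF tendsto_ident_at], of "0::complex" UNIV] by simp
    then have "(csqrt \<longlongrightarrow> 0) (at 0)"
      by (rule tendsto_norm_zero_cancel)
    moreover have "isCont f 0"
      using holomorphic_on_imp_continuous_on[OF f] by (simp add: continuous_on_eq_continuous_at)
    ultimately show ?thesis
      unfolding csqrt_0 by (rule isCont_tendsto_compose[rotated])
  qed
  ultimately show ?thesis
    using no_isolated_singularity'[of "{0}" "\<lambda>w. f (csqrt w)" UNIV] by simp
qed

lemma entire_eq_if_eq_on_reals: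
  fixes f g :: "complex \<Rightarrow> complex"
  assumes f: "f holomorphic_on UNIV" and g: "g holomorphic_on UNIV" and eq: "\<And>x::real. f (of_real x) = g (of_real x)"
  shows "f z = g z"
proof -
  have "(\<lambda>z. f z - g z) z = 0"
  proof (rule analytic_continuation[of "\<lambda>z. f z - g z" UNIV "range of_real" 0])
    show "(\<lambda>z. f z - g z) holomorphic_on UNIV" by (intro holomorphic_intros f g)
    show "(0::complex) islimpt range of_real"
    proof (rule islimptI)
      fix T :: "complex set" assume "0 \<in> T" "open T"
      then obtain e where e: "e > 0" "ball 0 e \<subseteq> T"
        by (meson open_contains_ball)
      have "complex_of_real (e / 2) \<in> ball 0 e" using e by (simp add: norm_divide)
      then show "\<exists>y\<in>range of_real. y \<in> T \<and> y \<noteq> 0"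
        using e by (intro bexI[of _ "complex_of_real (e / 2)"] conjI rangeI) auto
    qed
  qed (use eq in auto)
  then show ?thesis by simp
qed

section \<open>Even functions of one variable as radial functions of several\<close>

lemma norm_complex_vec_square: "(norm (z :: complex ^ 'n))\<^sup>2 = (\<Sum>i\<in>UNIV. (norm (z $ i))\<^sup>2)"
  by (simp add: norm_vec_def L2_set_def sum_nonneg)

text \<open>On real points the sum of squares is |x|^2, so this is the extension of the radial
  function x \<mapsto> f(|x|). It is entire as the composition of a quadratic form with the entire
  function w \<mapsto> f(sqrt w).\<close>

lemma entire_vec_even_radial:
  fixes f :: "complex \<Rightarrow> complex"
  assumes f: "f holomorphic_on UNIV" and even: "\<And>z. f (- z) = f z"
  shows "entire_vec (\<lambda>z :: complex ^ 'n::finite. f (csqrt (\<Sum>i\<in>UNIV. (z $ i)\<^sup>2)))"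
  unfolding entire_vec_def
proof
  fix z :: "complex ^ 'n"
  define h where "h = (\<lambda>w. f (csqrt w))"
  define q where "q = (\<lambda>z :: complex ^ 'n. \<Sum>i\<in>UNIV. (z $ i)\<^sup>2)"
  define dq where "dq = (\<lambda>v :: complex ^ 'n. \<Sum>i\<in>UNIV. 2 * (z $ i) * v $ i)"
  have "h holomorphic_on UNIV"
    unfolding h_def by (rule even_entire_square_root[OF f even])
  then have "(h has_field_derivative deriv h (q z)) (at (q z))"
    by (simp add: holomorphic_derivI)
  then have dh: "(h has_derivative (*) (deriv h (q z))) (at (q z))"
    by (simp add: has_field_derivative_def)
  have "((\<lambda>z :: complex ^ 'n. (z $ i)\<^sup>2) has_derivative (\<lambda>v. 2 * (z $ i) * v $ i)) (at z)" for i
  proof -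
    have "((\<lambda>z :: complex ^ 'n. z $ i) has_derivative (\<lambda>v. v $ i)) (at z)"
      by (rule bounded_linear_imp_has_derivative[OF bounded_linear_vec_nth])
    then show ?thesis
      by (auto intro!: derivative_eq_intros simp: mult_ac)
  qed
  then have "(q has_derivative dq) (at z)"
    unfolding q_def dq_def by (intro has_derivative_sum)
  then have "((\<lambda>z. h (q z)) has_derivative (\<lambda>v. deriv h (q z) * dq v)) (at z)"
    using has_derivative_compose[of q dq z UNIV h "(*) (deriv h (q z))"] dh by blast
  moreover have "deriv h (q z) * dq (c *s v) = c * (deriv h (q z) * dq v)" for c v
    by (simp add: dq_def sum_distrib_left mult_ac)
  ultimately show "\<exists>D. ((\<lambda>z :: complex ^ 'n. f (csqrt (\<Sum>i\<in>UNIV. (z $ i)\<^sup>2))) has_derivative D) (at z) \<and> (\<forall>c v. D (c *s v) = c * D v)"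
    unfolding h_def q_def by blast
qed

lemma exp_type_at_most_nonneg:
  assumes "exp_type_at_most F r" "\<epsilon> > 0"
  obtains A where "A \<ge> 0" "\<And>z. norm (F z) \<le> A * exp ((r + \<epsilon>) * norm z)"
proof -
  obtain A where A: "\<And>z. norm (F z) \<le> A * exp ((r + \<epsilon>) * norm z)"
    using assms unfolding exp_type_at_most_def by blast
  have "A \<ge> 0" using order_trans[OF norm_ge_zero A[of 0]] by simp
  then show ?thesis using that A by blast
qed

text \<open>The complex quadratic form is bounded by the square of the Hermitian norm, so passing to
  several variables does not raise the type.\<close>

lemma exp_type_even_radial:
  fixes f :: "complex \<Rightarrow> complex"
  assumes "exp_type_at_most f r" "r \<ge> 0"
  shows "exp_type_at_most (\<lambda>z :: complex ^ 'n::finite. f (csqrt (\<Sum>i\<in>UNIV. (z $ i)\<^sup>2))) r"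
  unfolding exp_type_at_most_def
proof (intro allI impI)
  fix \<epsilon> :: real assume e: "\<epsilon> > 0"
  obtain A where A: "A \<ge> 0" "\<And>z. norm (f z) \<le> A * exp ((r + \<epsilon>) * norm z)"
    using exp_type_at_most_nonneg[OF assms(1) e] by blast
  have "norm (f (csqrt (\<Sum>i\<in>UNIV. (z $ i)\<^sup>2))) \<le> A * exp ((r + \<epsilon>) * norm z)" for z :: "complex ^ 'n"
  proof -
    have "norm (\<Sum>i\<in>UNIV. (z $ i)\<^sup>2) \<le> (norm z)\<^sup>2"
      unfolding norm_complex_vec_square by (rule sum_norm_le) (simp add: norm_power)
    then have "norm (csqrt (\<Sum>i\<in>UNIV. (z $ i)\<^sup>2)) \<le> norm z"
      unfolding norm_csqrt by (simp add: real_le_lsqrt)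
    then have "A * exp ((r + \<epsilon>) * norm (csqrt (\<Sum>i\<in>UNIV. (z $ i)\<^sup>2))) \<le> A * exp ((r + \<epsilon>) * norm z)"
      using A(1) assms(2) e by (intro mult_left_mono) auto
    then show ?thesis using A(2)[of "csqrt (\<Sum>i\<in>UNIV. (z $ i)\<^sup>2)"] by linarith
  qed
  then show "\<exists>A. \<forall>z :: complex ^ 'n. norm (f (csqrt (\<Sum>i\<in>UNIV. (z $ i)\<^sup>2))) \<le> A * exp ((r + \<epsilon>) * norm z)"
    by blast
qed

lemma radial_lift_PW1:
  fixes f :: "complex \<Rightarrow> complex"
  assumes f: "f holomorphic_on UNIV" and even: "\<And>z. f (- z) = f z" and ty: "exp_type_at_most f r" "r \<ge> 0"
    and int: "integrable lborel (radial_lift f :: real ^ 'n::finite \<Rightarrow> complex)"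
  shows "(radial_lift f :: real ^ 'n \<Rightarrow> complex) \<in> PW1 r"
proof -
  have "radial_lift f x = f (csqrt (\<Sum>i\<in>UNIV. (cvec x $ i)\<^sup>2))" for x :: "real ^ 'n"
  proof -
    have "(\<Sum>i\<in>UNIV. (cvec x $ i)\<^sup>2) = of_real ((norm x)\<^sup>2)"
      by (simp add: cvec_def norm_vec_def L2_set_def sum_nonneg)
    then have "csqrt (\<Sum>i\<in>UNIV. (cvec x $ i)\<^sup>2) = of_real (norm x)"
      by (simp add: of_real_sqrt)
    then show ?thesis by (simp add: radial_lift_def)
  qed
  then show ?thesis
    unfolding PW1_def using int entire_vec_even_radial[OF f even] exp_type_even_radial[OF ty] by blast
qed

text \<open>Restricting the extension to one complex coordinate line preserves norms and yields an
  entire function of one variable; it agrees with f on the reals, for negative x by evenness, and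
  hence everywhere.\<close>

lemma exp_type_if_radial_lift_PW1:
  fixes f :: "complex \<Rightarrow> complex"
  assumes f: "f holomorphic_on UNIV" and even: "\<And>z. f (- z) = f z"
    and PW: "(radial_lift f :: real ^ 'n::finite \<Rightarrow> complex) \<in> PW1 r"
  shows "exp_type_at_most f r"
proof -
  obtain F :: "complex ^ 'n \<Rightarrow> complex" where F: "entire_vec F" "exp_type_at_most F r" "\<And>x. radial_lift f x = F (cvec x)"
    using PW unfolding PW1_def by blast
  fix i0 :: 'n
  define l where "l = (\<lambda>z :: complex. z *s (axis i0 1 :: complex ^ 'n))"
  have nl: "norm (l z) = norm z" for z
  proof -
    have "(norm (l z $ i))\<^sup>2 = (if i = i0 then (norm z)\<^sup>2 else 0)" for i
      by (simp add: l_def axis_def)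
    then have "(norm (l z))\<^sup>2 = (norm z)\<^sup>2"
      by (simp add: norm_complex_vec_square)
    then show ?thesis by (simp add: power2_eq_iff_nonneg)
  qed
  have bl: "bounded_linear l"
  proof (rule bounded_linear_intro[where K = 1])
    show "l (x + y) = l x + l y" for x y by (simp add: l_def vector_sadd_rdistrib)
    show "l (r *\<^sub>R x) = r *\<^sub>R l x" for r x
      by (simp add: l_def vec_eq_iff)
    show "norm (l x) \<le> norm x * 1" for x by (simp add: nl)
  qed
  have hol: "(\<lambda>z. F (l z)) holomorphic_on UNIV"
  proof -
    have "\<exists>f'. ((\<lambda>z. F (l z)) has_field_derivative f') (at z)" for z
    proof -
      obtain D where D: "(F has_derivative D) (at (l z))" "\<And>c v. D (c *s v) = c * D v"
        using F(1) unfolding entire_vec_def by blast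
      have "((\<lambda>z. F (l z)) has_derivative (\<lambda>v. D (l v))) (at z)"
        by (rule has_derivative_compose[OF bounded_linear_imp_has_derivative[OF bl] D(1)])
      moreover have "(\<lambda>v. D (l v)) = (*) (D (axis i0 1))"
        by (simp add: l_def D(2) mult.commute fun_eq_iff)
      ultimately show ?thesis by (auto simp: has_field_derivative_def)
    qed
    then show ?thesis by (simp add: holomorphic_on_open)
  qed
  have "f z = F (l z)" for z
  proof (rule entire_eq_if_eq_on_reals[OF f hol])
    fix x :: real
    define v where "v = x *\<^sub>R (axis i0 1 :: real ^ 'n)"
    have "cvec v = l (of_real x)"
      by (simp add: v_def cvec_def l_def vec_eq_iff axis_def)
    moreover have "norm v = \<bar>x\<bar>" by (simp add: v_def)
    ultimately have "F (l (of_real x)) = f (of_real \<bar>x\<bar>)"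
      using F(3)[of v] by (simp add: radial_lift_def)
    also have "\<dots> = f (of_real x)"
      using even[of "of_real x"] by (simp add: abs_if)
    finally show "f (of_real x) = F (l (of_real x))" by simp
  qed
  then show ?thesis
    using F(2) nl unfolding exp_type_at_most_def by metis
qed

text \<open>Polar coordinates by comparing distribution functions: for a \<ge> 0 both measures give
  the half-line up to a the volume V a^n of the ball, and such half-lines generate the Borel sets
  and are stable under intersection.\<close>

lemma distr_norm_lborel:
  "distr lborel borel (norm :: real ^ 'n::finite \<Rightarrow> real) =
     density lborel (\<lambda>r. ennreal (real CARD('n) * unit_ball_volume TYPE('n) * (indicator {0..} r * r ^ (CARD('n) - 1))))"
  (is "?M = density lborel (\<lambda>r. ennreal (?w r))")
proof -
  define V where "V = unit_ball_volume TYPE('n)"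
  define n where "n = CARD('n)"
  have n: "n > 0" by (simp add: n_def)
  have V0: "V \<ge> 0" by (simp add: V_def unit_ball_volume_def)
  have V: "V = unit_ball_vol (real n)"
    by (simp add: V_def unit_ball_volume_def content_ball n_def)
  have w: "?w = (\<lambda>r. real n * V * (indicator {0..} r * r ^ (n - 1)))"
    by (simp add: V_def n_def)
  let ?N = "density lborel (\<lambda>r. ennreal (?w r))"
  have M: "emeasure ?M {..a} = ennreal (if a \<ge> 0 then V * a ^ n else 0)" for a
  proof -
    have "emeasure ?M {..a} = emeasure lborel {x :: real ^ 'n. norm x \<le> a}"
      by (subst emeasure_distr) (auto intro!: arg_cong[where f = "emeasure lborel"])
    also have "\<dots> = ennreal (if a \<ge> 0 then V * a ^ n else 0)"
    proof (cases "a \<ge> 0")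
      case True
      have "{x :: real ^ 'n. norm x \<le> a} = cball 0 a" by auto
      then show ?thesis using True by (simp add: emeasure_cball V n_def)
    next
      case False
      then have "{x :: real ^ 'n. norm x \<le> a} = {}"
        using norm_ge_zero order_trans by blast
      then show ?thesis using False by simp
    qed
    finally show ?thesis .
  qed
  have N: "emeasure ?N {..a} = ennreal (if a \<ge> 0 then V * a ^ n else 0)" for a
  proof -
    have "emeasure ?N {..a} = (\<integral>\<^sup>+ r. ennreal (?w r) * indicator {..a} r \<partial>lborel)"
      by (rule emeasure_density) auto
    also have "\<dots> = (\<integral>\<^sup>+ r. ennreal (real n * V * r ^ (n - 1)) * indicator {0..a} r \<partial>lborel)"
      by (intro nn_integral_cong) (simp add: indicator_def V_def n_def)
    also have "\<dots> = ennreal (if a \<ge> 0 then V * a ^ n else 0)"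
    proof (cases "a \<ge> 0")
      case True
      have "(\<integral>\<^sup>+ r. ennreal (real n * V * r ^ (n - 1)) * indicator {0..a} r \<partial>lborel) = ennreal (V * a ^ n - V * 0 ^ n)"
      proof (rule nn_integral_FTC_Icc)
        show "((\<lambda>r. V * r ^ n) has_real_derivative real n * V * r ^ (n - 1)) (at r)" for r
          by (auto intro!: derivative_eq_intros)
      qed (use True V0 in auto)
      then show ?thesis using True n by (simp add: zero_power)
    qed simp
    finally show ?thesis .
  qed
  show ?thesis
  proof (rule measure_eqI_generator_eq[where E = "range atMost" and \<Omega> = UNIV and A = "\<lambda>i. {..real i}"])
    show "Int_stable (range atMost :: real set set)"
      by (auto simp: Int_stable_def)
    show "emeasure ?M X = emeasure ?N X" if "X \<in> range atMost" for X
      using that M N by auto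
    show "sets ?M = sigma_sets UNIV (range atMost)" "sets ?N = sigma_sets UNIV (range atMost)"
      by (simp_all add: borel_eq_atMost)
    show "(\<Union>i. {..real i}) = UNIV"
      using real_arch_simple by auto
    show "emeasure ?M {..real i} \<noteq> \<infinity>" for i
      unfolding M by simp
  qed auto
qed

section \<open>Integrals against the radial weight\<close>

definition radial_weight :: "nat \<Rightarrow> real \<Rightarrow> real" where
  "radial_weight n r = indicator {0..} r * r ^ (n - 1)"

lemma radial_weight_nonneg [simp]: "radial_weight n r \<ge> 0"
  by (simp add: radial_weight_def indicator_def)

lemma radial_weight_measurable [measurable]: "radial_weight n \<in> borel_measurable borel"
  unfolding radial_weight_def[abs_def] by measurable

lemma unit_ball_volume_pos: "unit_ball_volume TYPE('n::finite) > 0"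
  by (simp add: unit_ball_volume_def content_ball)

lemma
  fixes g :: "real \<Rightarrow> 'b::{banach, second_countable_topology}"
  assumes g[measurable]: "g \<in> borel_measurable borel"
  shows integrable_radial: "integrable lborel (\<lambda>x :: real ^ 'n::finite. g (norm x)) \<longleftrightarrow>
      integrable lborel (\<lambda>r. radial_weight CARD('n) r *\<^sub>R g r)" (is ?A)
    and integral_radial: "(LINT x|lborel. g (norm (x :: real ^ 'n))) =
      (real CARD('n) * unit_ball_volume TYPE('n)) *\<^sub>R (LINT r|lborel. radial_weight CARD('n) r *\<^sub>R g r)" (is ?B)
proof -
  define c where "c = real CARD('n) * unit_ball_volume TYPE('n)"
  have c: "c > 0" using unit_ball_volume_pos[where 'n = 'n] by (simp add: c_def)
  have D: "distr lborel borel (norm :: real ^ 'n \<Rightarrow> real) = density lborel (\<lambda>r. ennreal (c * radial_weight CARD('n) r))"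
    unfolding distr_norm_lborel radial_weight_def c_def ..
  let ?D = "density lborel (\<lambda>r. ennreal (c * radial_weight CARD('n) r))"
  have "integrable ?D g \<longleftrightarrow> integrable lborel (\<lambda>r. (c * radial_weight CARD('n) r) *\<^sub>R g r)"
    using c by (intro integrable_density) auto
  moreover have "integrable ?D g \<longleftrightarrow> integrable lborel (\<lambda>x :: real ^ 'n. g (norm x))"
    unfolding D[symmetric] by (rule integrable_distr_eq) auto
  ultimately have "integrable lborel (\<lambda>x :: real ^ 'n. g (norm x)) \<longleftrightarrow> integrable lborel (\<lambda>r. (c * radial_weight CARD('n) r) *\<^sub>R g r)"
    by blast
  also have "\<dots> \<longleftrightarrow> integrable lborel (\<lambda>r. c *\<^sub>R (radial_weight CARD('n) r *\<^sub>R g r))"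
    by simp
  also have "\<dots> \<longleftrightarrow> integrable lborel (\<lambda>r. radial_weight CARD('n) r *\<^sub>R g r)"
  proof
    assume "integrable lborel (\<lambda>r. c *\<^sub>R (radial_weight CARD('n) r *\<^sub>R g r))"
    then have "integrable lborel (\<lambda>r. (1 / c) *\<^sub>R (c *\<^sub>R (radial_weight CARD('n) r *\<^sub>R g r)))"
      by (rule integrable_scaleR_right)
    then show "integrable lborel (\<lambda>r. radial_weight CARD('n) r *\<^sub>R g r)" using c by simp
  qed (rule integrable_scaleR_right)
  finally show ?A .
  have "integral\<^sup>L ?D g = (LINT r|lborel. (c * radial_weight CARD('n) r) *\<^sub>R g r)"
    using c by (intro integral_density) auto
  moreover have "integral\<^sup>L ?D g = (LINT x|lborel. g (norm (x :: real ^ 'n)))"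
    unfolding D[symmetric] by (rule integral_distr) auto
  ultimately have "(LINT x|lborel. g (norm (x :: real ^ 'n))) = (LINT r|lborel. (c * radial_weight CARD('n) r) *\<^sub>R g r)"
    by simp
  also have "\<dots> = (LINT r|lborel. c *\<^sub>R (radial_weight CARD('n) r *\<^sub>R g r))"
    by simp
  also have "\<dots> = c *\<^sub>R (LINT r|lborel. radial_weight CARD('n) r *\<^sub>R g r)"
    using c by (intro integral_scaleR_right) 
  finally show ?B unfolding c_def .
qed

subsection \<open>The variational condition\<close>

text \<open>Rationalising the difference of norms gives the derivative of the modulus at a nonzero
  real number in the direction c. It is the pointwise input for differentiating the L^1 norm at
  \<phi>, which is real on the real axis.\<close>

lemma norm_add_real_multiple_quotient_tendsto:
  fixes p :: real and c :: complex
  assumes "p \<noteq> 0" and t: "t \<longlonglongrightarrow> 0" "\<And>n. t n > 0"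
  shows "(\<lambda>n. (norm (of_real p + of_real (t n) * c) - norm (of_real p :: complex)) / t n) \<longlonglongrightarrow> sgn p * Re c"
proof -
  let ?s = "\<lambda>n. norm (of_real p + of_real (t n) * c) + \<bar>p\<bar>"
  have pos: "?s n > 0" for n
    using assms(1) by (intro add_nonneg_pos) auto
  have "(norm (of_real p + of_real (t n) * c) - norm (of_real p :: complex)) / t n
      = (2 * p * Re c + t n * (norm c)\<^sup>2) / ?s n" for n
  proof -
    have "(norm (of_real p + of_real (t n) * c))\<^sup>2 = p\<^sup>2 + t n * (2 * p * Re c + t n * (norm c)\<^sup>2)"
      unfolding cmod_power2 by (simp add: power2_eq_square algebra_simps)
    then have "(norm (of_real p + of_real (t n) * c) - \<bar>p\<bar>) * ?s n = t n * (2 * p * Re c + t n * (norm c)\<^sup>2)"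
      by (simp add: algebra_simps power2_eq_square)
    then have "(norm (of_real p + of_real (t n) * c) - \<bar>p\<bar>) / t n = (2 * p * Re c + t n * (norm c)\<^sup>2) / ?s n"
      using pos[of n] t(2)[of n] by (subst frac_eq_eq) (auto simp: mult.commute)
    then show ?thesis by simp
  qed
  moreover have "(\<lambda>n. (2 * p * Re c + t n * (norm c)\<^sup>2) / ?s n) \<longlonglongrightarrow>
      (2 * p * Re c + 0 * (norm c)\<^sup>2) / (norm (of_real p + of_real 0 * c) + \<bar>p\<bar>)"
    using assms(1) by (intro tendsto_intros t(1)) auto
  moreover have "(2 * p * Re c + 0 * (norm c)\<^sup>2) / (norm (of_real p + of_real 0 * c) + \<bar>p\<bar>) = sgn p * Re c"
    using assms(1) by (simp add: sgn_if)
  ultimately show ?thesis by simp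
qed

lemma exp_type_at_most_add:
  assumes "exp_type_at_most f r" "exp_type_at_most g r"
  shows "exp_type_at_most (\<lambda>z. f z + g z) r"
  unfolding exp_type_at_most_def
proof (intro allI impI)
  fix \<epsilon> :: real assume e: "\<epsilon> > 0"
  obtain A where A: "\<And>z. norm (f z) \<le> A * exp ((r + \<epsilon>) * norm z)"
    using assms(1) e unfolding exp_type_at_most_def by blast
  obtain B where B: "\<And>z. norm (g z) \<le> B * exp ((r + \<epsilon>) * norm z)"
    using assms(2) e unfolding exp_type_at_most_def by blast
  have "norm (f z + g z) \<le> (A + B) * exp ((r + \<epsilon>) * norm z)" for z
    using norm_triangle_ineq[of "f z" "g z"] A[of z] B[of z] by (simp add: distrib_right)
  then show "\<exists>A. \<forall>z. norm (f z + g z) \<le> A * exp ((r + \<epsilon>) * norm z)" by blast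
qed

lemma exp_type_at_most_cmult:
  assumes "exp_type_at_most f r"
  shows "exp_type_at_most (\<lambda>z. c * f z) r"
  unfolding exp_type_at_most_def
proof (intro allI impI)
  fix \<epsilon> :: real assume e: "\<epsilon> > 0"
  obtain A where A: "\<And>z. norm (f z) \<le> A * exp ((r + \<epsilon>) * norm z)"
    using assms(1) e unfolding exp_type_at_most_def by blast
  have "norm (c * f z) \<le> (norm c * A) * exp ((r + \<epsilon>) * norm z)" for z
    using mult_left_mono[OF A[of z], of "norm c"] by (simp add: norm_mult mult.assoc)
  then show "\<exists>A. \<forall>z. norm (c * f z) \<le> A * exp ((r + \<epsilon>) * norm z)" by blast
qed

text \<open>One-variable description of the radial competitors in dimension n: their radial lifts
  lie in \<open>PW1 1\<close>. The value at 0 is left free so that the class is a vector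
  space.\<close>

definition admissible :: "nat \<Rightarrow> (complex \<Rightarrow> complex) \<Rightarrow> bool" where
  "admissible n f \<longleftrightarrow> f holomorphic_on UNIV \<and> (\<forall>z. f (- z) = f z) \<and> exp_type_at_most f 1 \<and>
     integrable lborel (\<lambda>r. radial_weight n r *\<^sub>R f (of_real r))"

lemma admissible_add: "admissible n f \<Longrightarrow> admissible n g \<Longrightarrow> admissible n (\<lambda>z. f z + g z)"
  unfolding admissible_def by (auto simp: scaleR_add_right intro!: holomorphic_intros exp_type_at_most_add)

lemma admissible_cmult:
  assumes "admissible n f"
  shows "admissible n (\<lambda>z. c * f z)"
proof -
  have "integrable lborel (\<lambda>r. c * (radial_weight n r *\<^sub>R f (of_real r)))"
    using assms by (intro integrable_mult_right) (simp add: admissible_def)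
  then show ?thesis
    using assms unfolding admissible_def by (auto intro!: holomorphic_intros exp_type_at_most_cmult)
qed

lemma admissible_norm_integrable:
  assumes "admissible n f"
  shows "integrable lborel (\<lambda>r. radial_weight n r * norm (f (of_real r)))"
proof -
  have "integrable lborel (\<lambda>r. norm (radial_weight n r *\<^sub>R f (of_real r)))"
    using assms by (intro integrable_norm) (simp add: admissible_def)
  then show ?thesis by simp
qed

lemma entire_of_real_measurable:
  assumes "f holomorphic_on UNIV"
  shows "(\<lambda>r. f (complex_of_real r)) \<in> borel_measurable borel"
proof (rule borel_measurable_continuous_onI)
  have "continuous_on UNIV f"
    using assms by (rule holomorphic_on_imp_continuous_on)
  then show "continuous_on UNIV (\<lambda>r. f (complex_of_real r))"
    by (rule continuous_on_compose2) (auto intro: continuous_intros)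
qed

locale extremal_function =
  fixes \<phi> :: "complex \<Rightarrow> complex" and T :: "'n::finite itself" and d :: nat
  assumes ext: "radial_extremal T \<phi>" and d_def: "d = CARD('n)"
begin

lemma T_eq: "unit_ball_volume T = unit_ball_volume TYPE('n)"
  by (simp add: unit_ball_volume_def)

lemma phi_holomorphic: "\<phi> holomorphic_on UNIV"
  and phi_even: "\<phi> (- z) = \<phi> z"
  and phi_real: "x \<in> \<real> \<Longrightarrow> \<phi> x \<in> \<real>"
  and phi_0: "\<phi> 0 = 1"
  using ext unfolding radial_extremal_def by auto

lemma phi_PW1: "(radial_lift \<phi> :: real ^ 'n \<Rightarrow> complex) \<in> PW1 1"
  using ext unfolding radial_extremal_def by auto

lemma phi_admissible: "admissible d \<phi>"
proof -
  have "integrable lborel (radial_lift \<phi> :: real ^ 'n \<Rightarrow> complex)"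
    using phi_PW1 unfolding PW1_def by auto
  then have "integrable lborel (\<lambda>r. radial_weight d r *\<^sub>R \<phi> (of_real r))"
    unfolding d_def radial_lift_def[abs_def]
    using integrable_radial[OF entire_of_real_measurable[OF phi_holomorphic], where 'n = 'n] by simp
  then show ?thesis
    unfolding admissible_def using phi_holomorphic phi_even
      exp_type_if_radial_lift_PW1[OF phi_holomorphic phi_even phi_PW1] by blast
qed

definition radial_norm :: "(complex \<Rightarrow> complex) \<Rightarrow> real" where
  "radial_norm f = (LINT r|lborel. radial_weight d r * norm (f (of_real r)))"

lemma L1_norm_radial_lift:
  assumes "f holomorphic_on UNIV"
  shows "L1_norm (radial_lift f :: real ^ 'n \<Rightarrow> complex) = real d * unit_ball_volume TYPE('n) * radial_norm f"
proof -
  note [measurable] = entire_of_real_measurable[OF assms]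
  show ?thesis
    unfolding L1_norm_def radial_lift_def radial_norm_def
    using integral_radial[of "\<lambda>r. norm (f (of_real r))", where 'n = 'n, folded d_def] by simp
qed

lemma admissible_PW1:
  assumes "admissible d f"
  shows "(radial_lift f :: real ^ 'n \<Rightarrow> complex) \<in> PW1 1"
proof (rule radial_lift_PW1)
  have f: "f holomorphic_on UNIV" "integrable lborel (\<lambda>r. radial_weight d r *\<^sub>R f (of_real r))"
    using assms unfolding admissible_def by auto
  then show "integrable lborel (radial_lift f :: real ^ 'n \<Rightarrow> complex)"
    unfolding radial_lift_def[abs_def]
    using integrable_radial[OF entire_of_real_measurable[OF f(1)], where 'n = 'n] by (simp add: d_def)
qed (use assms in \<open>auto simp: admissible_def\<close>)

lemma extremal_le:
  assumes "f \<in> PW1 1" "f 0 = 1"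
  shows "L1_norm (radial_lift \<phi> :: real ^ 'n \<Rightarrow> complex) \<le> L1_norm (f :: real ^ 'n \<Rightarrow> complex)"
proof -
  have "L1_norm (radial_lift \<phi> :: real ^ 'n \<Rightarrow> complex) =
      Inf {L1_norm f | f :: real ^ 'n \<Rightarrow> complex. f \<in> PW1 1 \<and> f 0 = 1}"
    using ext unfolding radial_extremal_def nikolskii_const_def by simp
  also have "\<dots> \<le> L1_norm f"
  proof (rule cInf_lower)
    show "L1_norm f \<in> {L1_norm f | f :: real ^ 'n \<Rightarrow> complex. f \<in> PW1 1 \<and> f 0 = 1}"
      using assms by blast
    show "bdd_below {L1_norm f | f :: real ^ 'n \<Rightarrow> complex. f \<in> PW1 1 \<and> f 0 = 1}"
      by (rule bdd_belowI[of _ 0]) (auto simp: L1_norm_def)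
  qed
  finally show ?thesis .
qed

lemma d_pos: "d > 0" by (simp add: d_def)

lemma radial_norm_minimal:
  assumes "admissible d f" "f 0 = 1"
  shows "radial_norm \<phi> \<le> radial_norm f"
proof -
  have "f holomorphic_on UNIV" using assms(1) by (simp add: admissible_def)
  moreover have "radial_lift f (0 :: real ^ 'n) = 1" using assms(2) by (simp add: radial_lift_def)
  ultimately have "real d * unit_ball_volume TYPE('n) * radial_norm \<phi> \<le> real d * unit_ball_volume TYPE('n) * radial_norm f"
    using extremal_le[OF admissible_PW1[OF assms(1)]] by (simp add: L1_norm_radial_lift phi_holomorphic)
  then show ?thesis
    using unit_ball_volume_pos[where 'n = 'n] d_pos by simp
qed

text \<open>The L^1 norm of the lift of \<phi> is d V_d times \<open>radial_norm \<phi>\<close>, and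
  a_d is that L^1 norm divided by 2 V_d.\<close>

lemma a_const_eq: "a_const T = real d / 2 * radial_norm \<phi>"
proof -
  have "L1_norm (radial_lift \<phi> :: real ^ 'n \<Rightarrow> complex) = inverse (nikolskii_const T)"
    using ext unfolding radial_extremal_def by auto
  then have "a_const T = L1_norm (radial_lift \<phi> :: real ^ 'n \<Rightarrow> complex) / (2 * unit_ball_volume T)"
    by (simp add: a_const_def field_simps)
  then show ?thesis
    using unit_ball_volume_pos[where 'n = 'n]
    by (simp add: L1_norm_radial_lift phi_holomorphic T_eq)
qed

definition sign :: "real \<Rightarrow> real" where "sign r = sgn (Re (\<phi> (of_real r)))"

lemma phi_of_real: "\<phi> (of_real r) = of_real (Re (\<phi> (of_real r)))"
  using phi_real[of "of_real r"] by (simp add: complex_is_Real_iff complex_eq_iff)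

lemma sign_measurable [measurable]: "sign \<in> borel_measurable borel"
proof -
  note [measurable] = entire_of_real_measurable[OF phi_holomorphic]
  show ?thesis unfolding sign_def[abs_def] by measurable
qed

lemma abs_sign_le: "\<bar>sign r\<bar> \<le> 1"
  by (simp add: sign_def sgn_if)

text \<open>A nonzero entire function has only countably many zeros. Hence the modulus is
  differentiable at almost every value taken by \<phi> on the line, as the first variation
  demands.\<close>

lemma AE_phi_nonzero: "AE r in lborel. \<phi> (of_real r) \<noteq> 0"
proof -
  have "countable {z \<in> UNIV. \<phi> z = 0}" if "\<not> \<phi> constant_on UNIV"
  proof (rule holomorphic_countable_zeros[OF phi_holomorphic open_UNIV _ _ that])
    show "fsigma (UNIV :: complex set)"
      using fsigma.intros[of "\<lambda>_. UNIV :: complex set"] by simp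
  qed (rule connected_UNIV)
  moreover have "{z \<in> UNIV. \<phi> z = 0} = {}" if "\<phi> constant_on UNIV"
    using that phi_0 unfolding constant_on_def by force
  ultimately have "countable {z. \<phi> z = 0}" by fastforce
  then have "countable (Re ` {z. \<phi> z = 0})" by (rule countable_image)
  moreover have "{r. \<phi> (complex_of_real r) = 0} \<subseteq> Re ` {z. \<phi> z = 0}"
    by force
  ultimately have "countable {r. \<phi> (complex_of_real r) = 0}"
    by (rule countable_subset[rotated])
  then show ?thesis
    by (intro AE_I'[of "{r. \<phi> (complex_of_real r) = 0}"]) (auto simp: countable_imp_null_set_lborel)
qed

text \<open>Since f(0) = 0, each \<phi> + t f is a competitor, so the difference quotients of the
  norm for t > 0 are nonnegative; they are dominated by |f| and converge wherever \<phi> does not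
  vanish.\<close>

lemma variation_nonneg:
  assumes f: "admissible d f" "f 0 = 0"
  shows "(LINT r|lborel. radial_weight d r * (sign r * Re (f (of_real r)))) \<ge> 0"
proof -
  define t where "t = (\<lambda>n. inverse (real (Suc n)))"
  have t: "t \<longlonglongrightarrow> 0" "\<And>n. t n > 0"
    unfolding t_def using LIMSEQ_inverse_real_of_nat by auto
  define X where "X = (\<lambda>n r. radial_weight d r * ((norm (\<phi> (of_real r) + of_real (t n) * f (of_real r)) - norm (\<phi> (of_real r))) / t n))"
  have fh: "f holomorphic_on UNIV" and fi: "integrable lborel (\<lambda>r. radial_weight d r *\<^sub>R f (of_real r))"
    using f(1) by (auto simp: admissible_def)
  note [measurable] = entire_of_real_measurable[OF phi_holomorphic] entire_of_real_measurable[OF fh]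
  have "(\<lambda>n. LINT r|lborel. X n r) \<longlonglongrightarrow> (LINT r|lborel. radial_weight d r * (sign r * Re (f (of_real r))))"
  proof (rule integral_dominated_convergence)
    show "integrable lborel (\<lambda>r. norm (radial_weight d r *\<^sub>R f (of_real r)))"
      using fi by (rule integrable_norm)
    show "AE r in lborel. (\<lambda>n. X n r) \<longlonglongrightarrow> radial_weight d r * (sign r * Re (f (of_real r)))"
      using AE_phi_nonzero
    proof eventually_elim
      case (elim r)
      define p where "p = Re (\<phi> (of_real r))"
      have pe: "\<phi> (of_real r) = of_real p" unfolding p_def by (rule phi_of_real)
      have "p \<noteq> 0" using elim pe by auto
      show ?case
        unfolding X_def sign_def p_def[symmetric] unfolding pe
        by (rule tendsto_mult[OF tendsto_const norm_add_real_multiple_quotient_tendsto[OF \<open>p \<noteq> 0\<close> t]])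
    qed
    show "AE r in lborel. norm (X n r) \<le> norm (radial_weight d r *\<^sub>R f (of_real r))" for n
    proof (rule AE_I2)
      fix r
      have "\<bar>norm (\<phi> (of_real r) + of_real (t n) * f (of_real r)) - norm (\<phi> (of_real r))\<bar> \<le> t n * norm (f (of_real r))"
        using norm_triangle_ineq3[of "\<phi> (of_real r) + of_real (t n) * f (of_real r)" "\<phi> (of_real r)"] t(2)[of n]
        by (simp add: norm_mult)
      then have "\<bar>(norm (\<phi> (of_real r) + of_real (t n) * f (of_real r)) - norm (\<phi> (of_real r))) / t n\<bar> \<le> norm (f (of_real r))"
        using t(2)[of n] by (simp add: divide_le_eq mult.commute)
      then show "norm (X n r) \<le> norm (radial_weight d r *\<^sub>R f (of_real r))"
        unfolding X_def real_norm_def abs_mult norm_scaleR by (intro mult_left_mono) auto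
    qed
  qed (auto simp: X_def[abs_def])
  moreover have "(LINT r|lborel. X n r) \<ge> 0" for n
  proof -
    have adm: "admissible d (\<lambda>z. \<phi> z + of_real (t n) * f z)"
      by (intro admissible_add admissible_cmult phi_admissible f)
    note i1 = admissible_norm_integrable[OF adm] and i2 = admissible_norm_integrable[OF phi_admissible]
    have "(LINT r|lborel. X n r) = (radial_norm (\<lambda>z. \<phi> z + of_real (t n) * f z) - radial_norm \<phi>) / t n"
      unfolding radial_norm_def Bochner_Integration.integral_diff[OF i1 i2, symmetric] X_def
        integral_divide_zero[symmetric] by (intro Bochner_Integration.integral_cong) (auto simp: algebra_simps)
    moreover have "radial_norm \<phi> \<le> radial_norm (\<lambda>z. \<phi> z + of_real (t n) * f z)"
      by (rule radial_norm_minimal[OF adm]) (simp add: phi_0 f(2))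
    ultimately show ?thesis using t(2)[of n] by simp
  qed
  ultimately show ?thesis
    by (intro LIMSEQ_le_const) auto
qed

lemma admissible_sign_integrable:
  assumes "admissible d f"
  shows "integrable lborel (\<lambda>r. (radial_weight d r * sign r) *\<^sub>R f (of_real r))"
proof -
  have fh: "f holomorphic_on UNIV" and fi: "integrable lborel (\<lambda>r. radial_weight d r *\<^sub>R f (of_real r))"
    using assms by (auto simp: admissible_def)
  note [measurable] = entire_of_real_measurable[OF fh]
  show ?thesis
  proof (rule Bochner_Integration.integrable_bound[OF fi])
    show "AE r in lborel. norm ((radial_weight d r * sign r) *\<^sub>R f (of_real r)) \<le> norm (radial_weight d r *\<^sub>R f (of_real r))"
      using abs_sign_le by (intro AE_I2) (auto simp: abs_mult intro!: mult_right_mono mult_left_le)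
  qed measurable
qed

text \<open>The inequality applies to cf for every complex c; the choices 1, -1, i and -i force both
  the real and the imaginary part to vanish.\<close>

lemma variation_zero:
  assumes f: "admissible d f" "f 0 = 0"
  shows "(LINT r|lborel. (radial_weight d r * sign r) *\<^sub>R f (of_real r)) = 0"
proof -
  let ?I = "\<lambda>f. LINT r|lborel. (radial_weight d r * sign r) *\<^sub>R f (complex_of_real r)"
  have re: "Re (?I g) = (LINT r|lborel. radial_weight d r * (sign r * Re (g (of_real r))))" if "admissible d g" for g
    using integral_Re[OF admissible_sign_integrable[OF that]] by (simp add: mult.assoc)
  have cm: "?I (\<lambda>z. c * f z) = c * ?I f" for c
    unfolding integral_mult_right_zero[symmetric] by simp
  have nn: "Re (c * ?I f) \<ge> 0" for c
  proof -
    have "(LINT r|lborel. radial_weight d r * (sign r * Re (c * f (of_real r)))) \<ge> 0"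
      by (rule variation_nonneg[OF admissible_cmult[OF f(1)]]) (simp add: f(2))
    then show ?thesis
      using re[OF admissible_cmult[OF f(1), of c]] by (simp only: cm)
  qed
  show ?thesis
    using nn[of 1] nn[of "-1"] nn[of \<i>] nn[of "-\<i>"] by (simp add: complex_eq_iff)
qed

text \<open>f - f(0) \<phi> vanishes at 0, so its integral against the sign is zero; the integral of
  \<phi> itself against its sign is \<open>radial_norm \<phi>\<close>, which equals 2a/d.\<close>

lemma extremal_quadrature:
  assumes f: "admissible d f"
  shows "(LINT r|lborel. (radial_weight d r * sign r) *\<^sub>R f (of_real r)) = of_real (2 * a_const T / real d) * f 0"
proof -
  let ?I = "\<lambda>f. LINT r|lborel. (radial_weight d r * sign r) *\<^sub>R f (complex_of_real r)"
  have "?I (\<lambda>z. f z + (- f 0) * \<phi> z) = 0"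
  proof (rule variation_zero)
    show "admissible d (\<lambda>z. f z + (- f 0) * \<phi> z)"
      by (intro admissible_add admissible_cmult f phi_admissible)
  qed (simp add: phi_0)
  moreover have "?I (\<lambda>z. f z + (- f 0) * \<phi> z) = ?I f + (- f 0) * ?I \<phi>"
    unfolding integral_mult_right_zero[symmetric]
    by (subst Bochner_Integration.integral_add[symmetric])
      (use admissible_sign_integrable[OF f] integrable_mult_right[OF admissible_sign_integrable[OF phi_admissible], of "- f 0"]
        in \<open>simp_all add: scaleR_add_right scaleR_diff_right\<close>)
  moreover have "?I \<phi> = of_real (radial_norm \<phi>)"
  proof -
    have "(radial_weight d r * sign r) *\<^sub>R \<phi> (of_real r) = of_real (radial_weight d r * norm (\<phi> (of_real r)))" for r
      by (subst (1 2) phi_of_real) (simp add: sign_def scaleR_conv_of_real abs_sgn mult_ac flip: of_real_mult)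
    then show ?thesis
      unfolding radial_norm_def by (simp only: integral_complex_of_real)
  qed
  ultimately have "?I f = of_real (radial_norm \<phi>) * f 0"
    by (simp add: mult.commute)
  moreover have "radial_norm \<phi> = 2 * a_const T / real d"
    using d_pos by (simp add: a_const_eq)
  ultimately show ?thesis by simp
qed

lemma a_const_pos: "a_const T > 0"
proof -
  note i = admissible_norm_integrable[OF phi_admissible]
  have "radial_norm \<phi> \<noteq> 0"
  proof
    assume "radial_norm \<phi> = 0"
    then have "AE r in lborel. radial_weight d r * norm (\<phi> (of_real r)) = 0"
      unfolding radial_norm_def using integral_nonneg_eq_0_iff_AE[OF i] by simp
    with AE_phi_nonzero have "AE r in lborel. radial_weight d r = 0"
      by eventually_elim auto
    then have "AE r in lborel. r \<notin> {0<..<(1::real)}"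
      by eventually_elim (auto simp: radial_weight_def indicator_def split: if_splits)
    then have "emeasure lborel {0<..<(1::real)} = 0"
      by (subst (asm) AE_iff_measurable[of "{0<..<1}"]) auto
    then show False by simp
  qed
  moreover have "radial_norm \<phi> \<ge> 0"
    unfolding radial_norm_def by (intro Bochner_Integration.integral_nonneg) auto
  ultimately show ?thesis
    using d_pos by (simp add: a_const_eq)
qed

end

subsection \<open>The quadrature formula\<close>

text \<open>Half of \<epsilon> is spent on the given bound, the other half absorbs the factor
  |z|.\<close>

lemma exp_type_at_most_ident_mult:
  assumes "exp_type_at_most f r"
  shows "exp_type_at_most (\<lambda>z. z * f z) r"
  unfolding exp_type_at_most_def
proof (intro allI impI)
  fix \<epsilon> :: real assume e: "\<epsilon> > 0"
  then have "\<epsilon> / 2 > 0" by simp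
  then obtain A where A: "A \<ge> 0" "\<And>z. norm (f z) \<le> A * exp ((r + \<epsilon> / 2) * norm z)"
    using exp_type_at_most_nonneg[OF assms] by blast
  have "norm (z * f z) \<le> (2 / \<epsilon> * A) * exp ((r + \<epsilon>) * norm z)" for z
  proof -
    have "\<epsilon> / 2 * norm z \<le> exp (\<epsilon> / 2 * norm z)"
      using exp_ge_add_one_self[of "\<epsilon> / 2 * norm z"] by linarith
    then have "norm z \<le> 2 / \<epsilon> * exp (\<epsilon> / 2 * norm z)"
      using e by (simp add: field_simps)
    then have "norm z * norm (f z) \<le> (2 / \<epsilon> * exp (\<epsilon> / 2 * norm z)) * (A * exp ((r + \<epsilon> / 2) * norm z))"
      using e A by (intro mult_mono) auto
    also have "\<dots> = (2 / \<epsilon> * A) * (exp (\<epsilon> / 2 * norm z) * exp ((r + \<epsilon> / 2) * norm z))"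
      by (simp only: mult_ac)
    also have "exp (\<epsilon> / 2 * norm z) * exp ((r + \<epsilon> / 2) * norm z) = exp ((r + \<epsilon>) * norm z)"
      unfolding exp_add[symmetric] distrib_right[symmetric] by (simp add: add.commute)
    finally show ?thesis by (simp add: norm_mult)
  qed
  then show "\<exists>A. \<forall>z. norm (z * f z) \<le> A * exp ((r + \<epsilon>) * norm z)" by blast
qed

lemma exp_type_at_most_power_mult:
  assumes "exp_type_at_most f r"
  shows "exp_type_at_most (\<lambda>z. z ^ k * f z) r"
proof (induction k)
  case (Suc k)
  then show ?case using exp_type_at_most_ident_mult[OF Suc] by (simp add: mult.assoc)
qed (use assms in simp)

lemma exp_type_at_most_deriv:
  assumes f: "f holomorphic_on UNIV" and ty: "exp_type_at_most f r" and r: "r \<ge> 0"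
  shows "exp_type_at_most (deriv f) r"
  unfolding exp_type_at_most_def
proof (intro allI impI)
  fix \<epsilon> :: real assume e: "\<epsilon> > 0"
  obtain A where A: "A \<ge> 0" "\<And>z. norm (f z) \<le> A * exp ((r + \<epsilon>) * norm z)"
    using exp_type_at_most_nonneg[OF ty e] by blast
  have "norm (deriv f z) \<le> (A * exp (r + \<epsilon>)) * exp ((r + \<epsilon>) * norm z)" for z
  proof -
    have "norm ((deriv ^^ 1) f z) \<le> fact 1 * ((A * exp (r + \<epsilon>)) * exp ((r + \<epsilon>) * norm z)) / 1 ^ 1"
    proof (rule Cauchy_inequality)
      show "f holomorphic_on ball z 1" "continuous_on (cball z 1) f"
        using f holomorphic_on_imp_continuous_on holomorphic_on_subset by blast+
      fix u assume "norm (z - u) = 1"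
      then have "norm u \<le> 1 + norm z"
        using norm_triangle_ineq3[of u z] by (simp add: norm_minus_commute)
      then have "A * exp ((r + \<epsilon>) * norm u) \<le> A * exp ((r + \<epsilon>) * (1 + norm z))"
        using A(1) r e by (intro mult_left_mono) auto
      also have "\<dots> = (A * exp (r + \<epsilon>)) * exp ((r + \<epsilon>) * norm z)"
        by (simp add: distrib_left exp_add)
      finally show "norm (f u) \<le> (A * exp (r + \<epsilon>)) * exp ((r + \<epsilon>) * norm z)"
        using A(2)[of u] by linarith
    qed simp
    then show ?thesis by simp
  qed
  then show "\<exists>A. \<forall>z. norm (deriv f z) \<le> A * exp ((r + \<epsilon>) * norm z)" by blast
qed

lemma quadratic_lower:
  fixes z w :: complex
  assumes "norm z \<ge> norm w + 1"
  shows "norm z \<le> norm (z\<^sup>2 - w\<^sup>2)"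
proof -
  have "norm z \<le> (norm z - norm w) * (norm z + norm w)"
    using assms mult_mono[of 1 "norm z - norm w" "norm z" "norm z + norm w"] by simp
  also have "\<dots> = (norm z)\<^sup>2 - (norm w)\<^sup>2"
    by (simp add: power2_eq_square algebra_simps)
  also have "\<dots> \<le> norm (z\<^sup>2 - w\<^sup>2)"
    using norm_triangle_ineq2[of "z\<^sup>2" "w\<^sup>2"] by (simp add: norm_power)
  finally show ?thesis .
qed

text \<open>Outside the ball of radius |w| + 1 the divisor has modulus at least 1; inside it
  compactness bounds h.\<close>

lemma exp_type_at_most_divide_quadratic:
  assumes h: "h holomorphic_on UNIV" and ty: "exp_type_at_most (\<lambda>z. (z\<^sup>2 - w\<^sup>2) * h z) r" and r: "r \<ge> 0"
  shows "exp_type_at_most h r"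
  unfolding exp_type_at_most_def
proof (intro allI impI)
  fix \<epsilon> :: real assume e: "\<epsilon> > 0"
  obtain A where A: "A \<ge> 0" "\<And>z. norm ((z\<^sup>2 - w\<^sup>2) * h z) \<le> A * exp ((r + \<epsilon>) * norm z)"
    using exp_type_at_most_nonneg[OF ty e] by blast
  have "continuous_on (cball 0 (norm w + 1)) h"
    using h holomorphic_on_imp_continuous_on holomorphic_on_subset by blast
  then have "bounded (h ` cball 0 (norm w + 1))"
    by (intro compact_imp_bounded compact_continuous_image) auto
  then obtain B where B: "\<And>z. norm z \<le> norm w + 1 \<Longrightarrow> norm (h z) \<le> B"
    unfolding bounded_iff by fastforce
  have "B \<ge> 0" using order_trans[OF norm_ge_zero B[of 0]] by (simp add: add_nonneg_nonneg)
  have "norm (h z) \<le> (A + B) * exp ((r + \<epsilon>) * norm z)" for z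
  proof -
    have e1: "1 \<le> exp ((r + \<epsilon>) * norm z)" using r e by simp
    show ?thesis
    proof (cases "norm z \<le> norm w + 1")
      case True
      then have "norm (h z) \<le> B * 1" using B by simp
      also have "\<dots> \<le> (A + B) * exp ((r + \<epsilon>) * norm z)"
        using e1 A(1) \<open>B \<ge> 0\<close> by (intro mult_mono) auto
      finally show ?thesis .
    next
      case False
      then have "1 \<le> norm (z\<^sup>2 - w\<^sup>2)"
        using quadratic_lower[of w z] norm_ge_zero[of w] by linarith
      then have "1 * norm (h z) \<le> norm (z\<^sup>2 - w\<^sup>2) * norm (h z)"
        by (intro mult_right_mono) auto
      also have "\<dots> \<le> A * exp ((r + \<epsilon>) * norm z)"
        using A(2)[of z] by (simp add: norm_mult)
      also have "\<dots> \<le> (A + B) * exp ((r + \<epsilon>) * norm z)"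
        using \<open>B \<ge> 0\<close> by (intro mult_right_mono) auto
      finally show ?thesis by simp
    qed
  qed
  then show "\<exists>A. \<forall>z. norm (h z) \<le> A * exp ((r + \<epsilon>) * norm z)" by blast
qed

section \<open>Signs of the extremal function between its zeros\<close>

locale extremal_zeros = extremal_function \<phi> T d + alternating_zeros \<tau>
  for \<phi> :: "complex \<Rightarrow> complex" and T :: "'n::finite itself" and d :: nat and \<tau> :: "nat \<Rightarrow> real" +
  fixes m :: nat
  assumes dm: "d = 2 * m + 1"
    and zeros_simple: "\<And>z. \<phi> z = 0 \<Longrightarrow> z \<in> \<real> \<and> deriv \<phi> z \<noteq> 0"
    and positive_zeros: "\<tau> ` {1..} = {x. x > 0 \<and> \<phi> (complex_of_real x) = 0}"
    and product: "\<And>z. (\<lambda>n. \<Prod>k=1..n. 1 - z\<^sup>2 / (complex_of_real (\<tau> k))\<^sup>2) \<longlonglongrightarrow> \<phi> z"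
begin

text \<open>\<open>\<tau> 0\<close> is unspecified, so the left end 0 of the first sign interval is
  supplied separately.\<close>

definition node :: "nat \<Rightarrow> real" where "node k = (if k = 0 then 0 else \<tau> k)"

lemma node_less: "node k < node (Suc k)"
  using tau_pos[of 1] tau_mono by (auto simp: node_def strict_mono_on_def)

lemma node_strict_mono: "strict_mono node"
  by (simp add: strict_mono_Suc_iff node_less)

text \<open>For such r exactly the first k factors of the product are negative. The limit yields
  only a weak inequality, which is strict because r is not a zero.\<close>

lemma sign_between_nodes:
  assumes r: "node k < r" "r < node (Suc k)"
  shows "sign r = (-1) ^ k"
proof -
  define P where "P = (\<lambda>n. \<Prod>j=1..n. 1 - r\<^sup>2 / (\<tau> j)\<^sup>2)"
  have r0: "r > 0"
    using r(1) node_strict_mono[THEN strict_mono_less_eq, of 0 k] by (simp add: node_def split: if_splits)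
  have "(\<lambda>n. complex_of_real (P n)) \<longlonglongrightarrow> \<phi> (of_real r)"
    using product[of "of_real r"] by (simp add: P_def)
  then have "(\<lambda>n. Re (complex_of_real (P n))) \<longlonglongrightarrow> Re (\<phi> (of_real r))"
    by (rule tendsto_Re)
  then have lim: "(\<lambda>n. (-1) ^ k * P n) \<longlonglongrightarrow> (-1) ^ k * Re (\<phi> (of_real r))"
    by (intro tendsto_intros) simp
  have "(-1) ^ k * P n \<ge> 0" if n: "n \<ge> k" for n
  proof -
    have "(\<Prod>j=1..k. - (1 - r\<^sup>2 / (\<tau> j)\<^sup>2)) \<ge> 0"
    proof (rule prod_nonneg)
      fix j assume j: "j \<in> {1..k}"
      then have "\<tau> j \<le> node k"
        using node_strict_mono[THEN strict_mono_less_eq, of j k] by (simp add: node_def)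
      then have "(\<tau> j)\<^sup>2 \<le> r\<^sup>2" "\<tau> j > 0"
        using r(1) tau_pos[of j] j by (auto intro!: power_mono)
      then show "0 \<le> - (1 - r\<^sup>2 / (\<tau> j)\<^sup>2)" by (simp add: pos_le_divide_eq)
    qed
    moreover have "(\<Prod>j=k + 1..n. 1 - r\<^sup>2 / (\<tau> j)\<^sup>2) \<ge> 0"
    proof (rule prod_nonneg)
      fix j assume j: "j \<in> {k + 1..n}"
      then have "node (Suc k) \<le> \<tau> j"
        using node_strict_mono[THEN strict_mono_less_eq, of "Suc k" j] by (simp add: node_def)
      then have "r\<^sup>2 \<le> (\<tau> j)\<^sup>2" "\<tau> j > 0"
        using r(2) r0 tau_pos[of j] j by (auto intro!: power_mono)
      then show "0 \<le> 1 - r\<^sup>2 / (\<tau> j)\<^sup>2" by (simp add: pos_divide_le_eq)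
    qed
    moreover have "(-1) ^ k * P n = (\<Prod>j=1..k. - (1 - r\<^sup>2 / (\<tau> j)\<^sup>2)) * (\<Prod>j=k + 1..n. 1 - r\<^sup>2 / (\<tau> j)\<^sup>2)"
    proof -
      have "P n = (\<Prod>j=1..k. 1 - r\<^sup>2 / (\<tau> j)\<^sup>2) * (\<Prod>j=k + 1..n. 1 - r\<^sup>2 / (\<tau> j)\<^sup>2)"
        using prod.ub_add_nat[of 1 k "\<lambda>j. 1 - r\<^sup>2 / (\<tau> j)\<^sup>2" "n - k"] n by (simp add: P_def)
      moreover have "(\<Prod>j=1..k. - (1 - r\<^sup>2 / (\<tau> j)\<^sup>2)) = (-1) ^ k * (\<Prod>j=1..k. 1 - r\<^sup>2 / (\<tau> j)\<^sup>2)"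
        using prod_uminus[of "\<lambda>j. 1 - r\<^sup>2 / (\<tau> j)\<^sup>2" "{1..k}"] by simp
      ultimately show ?thesis by (simp only: mult.assoc)
    qed
    ultimately show ?thesis by simp
  qed
  then have "(-1) ^ k * Re (\<phi> (of_real r)) \<ge> 0"
    by (intro LIMSEQ_le_const[OF lim]) blast
  moreover have "Re (\<phi> (of_real r)) \<noteq> 0"
  proof
    assume "Re (\<phi> (of_real r)) = 0"
    then have "\<phi> (of_real r) = 0" by (subst phi_of_real) simp
    then obtain j where j: "j \<ge> 1" "r = \<tau> j"
      using positive_zeros r0 by blast
    then have "node k < node j" "node j < node (Suc k)"
      using r by (auto simp: node_def)
    then show False
      using strict_mono_less[OF node_strict_mono] by auto
  qed
  ultimately show ?thesis
    unfolding sign_def by (cases "even k") (auto simp: sgn_if)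
qed

end

context extremal_zeros
begin

lemma has_integral_sign_derivative:
  fixes G g :: "real \<Rightarrow> complex"
  assumes G: "\<And>x. (G has_vector_derivative g x) (at x)"
  shows "((\<lambda>x. sign x *\<^sub>R g x) has_integral (\<Sum>k<n. (-1) ^ k * (G (node (Suc k)) - G (node k)))) {0..node n}"
proof (induction n)
  case 0
  show ?case using has_integral_refl(2)[of _ "0::real"] by (simp add: node_def)
next
  case (Suc n)
  have le: "node n \<le> node (Suc n)" "0 \<le> node n"
    using node_less[of n] node_strict_mono[THEN strict_mono_less_eq, of 0 n] by (auto simp: node_def)
  have "(g has_integral (G (node (Suc n)) - G (node n))) {node n..node (Suc n)}"
    by (rule fundamental_theorem_of_calculus[OF le(1)]) (rule has_vector_derivative_at_within[OF G])
  then have "((\<lambda>x. (-1) ^ n * g x) has_integral (-1) ^ n * (G (node (Suc n)) - G (node n))) {node n..node (Suc n)}"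
    by (rule has_integral_mult_right)
  then have "((\<lambda>x. sign x *\<^sub>R g x) has_integral (-1) ^ n * (G (node (Suc n)) - G (node n))) {node n..node (Suc n)}"
  proof (rule has_integral_spike_finite[rotated 2])
    show "finite {node n, node (Suc n)}" by simp
    fix x assume "x \<in> {node n..node (Suc n)} - {node n, node (Suc n)}"
    then have "sign x = (-1) ^ n"
      by (intro sign_between_nodes) auto
    then show "sign x *\<^sub>R g x = (-1) ^ n * g x"
      by (simp add: scaleR_conv_of_real)
  qed
  then show ?case
    using has_integral_combine[OF le(2) le(1) Suc] by simp
qed

text \<open>Summation by parts: an inner node ends one interval and begins the next, whose sign is
  opposite, so it is counted twice. Only the last node keeps a boundary term, and the node 0 drops
  out because G vanishes there.\<close>

lemma alternating_increments:
  fixes G :: "real \<Rightarrow> complex"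
  assumes "G 0 = 0"
  shows "(\<Sum>k<n. (-1) ^ k * (G (node (Suc k)) - G (node k))) = 2 * (\<Sum>k=1..n. (-1) ^ (k + 1) * G (\<tau> k)) + (-1) ^ n * G (node n)"
proof (induction n)
  case 0
  then show ?case using assms by (simp add: node_def)
next
  case (Suc n)
  have "node (Suc n) = \<tau> (Suc n)" by (simp add: node_def)
  then show ?case unfolding sum.lessThan_Suc Suc by (simp add: algebra_simps)
qed

lemma node_at_top: "filterlim node at_top sequentially"
proof -
  have "\<forall>\<^sub>F k in sequentially. \<tau> k = node k"
    using eventually_gt_at_top[of 0] by eventually_elim (simp add: node_def)
  then show ?thesis
    using tau_at_top filterlim_cong[OF refl refl, of \<tau> node sequentially] by simp
qed

text \<open>
  With \<open>G(x) = x\<^sup>d h(x)\<close> the test function is \<open>f = G' / x\<^sup>(\<^sup>d\<^sup>-\<^sup>1\<^sup>) = d h + z h'\<close>, so that the left-hand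
  side of the quadrature formula telescopes over the sign intervals of the extremal function.
\<close>

lemma node_quadrature:
  fixes h :: "complex \<Rightarrow> complex"
  assumes h: "h holomorphic_on UNIV" and even: "\<And>z. h (- z) = h z"
    and ty: "exp_type_at_most (\<lambda>z. (z\<^sup>2 - w\<^sup>2) * h z) 1"
    and int: "integrable lborel (\<lambda>x. complex_of_real x ^ (2 * m) * (((complex_of_real x)\<^sup>2 - w\<^sup>2) * h (of_real x)))"
  shows "(\<lambda>n. \<Sum>k=1..n. (-1) ^ (k + 1) * (of_real (\<tau> k) ^ d * h (of_real (\<tau> k)))) \<longlonglongrightarrow> of_real (a_const T) * h 0"
proof -
  \<comment> \<open>Integrability is assumed for this undivided function only, so the Bernstein
    inequality is applied to u, and h is recovered by division at some distance from w and
    -w.\<close>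
  define u where "u = (\<lambda>z. z ^ (2 * m) * ((z\<^sup>2 - w\<^sup>2) * h z))"
  define f where "f = (\<lambda>z. of_nat d * h z + z * deriv h z)"
  define G where "G = (\<lambda>x. complex_of_real x ^ d * h (of_real x))"
  define g where "g = (\<lambda>x. complex_of_real x ^ (2 * m) * f (of_real x))"
  have dh: "deriv h holomorphic_on UNIV" using h by (simp add: holomorphic_deriv)
  have fh: "f holomorphic_on UNIV"
    unfolding f_def by (intro holomorphic_intros h dh)
  have uh: "u holomorphic_on UNIV"
    unfolding u_def by (intro holomorphic_intros h)
  have hd: "(h has_field_derivative deriv h z) (at z)" for z
    using h by (simp add: holomorphic_derivI)
  have Gd: "((\<lambda>z. z ^ d * h z) has_field_derivative z ^ (2 * m) * f z) (at z)" for z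
  proof -
    have "((\<lambda>z. z ^ d * h z) has_field_derivative (of_nat d * z ^ (d - 1)) * h z + deriv h z * z ^ d) (at z)"
      by (rule DERIV_mult[OF _ hd]) (auto intro!: derivative_eq_intros)
    moreover have "(of_nat d * z ^ (d - 1)) * h z + deriv h z * z ^ d = z ^ (2 * m) * f z"
      by (simp add: f_def dm algebra_simps)
    ultimately show ?thesis by simp
  qed
  have Gg: "(G has_vector_derivative g x) (at x)" for x
    unfolding G_def g_def by (rule has_vector_derivative_real_field[OF Gd])
  have tyu: "exp_type_at_most u 1"
    unfolding u_def by (rule exp_type_at_most_power_mult[OF ty])
  have tyh: "exp_type_at_most h 1"
    by (rule exp_type_at_most_divide_quadratic[OF h ty]) simp
  have tyf: "exp_type_at_most f 1"
    unfolding f_def by (intro exp_type_at_most_add exp_type_at_most_cmult exp_type_at_most_ident_mult exp_type_at_most_deriv tyh h) simp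
  have feven: "f (- z) = f z" for z
  proof -
    have "((\<lambda>z. h (- z)) has_field_derivative deriv h (- z) * - 1) (at z)"
      by (rule DERIV_chain2[OF hd]) (auto intro!: derivative_eq_intros)
    then have "deriv h z = - deriv h (- z)"
      unfolding even using DERIV_unique[OF hd[of z]] by simp
    then show ?thesis by (simp add: f_def even)
  qed
  obtain A where A: "\<And>z. norm (u z) \<le> A * exp (2 * norm z)"
    using exp_type_at_most_nonneg[OF tyu, of 1] by auto
  have iu: "integrable lborel (\<lambda>x. u (of_real x))"
    using int by (simp add: u_def)
  note bern = bernstein_L1[OF uh A _ iu, simplified]
  have iu': "integrable lborel (\<lambda>x. deriv u (of_real x))" by (rule bern(1))
  obtain K where K: "\<And>x. norm (u (complex_of_real x)) \<le> K" using bern(2) by blast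
  have Gu: "G x * ((of_real x)\<^sup>2 - w\<^sup>2) = of_real x * u (of_real x)" for x
    by (simp add: G_def u_def dm)
  have low: "\<bar>x\<bar> \<le> norm ((complex_of_real x)\<^sup>2 - w\<^sup>2)" if "\<bar>x\<bar> \<ge> norm w + 1" for x
    using quadratic_lower[of w "of_real x"] that by simp
  \<comment> \<open>Differentiating G (z^2 - w^2) = z u expresses g through u and u' with the
    factors 1/\<rho>, z/\<rho> and (z/\<rho>)^2, all of modulus at most 1 once |x| \<ge> |w| +
    1.\<close>
  have gbound: "norm (g x) \<le> 3 * norm (u (of_real x)) + norm (deriv u (of_real x))" if x: "\<bar>x\<bar> \<ge> norm w + 1" for x
  proof -
    define z where "z = complex_of_real x"
    define \<rho> where "\<rho> = z\<^sup>2 - w\<^sup>2"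
    have nz: "norm z = \<bar>x\<bar>" by (simp add: z_def)
    have x1: "1 \<le> norm z" using x nz norm_ge_zero[of w] by linarith
    have \<rho>: "norm z \<le> norm \<rho>" using low[OF x] by (simp add: \<rho>_def z_def)
    have \<rho>0: "\<rho> \<noteq> 0" using x1 \<rho> by auto
    have "((\<lambda>z. z ^ d * h z * (z\<^sup>2 - w\<^sup>2)) has_field_derivative (z ^ (2 * m) * f z) * \<rho> + (2 * z) * (z ^ d * h z)) (at z)"
      unfolding \<rho>_def by (rule DERIV_mult[OF Gd]) (auto intro!: derivative_eq_intros)
    moreover have "((\<lambda>z. z * u z) has_field_derivative u z + z * deriv u z) (at z)"
    proof -
      have "(u has_field_derivative deriv u z) (at z)" using uh by (simp add: holomorphic_derivI)
      then show ?thesis by (auto intro!: derivative_eq_intros simp: algebra_simps)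
    qed
    moreover have "(\<lambda>z. z ^ d * h z * (z\<^sup>2 - w\<^sup>2)) = (\<lambda>z. z * u z)"
      by (simp add: u_def dm fun_eq_iff)
    ultimately have "(z ^ (2 * m) * f z) * \<rho> + (2 * z) * (z ^ d * h z) = u z + z * deriv u z"
      using DERIV_unique by metis
    then have "g x * \<rho> = u z + z * deriv u z - 2 * z * G x"
      by (simp add: g_def G_def z_def algebra_simps)
    then have "g x * \<rho> * \<rho> = (u z + z * deriv u z - 2 * z * G x) * \<rho>"
      by simp
    also have "\<dots> = (u z + z * deriv u z) * \<rho> - 2 * z * (G x * \<rho>)"
      by (simp add: algebra_simps)
    also have "G x * \<rho> = z * u z"
      using Gu[of x] by (simp add: z_def \<rho>_def)
    finally have e: "g x * \<rho> * \<rho> = (u z + z * deriv u z) * \<rho> - 2 * z * (z * u z)" .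
    have "g x = (g x * \<rho> * \<rho>) / (\<rho> * \<rho>)"
      using \<rho>0 by simp
    also have "\<dots> = u z * (1 / \<rho>) + deriv u z * (z / \<rho>) - 2 * u z * (z / \<rho>)\<^sup>2"
      unfolding e using \<rho>0 by (simp add: diff_divide_distrib add_divide_distrib power2_eq_square mult_ac)
    finally have eq: "g x = u z * (1 / \<rho>) + deriv u z * (z / \<rho>) - 2 * u z * (z / \<rho>)\<^sup>2" .
    have r1: "norm (1 / \<rho>) \<le> 1" "norm (z / \<rho>) \<le> 1"
      using x1 \<rho> by (auto simp: norm_divide divide_le_eq)
    have "norm (g x) \<le> norm (u z * (1 / \<rho>)) + norm (deriv u z * (z / \<rho>)) + norm (2 * u z * (z / \<rho>)\<^sup>2)"
      unfolding eq by (rule order_trans[OF norm_triangle_ineq4 add_right_mono[OF norm_triangle_ineq]])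
    also have "norm (u z * (1 / \<rho>)) \<le> norm (u z)"
      unfolding norm_mult using r1(1) by (rule mult_left_le) simp
    also have "norm (deriv u z * (z / \<rho>)) \<le> norm (deriv u z)"
      unfolding norm_mult using r1(2) by (rule mult_left_le) simp
    also have "norm (2 * u z * (z / \<rho>)\<^sup>2) \<le> norm (2 * u z)"
      unfolding norm_mult[of "2 * u z"] norm_power using power_le_one[OF norm_ge_zero r1(2)] by (rule mult_left_le) simp
    finally show ?thesis by (simp add: z_def norm_mult)
  qed
  have gm: "g \<in> borel_measurable borel"
  proof -
    have "(\<lambda>z. z ^ (2 * m) * f z) holomorphic_on UNIV"
      by (intro holomorphic_on_mult holomorphic_on_power holomorphic_on_ident fh)
    from entire_of_real_measurable[OF this] show ?thesis by (simp add: g_def)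
  qed
  have ig: "integrable lborel g"
  proof -
    define X where "X = norm w + 1"
    have "continuous_on UNIV f" using fh by (rule holomorphic_on_imp_continuous_on)
    then have "continuous_on {- X..X} (\<lambda>x. f (complex_of_real x))"
      by (rule continuous_on_compose2) (auto intro: continuous_intros)
    then have "continuous_on {- X..X} g"
      unfolding g_def by (rule continuous_on_mult[OF continuous_on_power[OF continuous_on_of_real[OF continuous_on_id]]])
    then have "bounded (g ` {- X..X})"
      by (intro compact_imp_bounded compact_continuous_image) auto
    then obtain B where B: "\<And>x. x \<in> {- X..X} \<Longrightarrow> norm (g x) \<le> B"
      unfolding bounded_iff by blast
    have "X \<ge> 0" by (simp add: X_def)
    then have B0: "B \<ge> 0" using order_trans[OF norm_ge_zero B[of 0]] by simp
    \<comment> \<open>B dominates g on the compact middle part, u and u' dominate it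
      outside.\<close>
    have "integrable lborel (\<lambda>x. B * indicator {- X..X} x + (3 * norm (u (of_real x)) + norm (deriv u (of_real x))))"
      using iu iu' by (intro Bochner_Integration.integrable_add integrable_mult_right integrable_norm integrable_real_indicator)
        (auto simp: emeasure_lborel_Icc_eq)
    then show ?thesis
    proof (rule Bochner_Integration.integrable_bound)
      show "AE x in lborel. norm (g x) \<le> norm (B * indicator {- X..X} x + (3 * norm (u (of_real x)) + norm (deriv u (of_real x))))"
      proof (rule AE_I2)
        fix x :: real
        have "norm (g x) \<le> B * indicator {- X..X} x + (3 * norm (u (of_real x)) + norm (deriv u (of_real x)))"
        proof (cases "x \<in> {- X..X}")
          case True
          then show ?thesis
            using B[OF True] by (simp add: add_increasing2)
        next
          case False
          then have "\<bar>x\<bar> \<ge> X" by auto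
          then show ?thesis using gbound[of x] False by (simp add: X_def)
        qed
        then show "norm (g x) \<le> norm (B * indicator {- X..X} x + (3 * norm (u (of_real x)) + norm (deriv u (of_real x))))"
          by simp
      qed
    qed (use gm in simp)
  qed
  have rg: "radial_weight d x *\<^sub>R f (of_real x) = indicator {0..} x *\<^sub>R g x" for x
    by (simp add: radial_weight_def g_def dm scaleR_conv_of_real)
  have adm: "admissible d f"
    unfolding admissible_def rg using fh feven tyf integrable_mult_indicator[OF _ ig, of "{0..}"] by simp
  have lim1: "(\<lambda>n. LINT x|lborel. indicator {0..node n} x *\<^sub>R (sign x *\<^sub>R g x)) \<longlonglongrightarrow>
      (LINT x|lborel. indicator {0..} x *\<^sub>R (sign x *\<^sub>R g x))"
  proof (rule integral_dominated_convergence)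
    show "integrable lborel (\<lambda>x. norm (g x))" using ig by (rule integrable_norm)
    show "AE x in lborel. (\<lambda>n. indicator {0..node n} x *\<^sub>R (sign x *\<^sub>R g x)) \<longlonglongrightarrow> indicator {0..} x *\<^sub>R (sign x *\<^sub>R g x)"
    proof (rule AE_I2)
      fix x :: real
      have "\<forall>\<^sub>F n in sequentially. x \<le> node n"
        using node_at_top by (auto simp: filterlim_at_top)
      then have "\<forall>\<^sub>F n in sequentially. indicator {0..} x *\<^sub>R (sign x *\<^sub>R g x) = indicator {0..node n} x *\<^sub>R (sign x *\<^sub>R g x)"
        by eventually_elim (simp add: indicator_def)
      then show "(\<lambda>n. indicator {0..node n} x *\<^sub>R (sign x *\<^sub>R g x)) \<longlonglongrightarrow> indicator {0..} x *\<^sub>R (sign x *\<^sub>R g x)"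
        by (rule Lim_transform_eventually[OF tendsto_const])
    qed
    show "AE x in lborel. norm (indicator {0..node n} x *\<^sub>R (sign x *\<^sub>R g x)) \<le> norm (g x)" for n
      using abs_sign_le by (intro AE_I2) (auto simp: indicator_def intro: mult_left_le_one_le)
  qed (use gm in \<open>simp_all\<close>)
  have isg: "integrable lborel (\<lambda>x. sign x *\<^sub>R g x)"
    by (rule Bochner_Integration.integrable_bound[OF ig])
      (use gm abs_sign_le in \<open>auto intro!: AE_I2 mult_left_le_one_le\<close>)
  have "(LINT x|lborel. indicator {0..node n} x *\<^sub>R (sign x *\<^sub>R g x)) =
      2 * (\<Sum>k=1..n. (-1) ^ (k + 1) * G (\<tau> k)) + (-1) ^ n * G (node n)" for n
  proof -
    have si: "set_integrable lborel {0..node n} (\<lambda>x. sign x *\<^sub>R g x)"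
      unfolding set_integrable_def by (intro integrable_mult_indicator isg) simp
    have "(LINT x|lborel. indicator {0..node n} x *\<^sub>R (sign x *\<^sub>R g x)) = integral {0..node n} (\<lambda>x. sign x *\<^sub>R g x)"
      using set_borel_integral_eq_integral(2)[OF si] by (simp add: set_lebesgue_integral_def)
    also have "\<dots> = (\<Sum>k<n. (-1) ^ k * (G (node (Suc k)) - G (node k)))"
      by (rule integral_unique[OF has_integral_sign_derivative[OF Gg]])
    also have "\<dots> = 2 * (\<Sum>k=1..n. (-1) ^ (k + 1) * G (\<tau> k)) + (-1) ^ n * G (node n)"
      by (rule alternating_increments) (simp add: G_def dm)
    finally show ?thesis .
  qed
  moreover have "(LINT x|lborel. indicator {0..} x *\<^sub>R (sign x *\<^sub>R g x)) = 2 * of_real (a_const T) * h 0"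
  proof -
    have "(LINT x|lborel. indicator {0..} x *\<^sub>R (sign x *\<^sub>R g x)) = (LINT r|lborel. (radial_weight d r * sign r) *\<^sub>R f (of_real r))"
    proof (rule Bochner_Integration.integral_cong[OF refl])
      fix r
      show "indicator {0..} r *\<^sub>R (sign r *\<^sub>R g r) = (radial_weight d r * sign r) *\<^sub>R f (of_real r)"
        using arg_cong[OF rg[of r], of "\<lambda>y. sign r *\<^sub>R y"] by (simp add: mult.commute)
    qed
    then show ?thesis
      using extremal_quadrature[OF adm] d_pos by (simp add: f_def)
  qed
  ultimately have lim2: "(\<lambda>n. 2 * (\<Sum>k=1..n. (-1) ^ (k + 1) * G (\<tau> k)) + (-1) ^ n * G (node n)) \<longlonglongrightarrow> 2 * of_real (a_const T) * h 0"
    using lim1 by simp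
  \<comment> \<open>G = x u / (x^2 - w^2) decays because u is bounded on the line, so the boundary
    term at the last node disappears.\<close>
  have "(\<lambda>n. (-1) ^ n * G (node n)) \<longlonglongrightarrow> 0"
  proof (rule Lim_null_comparison)
    have ev: "\<forall>\<^sub>F n in sequentially. norm w + 1 \<le> node n"
      using node_at_top by (auto simp: filterlim_at_top)
    have X: "norm (G x) \<le> K * (x / (x\<^sup>2 - (norm w)\<^sup>2))" if x: "x \<ge> norm w + 1" for x
    proof -
      have "norm w < x" using x by linarith
      then have pos: "x\<^sup>2 - (norm w)\<^sup>2 > 0" "x \<ge> 0"
        using power_strict_mono[of "norm w" x 2] order_trans[OF norm_ge_zero, of w x] by auto
      have "(x\<^sup>2 - (norm w)\<^sup>2) * norm (G x) \<le> norm ((of_real x)\<^sup>2 - w\<^sup>2) * norm (G x)"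
        using norm_triangle_ineq2[of "complex_of_real x ^ 2" "w\<^sup>2"] by (intro mult_right_mono) (auto simp: norm_power)
      also have "\<dots> = x * norm (u (of_real x))"
        using arg_cong[OF Gu[of x], of norm] pos by (simp add: norm_mult mult.commute)
      also have "\<dots> \<le> x * K"
        using K pos by (intro mult_left_mono) auto
      finally show ?thesis using pos by (simp add: field_simps)
    qed
    show "\<forall>\<^sub>F n in sequentially. norm ((-1) ^ n * G (node n)) \<le> K * (node n / ((node n)\<^sup>2 - (norm w)\<^sup>2))"
      using ev
    proof eventually_elim
      case (elim n)
      then show ?case using X[of "node n"] by (simp add: norm_mult norm_power)
    qed
    have "((\<lambda>x::real. x / (x\<^sup>2 - (norm w)\<^sup>2)) \<longlongrightarrow> 0) at_top"
      by real_asymp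
    then have "(\<lambda>n. node n / ((node n)\<^sup>2 - (norm w)\<^sup>2)) \<longlonglongrightarrow> 0"
      using node_at_top by (rule filterlim_compose)
    then show "(\<lambda>n. K * (node n / ((node n)\<^sup>2 - (norm w)\<^sup>2))) \<longlonglongrightarrow> 0"
      by (rule tendsto_mult_right_zero)
  qed
  from tendsto_diff[OF lim2 this] have "(\<lambda>n. 2 * (\<Sum>k=1..n. (-1) ^ (k + 1) * G (\<tau> k))) \<longlonglongrightarrow> 2 * of_real (a_const T) * h 0"
    by simp
  then have "(\<lambda>n. 1 / 2 * (2 * (\<Sum>k=1..n. (-1) ^ (k + 1) * G (\<tau> k)))) \<longlonglongrightarrow> 1 / 2 * (2 * of_real (a_const T) * h 0)"
    by (rule tendsto_mult[OF tendsto_const])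
  then show ?thesis
    by (simp add: G_def)
qed

end

subsection \<open>Polynomial growth of the reciprocal\<close>

lemma even_holomorphic_sinc:
  obtains S :: "complex \<Rightarrow> complex" where "S holomorphic_on UNIV" "\<And>z :: complex. sin z = z * S z" "\<And>z. S (- z) = S z"
proof -
  have "(sin :: complex \<Rightarrow> complex) holomorphic_on UNIV"
    by (simp add: holomorphic_on_def field_differentiable_within_sin)
  moreover have "sin (0 :: complex) = 0" by simp
  ultimately obtain S :: "complex \<Rightarrow> complex" where S: "S holomorphic_on UNIV" "\<And>z :: complex. sin z = (z - 0) * S z"
    by (rule entire_divide_linear) (rule that)
  have "S (- z) = S z" for z
  proof (rule eq_if_eq_off_real[of "\<lambda>z. S (- z)" S])
    show "continuous_on UNIV S" using S(1) by (rule holomorphic_on_imp_continuous_on)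
    show "continuous_on UNIV (\<lambda>z. S (- z))"
      by (rule holomorphic_on_imp_continuous_on[OF entire_reflect[OF S(1)]])
    fix z :: complex assume "Im z \<noteq> 0"
    then have "z \<noteq> 0" by auto
    moreover have "z * S (- z) = z * S z"
      using S(2)[of z] S(2)[of "- z"] by auto
    ultimately show "S (- z) = S z" by simp
  qed
  then show ?thesis using that S by simp
qed

lemma norm_sin_le_exp: "norm (sin z) \<le> exp (norm (z :: complex))"
proof -
  have "norm (exp (\<i> * z) - exp (- \<i> * z)) \<le> norm (exp (\<i> * z)) + norm (exp (- \<i> * z))"
    by (rule norm_triangle_ineq4)
  also have "\<dots> \<le> exp (norm z) + exp (norm z)"
    using norm_exp[of "\<i> * z"] norm_exp[of "- \<i> * z"] by (intro add_mono) (simp_all only: norm_mult norm_ii norm_minus_cancel mult_1 mult_minus_left)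
  finally show ?thesis
    by (simp add: sin_exp_eq norm_divide norm_mult)
qed

text \<open>From |sin(x + iy)| \<ge> sinh |y| \<ge> |y|; it bounds the comparison function from
  below.\<close>

lemma norm_sin_ge_abs_Im: "\<bar>Im z\<bar> \<le> norm (sin (z :: complex))"
proof -
  have 1: "y \<le> norm (sin (Complex x y))" if "y \<ge> 0" for x y
  proof -
    have "norm (exp (- \<i> * Complex x y)) - norm (exp (\<i> * Complex x y)) \<le> norm (exp (\<i> * Complex x y) - exp (- \<i> * Complex x y))"
      using norm_triangle_ineq2[of "exp (- \<i> * Complex x y)" "exp (\<i> * Complex x y)"] by (simp only: norm_minus_commute)
    then have "exp y - exp (- y) \<le> norm (exp (\<i> * Complex x y) - exp (- \<i> * Complex x y))"
      by (simp add: norm_exp_eq_Re)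
    moreover have "norm (sin (Complex x y)) = norm (exp (\<i> * Complex x y) - exp (- \<i> * Complex x y)) / 2"
      by (simp add: sin_exp_eq norm_divide norm_mult)
    moreover have "2 * y \<le> exp y - exp (- y)"
      using real_le_x_sinh[OF that] by (simp add: exp_minus)
    ultimately show ?thesis by simp
  qed
  show ?thesis
  proof (cases "Im z \<ge> 0")
    case True
    then show ?thesis using 1[of "Im z" "Re z"] by simp
  next
    case False
    have "- z = Complex (- Re z) (- Im z)" by (simp add: complex_eq_iff)
    then show ?thesis using 1[of "- Im z" "- Re z"] False norm_minus_cancel[of "sin z"] by (simp flip: sin_minus)
  qed
qed


lemma integrable_lborel_if_inverse_square_decay:
  fixes f :: "real \<Rightarrow> complex"
  assumes f: "continuous_on UNIV f" and C: "\<And>x. norm (f x) * (1 + x\<^sup>2) \<le> C"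
  shows "integrable lborel f"
proof (rule integrable_lborel_if_bounded_on_intervals[OF f])
  fix n :: nat
  have C0: "C \<ge> 0" using order_trans[OF norm_ge_zero] C[of 0] by simp
  have ar: "((\<lambda>x. C * inverse (1 + x\<^sup>2)) has_integral C * arctan (real n) - C * arctan (- real n)) {- real n..real n}"
    by (rule fundamental_theorem_of_calculus)
      (auto intro!: derivative_eq_intros simp: has_real_derivative_iff_has_vector_derivative[symmetric])
  have "integral {- real n..real n} (\<lambda>x. norm (f x)) \<le> integral {- real n..real n} (\<lambda>x. C * inverse (1 + x\<^sup>2))"
  proof (rule integral_le)
    show "(\<lambda>x. norm (f x)) integrable_on {- real n..real n}"
      by (intro integrable_continuous_interval continuous_on_norm continuous_on_subset[OF f]) auto
    show "(\<lambda>x. C * inverse (1 + x\<^sup>2)) integrable_on {- real n..real n}"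
      using ar by blast
    fix x :: real
    have "1 + x\<^sup>2 > 0" by (simp add: add_pos_nonneg)
    then show "norm (f x) \<le> C * inverse (1 + x\<^sup>2)"
      using C[of x] by (simp add: field_simps)
  qed
  also have "\<dots> = C * (arctan (real n) - arctan (- real n))"
    using integral_unique[OF ar] by (simp add: right_diff_distrib)
  also have "\<dots> \<le> C * pi"
    using C0 arctan_ubound[of "real n"] arctan_lbound[of "- real n"] by (intro mult_left_mono) auto
  finally show "integral {- real n..real n} (\<lambda>x. norm (f x)) \<le> C * pi" .
qed

text \<open>The function is (sin(z/N) / (z/N))^N: the N factors of type 1/N add up to type 1, each
  gives one power of decay on the real line, and |sin u| \<ge> |Im u| bounds the product from below
  off the axis.\<close>

lemma decaying_comparison_function:
  fixes N :: nat
  assumes N: "N \<ge> 1"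
  obtains \<psi> :: "complex \<Rightarrow> complex" and B :: real where "\<psi> holomorphic_on UNIV" "\<And>z. \<psi> (- z) = \<psi> z"
    "exp_type_at_most \<psi> 1" "\<And>x. norm (\<psi> (of_real x)) \<le> B" "\<And>x. norm (\<psi> (of_real x)) * \<bar>x\<bar> ^ N \<le> B"
    "\<And>z. Im z \<noteq> 0 \<Longrightarrow> (\<bar>Im z\<bar> / norm z) ^ N \<le> norm (\<psi> z)"
proof -
  obtain S :: "complex \<Rightarrow> complex" where S: "S holomorphic_on UNIV" "\<And>z :: complex. sin z = z * S z" "\<And>z. S (- z) = S z"
    using even_holomorphic_sinc by blast
  define \<psi> where "\<psi> = (\<lambda>z. S (1 / of_nat N * z) ^ N)"
  have "continuous_on (cball 0 1) S"
    using S(1) holomorphic_on_imp_continuous_on holomorphic_on_subset by blast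
  then have "bounded (S ` cball 0 1)"
    by (intro compact_imp_bounded compact_continuous_image) auto
  then obtain B0 where B0: "\<And>z. norm z \<le> 1 \<Longrightarrow> norm (S z) \<le> B0"
    unfolding bounded_iff by fastforce
  define B1 where "B1 = max B0 1"
  have B1: "B1 \<ge> 1" by (simp add: B1_def)
  have nS: "norm (S z) * norm z = norm (sin z)" for z
    using S(2)[of z] by (simp add: norm_mult mult.commute)
  have SB: "norm (S z) \<le> B1 * b" if "norm (sin z) \<le> b" "1 \<le> b" for z b
  proof (cases "norm z \<le> 1")
    case True
    then have "norm (S z) \<le> B1" using B0[of z] by (simp add: B1_def)
    also have "\<dots> \<le> B1 * b" using that B1 by (simp add: mult_le_cancel_left1)
    finally show ?thesis .
  next
    case False
    then have "norm (S z) * 1 \<le> norm (S z) * norm z" by (intro mult_left_mono) auto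
    also have "\<dots> \<le> b" using nS that by simp
    also have "\<dots> \<le> B1 * b" using that B1 by (simp add: mult_le_cancel_right1)
    finally show ?thesis by simp
  qed
  have "norm (S z) \<le> B1 * exp (norm z)" for z
    by (rule SB[OF norm_sin_le_exp]) simp
  then have "norm (S (1 / of_nat N * z)) ^ N \<le> (B1 * exp (norm (1 / of_nat N * z))) ^ N" for z
    by (intro power_mono) auto
  then have \<psi>1: "norm (\<psi> z) \<le> B1 ^ N * exp (norm z)" for z
    using N by (simp add: \<psi>_def norm_power power_mult_distrib norm_mult norm_divide flip: exp_of_nat_mult)
  have "exp_type_at_most \<psi> 1"
    unfolding exp_type_at_most_def
  proof (intro allI impI exI)
    fix \<epsilon> :: real and z :: complex assume "\<epsilon> > 0"
    then have "exp (norm z) \<le> exp ((1 + \<epsilon>) * norm z)"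
      by (simp add: mult_le_cancel_right1)
    then have "B1 ^ N * exp (norm z) \<le> B1 ^ N * exp ((1 + \<epsilon>) * norm z)"
      using B1 by (intro mult_left_mono) auto
    then show "norm (\<psi> z) \<le> B1 ^ N * exp ((1 + \<epsilon>) * norm z)"
      using \<psi>1[of z] by linarith
  qed
  moreover have "\<psi> holomorphic_on UNIV"
    unfolding \<psi>_def by (intro holomorphic_on_power entire_rescale S(1))
  moreover have "\<psi> (- z) = \<psi> z" for z
    using S(3)[of "1 / of_nat N * z"] by (simp add: \<psi>_def)
  moreover have sinr: "norm (sin (complex_of_real x)) \<le> 1" for x
    by (simp add: sin_of_real)
  then have "norm (S (of_real x)) \<le> B1" for x
    using SB[OF sinr, of x] by simp
  then have "norm (S (of_real (1 / real N * x))) ^ N \<le> B1 ^ N" for x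
    by (rule power_mono) simp
  then have "norm (\<psi> (of_real x)) \<le> B1 ^ N + real N ^ N" for x
    by (simp add: \<psi>_def norm_power add_increasing2)
  moreover have "norm (\<psi> (of_real x)) * \<bar>x\<bar> ^ N \<le> B1 ^ N + real N ^ N" for x
  proof -
    have "norm (S (of_real (x / real N))) * \<bar>x / real N\<bar> \<le> 1"
      using nS[of "of_real (x / real N)"] sinr[of "x / real N"] by (simp only: norm_of_real)
    then have "norm (S (of_real (x / real N))) * \<bar>x\<bar> \<le> real N"
      using N by (simp add: divide_le_eq)
    then have "(norm (S (of_real (x / real N))) * \<bar>x\<bar>) ^ N \<le> real N ^ N"
      by (intro power_mono) auto
    moreover have "B1 ^ N \<ge> 0" using B1 by simp
    ultimately show ?thesis
      by (simp add: \<psi>_def norm_power power_mult_distrib)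
  qed
  moreover have "(\<bar>Im z\<bar> / norm z) ^ N \<le> norm (\<psi> z)" if z: "Im z \<noteq> 0" for z
  proof -
    have nz: "norm z > 0" using z by auto
    let ?u = "1 / of_nat N * z"
    have "\<bar>Im z\<bar> / real N \<le> norm (S ?u) * (norm z / real N)"
      using norm_sin_ge_abs_Im[of ?u] nS[of ?u] by (simp add: norm_divide)
    then have "\<bar>Im z\<bar> / norm z \<le> norm (S ?u)"
      using N nz by (simp add: field_simps)
    then have "(\<bar>Im z\<bar> / norm z) ^ N \<le> norm (S ?u) ^ N"
      by (intro power_mono) auto
    then show ?thesis by (simp add: \<psi>_def norm_power)
  qed
  ultimately show ?thesis using that by blast
qed

section \<open>Values of \<phi>' at the zeros and the bound for 1/\<phi>\<close>

context extremal_zeros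
begin

text \<open>Evenness folds the negative half-line onto the positive one, where |x|^(2m) is the
  radial weight because d - 1 = 2m.\<close>

lemma admissible_integrable_line:
  assumes "admissible d f"
  shows "integrable lborel (\<lambda>x. complex_of_real x ^ (2 * m) * f (of_real x))"
proof -
  let ?g = "\<lambda>x. complex_of_real x ^ (2 * m) * f (of_real x)"
  have f: "f holomorphic_on UNIV" "\<And>z. f (- z) = f z" "integrable lborel (\<lambda>r. radial_weight d r *\<^sub>R f (of_real r))"
    using assms by (auto simp: admissible_def)
  have i: "integrable lborel (\<lambda>x. norm (radial_weight d x *\<^sub>R f (of_real x)))"
    by (rule integrable_norm[OF f(3)])
  have i': "integrable lborel (\<lambda>x. norm (radial_weight d (- x) *\<^sub>R f (of_real (- x))))"
    using lborel_integrable_real_affine[OF i, of "-1" 0] by simp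
  show ?thesis
  proof (rule Bochner_Integration.integrable_bound[OF Bochner_Integration.integrable_add[OF i i']])
    have "(\<lambda>z. z ^ (2 * m) * f z) holomorphic_on UNIV"
      by (intro holomorphic_on_mult holomorphic_on_power holomorphic_on_ident f(1))
    from entire_of_real_measurable[OF this] show "?g \<in> borel_measurable lborel" by simp
    show "AE x in lborel. norm (?g x) \<le> norm (norm (radial_weight d x *\<^sub>R f (of_real x)) + norm (radial_weight d (- x) *\<^sub>R f (of_real (- x))))"
    proof (rule AE_I2)
      fix x :: real
      have "norm (?g x) \<le> norm (radial_weight d x *\<^sub>R f (of_real x)) + norm (radial_weight d (- x) *\<^sub>R f (of_real (- x)))"
      proof (cases "x \<ge> 0")
        case True
        then have "norm (?g x) = norm (radial_weight d x *\<^sub>R f (of_real x))"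
          by (simp add: radial_weight_def dm norm_mult norm_power)
        then show ?thesis by simp
      next
        case False
        then have "norm (?g x) = norm (radial_weight d (- x) *\<^sub>R f (of_real (- x)))"
          using f(2)[of "of_real x"] by (simp add: radial_weight_def dm norm_mult norm_power power_mult)
        then show ?thesis by simp
      qed
      then show "norm (?g x) \<le> norm (norm (radial_weight d x *\<^sub>R f (of_real x)) + norm (radial_weight d (- x) *\<^sub>R f (of_real (- x))))"
        by (simp only: real_norm_def abs_of_nonneg add_nonneg_nonneg norm_ge_zero)
    qed
  qed
qed

lemma phi_tau: "k \<ge> 1 \<Longrightarrow> \<phi> (of_real (\<tau> k)) = 0"
  using positive_zeros by blast

lemma tau_inj: "i \<ge> 1 \<Longrightarrow> j \<ge> 1 \<Longrightarrow> \<tau> i = \<tau> j \<Longrightarrow> i = j"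
  using tau_mono by (metis atLeast_iff linorder_neqE_nat order_less_irrefl strict_mono_onD)

text \<open>The test function vanishes at every node except \<tau>_j, so the quadrature series
  collapses to one term; it relates h(0) = -1/\<tau>_j^2 to h(\<tau>_j) = \<phi>'(\<tau>_j) / (2
  \<tau>_j).\<close>

lemma deriv_phi_at_tau:
  assumes j: "j \<ge> 1"
  shows "of_real (\<tau> j) ^ (d + 1) * deriv \<phi> (of_real (\<tau> j)) = 2 * of_real (a_const T) * (-1) ^ j"
proof -
  define t where "t = complex_of_real (\<tau> j)"
  have t0: "t \<noteq> 0" using tau_pos[OF j] by (simp add: t_def)
  obtain h where h: "h holomorphic_on UNIV" "\<And>z. h (- z) = h z" "\<And>z. \<phi> z = (z\<^sup>2 - t\<^sup>2) * h z"
    using even_entire_divide_quadratic[OF phi_holomorphic phi_even, of t] phi_tau[OF j] t0 by (auto simp: t_def)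
  have "\<phi> = (\<lambda>z. (z\<^sup>2 - t\<^sup>2) * h z)" using h(3) by auto
  then have lim: "(\<lambda>n. \<Sum>k=1..n. (-1) ^ (k + 1) * (of_real (\<tau> k) ^ d * h (of_real (\<tau> k)))) \<longlonglongrightarrow> of_real (a_const T) * h 0"
    using phi_admissible admissible_integrable_line[OF phi_admissible] 
    by (intro node_quadrature[OF h(1,2)]) (auto simp: admissible_def)
  have "h (of_real (\<tau> k)) = 0" if "k \<ge> 1" "k \<noteq> j" for k
  proof -
    have "\<tau> k \<noteq> \<tau> j" using tau_inj that j by blast
    then have "(complex_of_real (\<tau> k))\<^sup>2 - t\<^sup>2 \<noteq> 0"
      using tau_pos[OF j] tau_pos[OF that(1)] by (auto simp: t_def power2_eq_iff simp flip: of_real_minus)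
    then show ?thesis using h(3)[of "of_real (\<tau> k)"] phi_tau[OF that(1)] by simp
  qed
  then have "(\<Sum>k=1..n. (-1) ^ (k + 1) * (of_real (\<tau> k) ^ d * h (of_real (\<tau> k)))) = (-1) ^ (j + 1) * (t ^ d * h t)" if "n \<ge> j" for n
    using that j by (subst sum.remove[of _ j]) (auto simp: t_def intro!: sum.neutral)
  then have "(\<lambda>n. \<Sum>k=1..n. (-1) ^ (k + 1) * (of_real (\<tau> k) ^ d * h (of_real (\<tau> k)))) \<longlonglongrightarrow> (-1) ^ (j + 1) * (t ^ d * h t)"
    by (intro tendsto_eventually) (auto simp: eventually_at_top_linorder)
  then have eq: "of_real (a_const T) * h 0 = (-1) ^ (j + 1) * (t ^ d * h t)"
    using lim LIMSEQ_unique by blast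
  have h0: "h 0 * t\<^sup>2 = - 1" using h(3)[of 0] phi_0 by (simp add: minus_equation_iff mult.commute)
  have "(h has_field_derivative deriv h t) (at t)" using h(1) by (simp add: holomorphic_derivI)
  then have "((\<lambda>z. (z\<^sup>2 - t\<^sup>2) * h z) has_field_derivative 2 * t * h t) (at t)"
    by (auto intro!: derivative_eq_intros)
  then have "deriv \<phi> t = 2 * t * h t"
    using \<open>\<phi> = (\<lambda>z. (z\<^sup>2 - t\<^sup>2) * h z)\<close> DERIV_imp_deriv by metis
  then have "t ^ (d + 1) * deriv \<phi> t = 2 * t\<^sup>2 * (t ^ d * h t)"
    by (simp add: power2_eq_square)
  also have "t ^ d * h t = (-1) ^ (j + 1) * (of_real (a_const T) * h 0)"
    unfolding eq by (simp flip: mult.assoc power_add)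
  also have "2 * t\<^sup>2 * ((-1) ^ (j + 1) * (of_real (a_const T) * h 0)) = 2 * of_real (a_const T) * (-1) ^ (j + 1) * (h 0 * t\<^sup>2)"
    by (simp only: mult_ac)
  also have "\<dots> = 2 * of_real (a_const T) * (-1) ^ j"
    unfolding h0 by simp
  finally show ?thesis by (simp only: t_def)
qed

text \<open>For w off the axis, v = \<psi>(w) \<phi> - \<phi>(w) \<psi> vanishes at w and -w; let h
  = v / (z^2 - w^2). At the nodes v = -\<phi>(w) \<psi>, so the quadrature bounds h(0) = (\<phi>(w)
  \<psi>(0) - \<psi>(w)) / w^2 by a multiple of |\<phi>(w)|. Hence |\<psi>(w)| is at most
  |\<phi>(w)| times a power of the weight, and the lower bound for \<psi> becomes an upper bound for
  1/\<phi>.\<close>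

lemma tame_inverse_phi: "tame (\<lambda>z. 1 / \<phi> z)"
proof -
  \<comment> \<open>Powers of decay for \<psi>: d against the factor \<tau>_k^d of the quadrature,
    and 2 more to leave the summable 1/\<tau>_k^2.\<close>
  define N where "N = d + 2"
  obtain \<psi> B where \<psi>: "\<psi> holomorphic_on UNIV" "\<And>z. \<psi> (- z) = \<psi> z" "exp_type_at_most \<psi> 1"
    and B: "\<And>x. norm (\<psi> (complex_of_real x)) \<le> B" "\<And>x. norm (\<psi> (of_real x)) * \<bar>x\<bar> ^ N \<le> B"
    and low: "\<And>z. Im z \<noteq> 0 \<Longrightarrow> (\<bar>Im z\<bar> / norm z) ^ N \<le> norm (\<psi> z)"
    using decaying_comparison_function[of N] by (auto simp: N_def)
  define a where "a = a_const T"
  have a: "a > 0" unfolding a_def by (rule a_const_pos)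
  have B0: "B \<ge> 0" using order_trans[OF norm_ge_zero B(1)] .
  have i\<psi>: "integrable lborel (\<lambda>x. complex_of_real x ^ (2 * m) * \<psi> (of_real x))"
  proof (rule integrable_lborel_if_inverse_square_decay)
    have "continuous_on UNIV \<psi>" using \<psi>(1) by (rule holomorphic_on_imp_continuous_on)
    then have "continuous_on UNIV (\<lambda>x. \<psi> (complex_of_real x))"
      by (rule continuous_on_compose2) (auto intro: continuous_intros)
    then show "continuous_on UNIV (\<lambda>x. complex_of_real x ^ (2 * m) * \<psi> (of_real x))"
      by (rule continuous_on_mult[OF continuous_on_power[OF continuous_on_of_real[OF continuous_on_id]]])
    fix x :: real
    show "norm (complex_of_real x ^ (2 * m) * \<psi> (of_real x)) * (1 + x\<^sup>2) \<le> B + B"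
    proof (cases "\<bar>x\<bar> \<le> 1")
      case True
      then have "\<bar>x\<bar> ^ (2 * m) \<le> 1" "\<bar>x\<bar>\<^sup>2 \<le> 1" by (simp_all add: power_le_one abs_square_le_1)
      then have "(\<bar>x\<bar> ^ (2 * m) * norm (\<psi> (of_real x))) * (1 + x\<^sup>2) \<le> (1 * B) * 2"
        using B(1) B0 by (intro mult_mono) auto
      then show ?thesis by (simp add: norm_mult norm_power)
    next
      case False
      then have "1 \<le> \<bar>x\<bar>" by simp
      then have "\<bar>x\<bar> ^ (2 * m) \<le> \<bar>x\<bar> ^ N" "\<bar>x\<bar> ^ (2 * m + 2) \<le> \<bar>x\<bar> ^ N"
        by (intro power_increasing; simp add: N_def dm)+
      then have "\<bar>x\<bar> ^ (2 * m) * 1 \<le> \<bar>x\<bar> ^ N" "\<bar>x\<bar> ^ (2 * m) * \<bar>x\<bar>\<^sup>2 \<le> \<bar>x\<bar> ^ N"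
        by (simp_all only: power_add mult_1_right)
      then have "norm (\<psi> (of_real x)) * (\<bar>x\<bar> ^ (2 * m) * 1 + \<bar>x\<bar> ^ (2 * m) * \<bar>x\<bar>\<^sup>2) \<le> norm (\<psi> (of_real x)) * (\<bar>x\<bar> ^ N + \<bar>x\<bar> ^ N)"
        by (intro mult_left_mono add_mono) auto
      also have "\<dots> \<le> B + B" using B(2)[of x] by (simp add: distrib_left)
      finally show ?thesis by (simp add: norm_mult norm_power algebra_simps)
    qed
  qed
  have i\<phi>: "integrable lborel (\<lambda>x. complex_of_real x ^ (2 * m) * \<phi> (of_real x))"
    by (rule admissible_integrable_line[OF phi_admissible])
  have ty\<phi>: "exp_type_at_most \<phi> 1" using phi_admissible by (simp add: admissible_def)
  define C where "C = norm (\<psi> 0) + B * T2 / a"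
  have C0: "C \<ge> 0" unfolding C_def using B0 T2_nonneg a by simp
  have "norm (1 / \<phi> w) \<le> C * ((1 + norm w) * (1 + 1 / \<bar>Im w\<bar>)) ^ (N + 2)" if w: "Im w \<noteq> 0" for w
  proof -
    have w0: "w \<noteq> 0" using w by auto
    have \<phi>w: "\<phi> w \<noteq> 0" using zeros_simple[of w] w by (auto simp: complex_is_Real_iff)
    define v where "v = (\<lambda>z. \<psi> w * \<phi> z + (- \<phi> w) * \<psi> z)"
    have vh: "v holomorphic_on UNIV"
      unfolding v_def by (intro holomorphic_intros \<psi>(1) phi_holomorphic)
    obtain h where h: "h holomorphic_on UNIV" "\<And>z. h (- z) = h z" "\<And>z. v z = (z\<^sup>2 - w\<^sup>2) * h z"
      using even_entire_divide_quadratic[OF vh, of w] w0 by (auto simp: v_def phi_even \<psi>(2))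
    have tyv: "exp_type_at_most v 1"
      unfolding v_def by (intro exp_type_at_most_add exp_type_at_most_cmult ty\<phi> \<psi>(3))
    have "integrable lborel (\<lambda>x. \<psi> w * (complex_of_real x ^ (2 * m) * \<phi> (of_real x)) + (- \<phi> w) * (complex_of_real x ^ (2 * m) * \<psi> (of_real x)))"
      by (intro Bochner_Integration.integrable_add integrable_mult_right i\<phi> i\<psi>)
    then have iv: "integrable lborel (\<lambda>x. complex_of_real x ^ (2 * m) * v (of_real x))"
      by (simp add: v_def algebra_simps)
    have lim: "(\<lambda>n. \<Sum>k=1..n. (-1) ^ (k + 1) * (of_real (\<tau> k) ^ d * h (of_real (\<tau> k)))) \<longlonglongrightarrow> of_real a * h 0"
      unfolding a_def using tyv iv by (intro node_quadrature[OF h(1,2)]) (simp_all add: h(3)[abs_def])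
    have term_le: "norm ((-1) ^ (k + 1) * (of_real (\<tau> k) ^ d * h (of_real (\<tau> k)))) \<le> norm (\<phi> w) * B / \<bar>Im w\<bar>\<^sup>2 * (1 / (\<tau> k)\<^sup>2)"
      if k: "k \<in> {1..n}" for k n
    proof -
      let ?t = "complex_of_real (\<tau> k)"
      have tp: "\<tau> k > 0" using tau_pos k by simp
      have "\<bar>Im w\<bar> \<le> norm (?t - w)" "\<bar>Im w\<bar> \<le> norm (?t + w)"
        using abs_Im_le_cmod[of "?t - w"] abs_Im_le_cmod[of "?t + w"] by simp_all
      then have "\<bar>Im w\<bar> * \<bar>Im w\<bar> \<le> norm (?t - w) * norm (?t + w)"
        by (intro mult_mono) auto
      then have "\<bar>Im w\<bar>\<^sup>2 \<le> norm (?t\<^sup>2 - w\<^sup>2)"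
        by (simp add: power2_eq_square square_diff_square_factored norm_mult mult.commute)
      then have "\<bar>Im w\<bar>\<^sup>2 * norm (h ?t) \<le> norm (?t\<^sup>2 - w\<^sup>2) * norm (h ?t)"
        by (intro mult_right_mono) auto
      also have "\<dots> = norm (v ?t)" by (simp add: h(3) norm_mult)
      also have "\<dots> = norm (\<phi> w) * norm (\<psi> ?t)"
        using phi_tau k by (simp add: v_def norm_mult)
      finally have "\<bar>Im w\<bar>\<^sup>2 * norm (h ?t) * \<tau> k ^ N \<le> norm (\<phi> w) * norm (\<psi> ?t) * \<tau> k ^ N"
        using tp by (intro mult_right_mono) auto
      also have "\<dots> = norm (\<phi> w) * (norm (\<psi> ?t) * \<bar>\<tau> k\<bar> ^ N)"
        using tp by simp
      also have "\<dots> \<le> norm (\<phi> w) * B"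
        by (intro mult_left_mono B(2)) auto
      finally have "(\<tau> k ^ d * norm (h ?t)) * (\<bar>Im w\<bar>\<^sup>2 * (\<tau> k)\<^sup>2) \<le> norm (\<phi> w) * B"
        by (simp only: N_def power_add mult_ac)
      then have "\<tau> k ^ d * norm (h ?t) \<le> norm (\<phi> w) * B / (\<bar>Im w\<bar>\<^sup>2 * (\<tau> k)\<^sup>2)"
        using tp w by (subst pos_le_divide_eq) auto
      then show ?thesis
        using tp by (simp add: norm_mult norm_power)
    qed
    have "norm (of_real a * h 0) \<le> norm (\<phi> w) * B / \<bar>Im w\<bar>\<^sup>2 * T2"
    proof (rule LIMSEQ_le_const2[OF tendsto_norm[OF lim]], intro exI allI impI)
      fix n
      have "norm (\<Sum>k=1..n. (-1) ^ (k + 1) * (of_real (\<tau> k) ^ d * h (of_real (\<tau> k)))) \<le> (\<Sum>k=1..n. norm (\<phi> w) * B / \<bar>Im w\<bar>\<^sup>2 * (1 / (\<tau> k)\<^sup>2))"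
        by (rule sum_norm_le[OF term_le])
      also have "\<dots> = norm (\<phi> w) * B / \<bar>Im w\<bar>\<^sup>2 * (\<Sum>k=1..n. 1 / (\<tau> k)\<^sup>2)"
        by (simp only: sum_distrib_left)
      also have "\<dots> \<le> norm (\<phi> w) * B / \<bar>Im w\<bar>\<^sup>2 * T2"
        using B0 by (intro mult_left_mono sum_inverse_tau_square_le) auto
      finally show "norm (\<Sum>k=1..n. (-1) ^ (k + 1) * (of_real (\<tau> k) ^ d * h (of_real (\<tau> k)))) \<le> norm (\<phi> w) * B / \<bar>Im w\<bar>\<^sup>2 * T2" .
    qed
    then have "a * norm (h 0) \<le> norm (\<phi> w) * B / \<bar>Im w\<bar>\<^sup>2 * T2"
      using a by (simp only: norm_mult norm_of_real abs_of_pos)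
    then have "norm (h 0) \<le> norm (\<phi> w) * B / \<bar>Im w\<bar>\<^sup>2 * T2 / a"
      by (subst pos_le_divide_eq[OF a]) (simp only: mult.commute)
    then have "(norm w)\<^sup>2 * norm (h 0) \<le> (norm w)\<^sup>2 * (norm (\<phi> w) * B / \<bar>Im w\<bar>\<^sup>2 * T2 / a)"
      by (intro mult_left_mono) auto
    also have "\<dots> = norm (\<phi> w) * (B * T2 / a) * (norm w / \<bar>Im w\<bar>)\<^sup>2"
      by (simp add: power_divide mult_ac)
    also have "(norm w)\<^sup>2 * norm (h 0) = norm (\<psi> w - \<phi> w * \<psi> 0)"
    proof -
      have "\<psi> w - \<phi> w * \<psi> 0 = (- (w\<^sup>2)) * h 0"
        using h(3)[of 0] by (simp add: v_def phi_0)
      then show ?thesis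
        by (simp only: norm_mult norm_minus_cancel norm_power)
    qed
    finally have "norm (\<psi> w - \<phi> w * \<psi> 0) \<le> norm (\<phi> w) * (B * T2 / a) * (norm w / \<bar>Im w\<bar>)\<^sup>2" .
    moreover have "norm (\<psi> w) \<le> norm (\<psi> w - \<phi> w * \<psi> 0) + norm (\<phi> w) * norm (\<psi> 0)"
      using norm_triangle_ineq[of "\<psi> w - \<phi> w * \<psi> 0" "\<phi> w * \<psi> 0"] by (simp add: norm_mult)
    ultimately have up: "norm (\<psi> w) \<le> norm (\<phi> w) * (norm (\<psi> 0) + (B * T2 / a) * (norm w / \<bar>Im w\<bar>)\<^sup>2)"
      by (simp add: algebra_simps)
    define W where "W = (1 + norm w) * (1 + 1 / \<bar>Im w\<bar>)"
    have W: "1 \<le> W" "norm w / \<bar>Im w\<bar> \<le> W"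
      unfolding W_def using tame_weight_ge[OF w] by blast+
    have "norm (\<psi> 0) + (B * T2 / a) * (norm w / \<bar>Im w\<bar>)\<^sup>2 \<le> norm (\<psi> 0) * W\<^sup>2 + (B * T2 / a) * W\<^sup>2"
    proof (intro add_mono mult_left_mono power_mono W(2))
      show "norm (\<psi> 0) \<le> norm (\<psi> 0) * W\<^sup>2"
        using one_le_power[OF W(1), of 2] by (simp add: mult_le_cancel_left1)
    qed (use B0 T2_nonneg a in auto)
    also have "\<dots> = C * W\<^sup>2" by (simp add: C_def distrib_right)
    finally have up2: "norm (\<psi> w) \<le> norm (\<phi> w) * (C * W\<^sup>2)"
      using up mult_left_mono[of _ "C * W\<^sup>2" "norm (\<phi> w)"] by (meson norm_ge_zero order_trans)
    \<comment> \<open>Writing 1 as the N-th power of a ratio times its inverse brings in the lower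
      bound for \<psi>(w).\<close>
    have "1 = (\<bar>Im w\<bar> / norm w * (norm w / \<bar>Im w\<bar>)) ^ N"
      using w w0 by simp
    also have "\<dots> = (\<bar>Im w\<bar> / norm w) ^ N * (norm w / \<bar>Im w\<bar>) ^ N"
      by (rule power_mult_distrib)
    also have "\<dots> \<le> norm (\<psi> w) * W ^ N"
      using low[OF w] W by (intro mult_mono power_mono) auto
    also have "\<dots> \<le> (norm (\<phi> w) * (C * W\<^sup>2)) * W ^ N"
      using up2 W(1) by (intro mult_right_mono) auto
    also have "\<dots> = norm (\<phi> w) * (C * W ^ (N + 2))"
      by (simp only: power_add mult_ac)
    finally show ?thesis
      unfolding W_def[symmetric] using \<phi>w by (simp add: norm_divide divide_le_eq mult.commute)
  qed
  then show ?thesis unfolding tame_def by blast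
qed

end

subsection \<open>The functional identity and the differential equation\<close>

lemma inverse_imag_tendsto_0: "((\<lambda>y. inverse (\<i> * complex_of_real y)) \<longlongrightarrow> 0) at_top"
proof -
  have "((\<lambda>y::real. inverse y) \<longlongrightarrow> 0) at_top"
    by (intro tendsto_inverse_0_at_top filterlim_ident)
  then have "((\<lambda>y. - \<i> * complex_of_real (inverse y)) \<longlongrightarrow> - \<i> * of_real 0) at_top"
    by (intro tendsto_intros)
  then show ?thesis by simp
qed

lemma poly_divide_imag_tendsto:
  fixes p :: "complex poly"
  assumes "degree p \<le> N"
  shows "((\<lambda>y. poly p (\<i> * of_real y) / (\<i> * of_real y) ^ N) \<longlongrightarrow> coeff p N) at_top"
proof -
  have eq: "poly p x / x ^ N = (\<Sum>i\<le>N. coeff p i * inverse x ^ (N - i))" if "x \<noteq> 0" for x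
  proof -
    have "poly p x = (\<Sum>i\<le>N. coeff p i * x ^ i)"
      unfolding poly_altdef using assms by (intro sum.mono_neutral_left) (auto simp: coeff_eq_0)
    then have "poly p x / x ^ N = (\<Sum>i\<le>N. coeff p i * x ^ i / x ^ N)"
      by (simp add: sum_divide_distrib)
    also have "\<dots> = (\<Sum>i\<le>N. coeff p i * inverse x ^ (N - i))"
    proof (rule sum.cong[OF refl])
      fix i assume "i \<in> {..N}"
      then have "x ^ N = x ^ i * x ^ (N - i)" by (simp flip: power_add)
      then show "coeff p i * x ^ i / x ^ N = coeff p i * inverse x ^ (N - i)"
        using that by (simp add: power_inverse divide_inverse)
    qed
    finally show ?thesis .
  qed
  have "((\<lambda>y. \<Sum>i\<le>N. coeff p i * inverse (\<i> * of_real y) ^ (N - i)) \<longlongrightarrow> (\<Sum>i\<le>N. coeff p i * 0 ^ (N - i))) at_top"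
    by (intro tendsto_sum tendsto_mult tendsto_const tendsto_power inverse_imag_tendsto_0)
  also have "(\<Sum>i\<le>N. coeff p i * 0 ^ (N - i)) = (\<Sum>i\<in>{N}. coeff p i * 0 ^ (N - i))"
    by (rule sum.mono_neutral_right) auto
  finally have lim: "((\<lambda>y. \<Sum>i\<le>N. coeff p i * inverse (\<i> * of_real y) ^ (N - i)) \<longlongrightarrow> coeff p N) at_top"
    by simp
  have "\<forall>\<^sub>F y in at_top. (\<Sum>i\<le>N. coeff p i * inverse (\<i> * of_real y) ^ (N - i)) = poly p (\<i> * of_real y) / (\<i> * of_real y) ^ N"
    using eventually_gt_at_top[of 0] by eventually_elim (simp add: eq)
  then show ?thesis by (rule Lim_transform_eventually[OF lim])
qed

text \<open>If the degree exceeded n, multiplying by a negative power of iy would send the quotient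
  at the true degree to 0, although it tends to the leading coefficient.\<close>

lemma degree_le_if_imag_limit:
  fixes p :: "complex poly"
  assumes lim: "((\<lambda>y. poly p (\<i> * of_real y) / (\<i> * of_real y) ^ n) \<longlongrightarrow> c) at_top"
  shows "degree p \<le> n" "coeff p n = c"
proof -
  show d: "degree p \<le> n"
  proof (rule ccontr)
    assume "\<not> degree p \<le> n"
    then have n: "n < degree p" by simp
    have l: "((\<lambda>y. poly p (\<i> * of_real y) / (\<i> * of_real y) ^ n * inverse (\<i> * of_real y) ^ (degree p - n)) \<longlongrightarrow> c * 0 ^ (degree p - n)) at_top"
      by (intro tendsto_mult lim tendsto_power inverse_imag_tendsto_0)
    have eq: "poly p x / x ^ n * inverse x ^ (degree p - n) = poly p x / x ^ degree p" for x
    proof -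
      have "x ^ degree p = x ^ n * x ^ (degree p - n)" using n by (simp flip: power_add)
      then show ?thesis by (simp add: power_inverse divide_inverse)
    qed
    have "((\<lambda>y. poly p (\<i> * of_real y) / (\<i> * of_real y) ^ degree p) \<longlongrightarrow> c * 0 ^ (degree p - n)) at_top"
      using l unfolding eq .
    moreover have "c * 0 ^ (degree p - n) = 0" using n by simp
    ultimately have "((\<lambda>y. poly p (\<i> * of_real y) / (\<i> * of_real y) ^ degree p) \<longlongrightarrow> 0) at_top"
      by (simp only:)
    then have "lead_coeff p = 0"
      using poly_divide_imag_tendsto[of p "degree p"] tendsto_unique[OF trivial_limit_at_top_linorder] by blast
    then show False using n by simp
  qed
  show "coeff p n = c"
    using poly_divide_imag_tendsto[OF d] lim tendsto_unique[OF trivial_limit_at_top_linorder] by blast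
qed

lemma even_poly_coeff_odd:
  assumes "even_poly p" "odd n"
  shows "coeff p n = 0"
proof -
  have "poly (pcompose p [:0, -1:]) = poly p"
    using assms(1) by (simp add: fun_eq_iff poly_pcompose even_poly_def)
  then have "pcompose p [:0, -1:] = p"
    by (simp add: poly_eq_poly_eq_iff)
  then have "coeff p n = (-1) ^ n * coeff p n"
    using coeff_pcompose_linear[of p "-1" n] by simp
  then show ?thesis using assms(2) by simp
qed

text \<open>The coefficient of order d + 1 vanishes by hypothesis and that of order d by parity, so
  a single vanishing coefficient lowers the degree by two.\<close>

lemma even_poly_degree_le:
  assumes p: "even_poly p" "degree p \<le> d + 1" "coeff p (d + 1) = 0" and d: "odd d"
  shows "degree p \<le> d - 1"
proof (rule degree_le, intro allI impI)
  fix i assume "d - 1 < i"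
  then consider "i = d" | "i = d + 1" | "i > d + 1" by linarith
  then show "coeff p i = 0"
    using p even_poly_coeff_odd[OF p(1) d] by cases (auto intro: coeff_eq_0)
qed

section \<open>The polynomial quotients R and K\<close>

context extremal_zeros
begin

abbreviation \<Phi> :: "complex \<Rightarrow> complex" where "\<Phi> \<equiv> Phi \<tau>"

lemma odd_d: "odd d" by (simp add: dm)

lemma phi_eq: "\<phi> z = \<Phi> z * \<Phi> (- z)"
  by (rule Phi_times_reflection[OF product])

lemma Phi_deriv: "(\<Phi> has_field_derivative deriv \<Phi> z) (at z)"
  using Phi_holomorphic by (simp add: holomorphic_derivI)

lemma Phi_deriv2: "(deriv \<Phi> has_field_derivative deriv (deriv \<Phi>) z) (at z)"
  using holomorphic_deriv[OF Phi_holomorphic] by (simp add: holomorphic_derivI)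

lemma Phi_reflect_deriv: "((\<lambda>z. \<Phi> (- z)) has_field_derivative - deriv \<Phi> (- z)) (at z)"
  by (rule DERIV_cong[OF DERIV_chain2[OF Phi_deriv DERIV_minus[OF DERIV_ident]]]) simp

lemma Phi_reflect_deriv2: "((\<lambda>z. deriv \<Phi> (- z)) has_field_derivative - deriv (deriv \<Phi>) (- z)) (at z)"
  by (rule DERIV_cong[OF DERIV_chain2[OF Phi_deriv2 DERIV_minus[OF DERIV_ident]]]) simp

lemma deriv_phi: "deriv \<phi> z = deriv \<Phi> z * \<Phi> (- z) - deriv \<Phi> (- z) * \<Phi> z"
proof -
  have "\<phi> = (\<lambda>z. \<Phi> z * \<Phi> (- z))" using phi_eq by auto
  moreover have "((\<lambda>z. \<Phi> z * \<Phi> (- z)) has_field_derivative deriv \<Phi> z * \<Phi> (- z) + (- deriv \<Phi> (- z)) * \<Phi> z) (at z)"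
    by (rule DERIV_mult[OF Phi_deriv Phi_reflect_deriv])
  ultimately have "(\<phi> has_field_derivative deriv \<Phi> z * \<Phi> (- z) + (- deriv \<Phi> (- z)) * \<Phi> z) (at z)"
    by (simp only:)
  from DERIV_imp_deriv[OF this] show ?thesis by simp
qed

lemma phi_nonzero: "Im z \<noteq> 0 \<Longrightarrow> \<phi> z \<noteq> 0"
  using zeros_simple[of z] by (auto simp: complex_is_Real_iff)

text \<open>A double zero of \<Phi>, or a common zero of \<Phi>(z) and \<Phi>(-z), would be a
  multiple zero of \<phi>.\<close>

lemma Phi_zero_simple:
  assumes "\<Phi> z = 0"
  shows "deriv \<Phi> z \<noteq> 0" "\<Phi> (- z) \<noteq> 0"
  using zeros_simple[of z] assms deriv_phi[of z] phi_eq[of z] by auto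

lemma deriv_phi_odd: "deriv \<phi> (- z) = - deriv \<phi> z"
  by (simp add: deriv_phi)

lemma phi_zero_cases:
  assumes "\<phi> z = 0"
  obtains j where "j \<ge> 1" "z = of_real (lam j) \<or> z = - of_real (lam j)"
proof -
  obtain x where x: "z = of_real x" using zeros_simple[OF assms] by (auto elim: Reals_cases)
  have "x \<noteq> 0" using assms phi_0 x by auto
  moreover have "\<phi> (of_real \<bar>x\<bar>) = 0"
    using assms phi_even[of z] by (simp add: x abs_if)
  ultimately have "\<bar>x\<bar> \<in> {x. x > 0 \<and> \<phi> (complex_of_real x) = 0}" by simp
  then obtain j where j: "j \<ge> 1" "\<bar>x\<bar> = \<tau> j"
    unfolding positive_zeros[symmetric] by auto
  then have "\<bar>x\<bar> = \<bar>lam j\<bar>" using abs_lam by simp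
  then have "x = lam j \<or> x = - lam j" by (simp add: abs_eq_iff)
  then show ?thesis using that[OF j(1)] x by auto
qed

definition a :: complex where "a = of_real (a_const T)"

text \<open>The part of the functional identity that has to be divisible by \<phi>; the quotient
  turns out to be 2R.\<close>

definition H :: "complex \<Rightarrow> complex" where
  "H z = z ^ (d + 1) * (deriv \<Phi> z * \<Phi> (- z) + deriv \<Phi> (- z) * \<Phi> z) + 2 * a"

lemma H_even: "H (- z) = H z"
  using odd_d by (simp add: H_def add.commute)

lemma H_holomorphic: "H holomorphic_on UNIV"
proof -
  have "deriv \<Phi> holomorphic_on UNIV" using Phi_holomorphic by (simp add: holomorphic_deriv)
  note facts = this entire_reflect[OF this] Phi_holomorphic entire_reflect[OF Phi_holomorphic]
  show ?thesis
    unfolding H_def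
    by (intro holomorphic_on_add holomorphic_on_mult holomorphic_on_power holomorphic_on_ident holomorphic_on_const facts)
qed

text \<open>At \<open>lam j\<close> the factor \<Phi> vanishes, which leaves the power d + 1 of
  \<open>lam j\<close> times \<phi>'(\<open>lam j\<close>), plus 2a. As \<phi>' is odd, the sign in
  \<open>lam j\<close> turns the alternating values at \<tau>_j into the constant -2a: this is what
  the alternation of the zeros of \<Phi> achieves. The remaining zeros follow by evenness of
  \<open>H\<close>.\<close>

lemma H_zero: assumes "\<phi> z = 0" shows "H z = 0"
proof -
  have *: "H (of_real (lam j)) = 0" if j: "j \<ge> 1" for j
  proof -
    let ?z = "complex_of_real (lam j)"
    have F: "\<Phi> ?z = 0" by (rule Phi_lam[OF j])
    then have dp: "deriv \<Phi> ?z * \<Phi> (- ?z) = deriv \<phi> ?z" by (simp add: deriv_phi)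
    have "deriv \<phi> ?z = (-1) ^ (j + 1) * deriv \<phi> (of_real (\<tau> j))"
      using deriv_phi_odd[of "of_real (\<tau> j)"] by (cases "even j") (simp_all add: lam_def)
    moreover have "?z ^ (d + 1) = of_real (\<tau> j) ^ (d + 1)"
      using odd_d by (cases "even j") (simp_all add: lam_def)
    ultimately have "?z ^ (d + 1) * deriv \<phi> ?z = (-1) ^ (j + 1) * (of_real (\<tau> j) ^ (d + 1) * deriv \<phi> (of_real (\<tau> j)))"
      by (simp only: mult_ac)
    also have "\<dots> = - 2 * a"
      unfolding deriv_phi_at_tau[OF j] by (simp add: a_def flip: power_add)
    finally show ?thesis
      using F dp by (simp add: H_def)
  qed
  obtain j where "j \<ge> 1" "z = of_real (lam j) \<or> z = - of_real (lam j)"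
    using phi_zero_cases[OF assms] by blast
  then show ?thesis using * H_even by auto
qed

text \<open>The zeros of \<Phi> are real, so conjugation commutes with the partial fractions; it
  carries the asymptotics over to the negative imaginary axis.\<close>

lemma log_derivative_cnj:
  assumes "Im z \<noteq> 0"
  shows "deriv \<Phi> (cnj z) / \<Phi> (cnj z) = cnj (deriv \<Phi> z / \<Phi> z)"
proof -
  have "(\<lambda>n. cnj (\<Sum>k=1..n. 1 / (z - of_real (lam k)))) \<longlonglongrightarrow> cnj (deriv \<Phi> z / \<Phi> z)"
    by (intro tendsto_cnj Phi_log_derivatives(1) assms)
  then have "(\<lambda>n. \<Sum>k=1..n. 1 / (cnj z - of_real (lam k))) \<longlonglongrightarrow> cnj (deriv \<Phi> z / \<Phi> z)"
    by simp
  moreover have "(\<lambda>n. \<Sum>k=1..n. 1 / (cnj z - of_real (lam k))) \<longlonglongrightarrow> deriv \<Phi> (cnj z) / \<Phi> (cnj z)"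
    using assms by (intro Phi_log_derivatives(1)) simp
  ultimately show ?thesis using LIMSEQ_unique by blast
qed

lemma log_derivative_sum_imag_axis:
  "((\<lambda>y. deriv \<Phi> (\<i> * of_real y) / \<Phi> (\<i> * of_real y) + deriv \<Phi> (- (\<i> * of_real y)) / \<Phi> (- (\<i> * of_real y))) \<longlongrightarrow> 0) at_top"
  and log_derivative_diff_imag_axis:
  "((\<lambda>y. deriv \<Phi> (\<i> * of_real y) / \<Phi> (\<i> * of_real y) - deriv \<Phi> (- (\<i> * of_real y)) / \<Phi> (- (\<i> * of_real y))) \<longlongrightarrow> - \<i>) at_top"
proof -
  let ?l = "\<lambda>z. deriv \<Phi> z / \<Phi> z"
  have "((\<lambda>y. cnj (?l (\<i> * of_real y))) \<longlongrightarrow> cnj (- \<i> / 2)) at_top"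
    by (intro tendsto_cnj log_derivative_imag_axis)
  moreover have "\<forall>\<^sub>F y in at_top. cnj (?l (\<i> * of_real y)) = ?l (- (\<i> * of_real y))"
    using eventually_gt_at_top[of 0]
  proof eventually_elim
    case (elim y)
    then show ?case using log_derivative_cnj[of "\<i> * of_real y"] by simp
  qed
  ultimately have l2: "((\<lambda>y. ?l (- (\<i> * of_real y))) \<longlongrightarrow> cnj (- \<i> / 2)) at_top"
    by (rule Lim_transform_eventually)
  show "((\<lambda>y. ?l (\<i> * of_real y) + ?l (- (\<i> * of_real y))) \<longlongrightarrow> 0) at_top"
    using tendsto_add[OF log_derivative_imag_axis l2] by simp
  show "((\<lambda>y. ?l (\<i> * of_real y) - ?l (- (\<i> * of_real y))) \<longlongrightarrow> - \<i>) at_top"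
    using tendsto_diff[OF log_derivative_imag_axis l2] by simp
qed

lemma phi_imag_axis_ge_1: "norm (\<phi> (\<i> * of_real y)) \<ge> 1"
proof (rule LIMSEQ_le_const[OF tendsto_norm[OF product]], intro exI allI impI)
  fix n
  have "(\<Prod>k=1..n. 1 - (\<i> * complex_of_real y)\<^sup>2 / (complex_of_real (\<tau> k))\<^sup>2) = of_real (\<Prod>k=1..n. 1 + y\<^sup>2 / (\<tau> k)\<^sup>2)"
    by (simp add: power_mult_distrib)
  moreover have "(\<Prod>k=1..n. 1 + y\<^sup>2 / (\<tau> k)\<^sup>2) \<ge> 1"
    by (rule prod_ge_1) simp
  ultimately show "1 \<le> norm (\<Prod>k=1..n. 1 - (\<i> * complex_of_real y)\<^sup>2 / (complex_of_real (\<tau> k))\<^sup>2)"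
    by (simp only: norm_of_real)
qed

text \<open>\<open>H\<close> / \<phi> is entire and, off the axis, built from tame functions, hence
  a polynomial 2R. On the imaginary axis R / z^(d+1) is half the sum of the logarithmic derivatives
  at z and -z, whose limits -i/2 and i/2 cancel, plus a term that vanishes because |\<phi>(iy)|
  \<ge> 1. So the coefficient of order d + 1 is zero, and parity removes that of order d.\<close>

lemma functional_identity:
  obtains R :: "complex poly" where "even_poly R" "degree R \<le> d - 1" "coeff R 0 = a"
    "\<And>z. z ^ (d + 1) * (deriv \<Phi> z * \<Phi> (- z) + deriv \<Phi> (- z) * \<Phi> z) - 2 * poly R z * \<Phi> z * \<Phi> (- z) = - 2 * a"
proof -
  obtain q where q: "q holomorphic_on UNIV" "\<And>z. H z = q z * \<phi> z"
  proof (rule entire_quotient_simple_zeros[OF H_holomorphic phi_holomorphic])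
    show "H z = 0 \<and> deriv \<phi> z \<noteq> 0" if "\<phi> z = 0" for z
      using H_zero[OF that] zeros_simple[OF that] by blast
  qed (rule that)
  have q_off: "q z = z ^ (d + 1) * (deriv \<Phi> z / \<Phi> z + deriv \<Phi> (- z) / \<Phi> (- z)) + 2 * a * (1 / \<phi> z)" if z: "Im z \<noteq> 0" for z
  proof -
    have nz: "\<Phi> z \<noteq> 0" "\<Phi> (- z) \<noteq> 0" using z by (auto intro!: Phi_nonzero)
    have qH: "q z = H z / \<phi> z" using q(2)[of z] phi_nonzero[OF z] by simp
    have gen: "(Z * (f1 * G + g1 * F) + c) / (F * G) = Z * (f1 / F + g1 / G) + c * (1 / (F * G))"
      if "F \<noteq> 0" "G \<noteq> 0" for Z f1 g1 F G c :: complex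
      using that by (simp add: field_simps)
    show ?thesis
      unfolding qH H_def phi_eq by (rule gen[OF nz])
  qed
  have "tame (\<lambda>z. z ^ (d + 1) * (deriv \<Phi> z / \<Phi> z + deriv \<Phi> (- z) / \<Phi> (- z)) + 2 * a * (1 / \<phi> z))" (is "tame ?f")
    by (intro tame_add tame_mult tame_power tame_ident tame_const tame_log_derivative tame_inverse_phi tame_reflect[OF tame_log_derivative])
  moreover have "tame q = tame ?f" by (rule tame_cong) (rule q_off)
  ultimately have "tame q" by (simp only:)
  then obtain P where P: "\<And>z. q z = poly P z"
    by (rule entire_tame_imp_poly[OF q(1)]) (rule that)
  define R where "R = smult (1 / 2) P"
  have Rq: "2 * poly R z = q z" for z by (simp add: R_def P)
  have "q (- z) = q z" for z
  proof (rule eq_if_eq_off_real[of "\<lambda>z. q (- z)" q])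
    show "continuous_on UNIV (\<lambda>z. q (- z))" "continuous_on UNIV q"
      using entire_reflect[OF q(1)] q(1) holomorphic_on_imp_continuous_on by blast+
    show "q (- z) = q z" if "Im z \<noteq> 0" for z
      using q(2)[of z] q(2)[of "- z"] H_even[of z] phi_even[of z] phi_nonzero[OF that] by simp
  qed
  then have even: "even_poly R" by (simp add: even_poly_def R_def flip: P)
  have id: "z ^ (d + 1) * (deriv \<Phi> z * \<Phi> (- z) + deriv \<Phi> (- z) * \<Phi> z) - 2 * poly R z * \<Phi> z * \<Phi> (- z) = - 2 * a" for z
  proof -
    have "2 * poly R z * \<Phi> z * \<Phi> (- z) = H z" unfolding Rq q(2) phi_eq by (simp only: mult.assoc)
    then show ?thesis by (simp add: H_def)
  qed
  have "H 0 = 2 * a" by (simp add: H_def)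
  then have "2 * poly R 0 = 2 * a" using q(2)[of 0] Rq phi_0 by simp
  then have c0: "coeff R 0 = a" by (simp add: poly_0_coeff_0)
  have "((\<lambda>y. poly R (\<i> * of_real y) / (\<i> * of_real y) ^ (d + 1)) \<longlongrightarrow> 0) at_top"
  proof -
    have "((\<lambda>y. a * (1 / \<phi> (\<i> * of_real y) * inverse (\<i> * of_real y) ^ (d + 1))) \<longlongrightarrow> 0) at_top"
    proof (rule tendsto_mult_right_zero, rule Lim_null_comparison)
      show "\<forall>\<^sub>F y in at_top. norm (1 / \<phi> (\<i> * of_real y) * inverse (\<i> * of_real y) ^ (d + 1)) \<le> norm (inverse (\<i> * complex_of_real y) ^ (d + 1))"
      proof (intro always_eventually allI)
        fix y
        have "norm (1 / \<phi> (\<i> * of_real y)) \<le> 1"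
          using phi_imag_axis_ge_1[of y] by (simp add: norm_divide divide_le_eq)
        then show "norm (1 / \<phi> (\<i> * of_real y) * inverse (\<i> * of_real y) ^ (d + 1)) \<le> norm (inverse (\<i> * complex_of_real y) ^ (d + 1))"
          unfolding norm_mult by (rule mult_left_le_one_le[rotated 2]) auto
      qed
      show "((\<lambda>y. norm (inverse (\<i> * complex_of_real y) ^ (d + 1))) \<longlongrightarrow> 0) at_top"
        using tendsto_norm[OF tendsto_power[OF inverse_imag_tendsto_0, of "d + 1"]] by simp
    qed
    then have "((\<lambda>y. 1 / 2 * (deriv \<Phi> (\<i> * of_real y) / \<Phi> (\<i> * of_real y) + deriv \<Phi> (- (\<i> * of_real y)) / \<Phi> (- (\<i> * of_real y)))
        + a * (1 / \<phi> (\<i> * of_real y) * inverse (\<i> * of_real y) ^ (d + 1))) \<longlongrightarrow> 1 / 2 * 0 + 0) at_top"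
      by (intro tendsto_add tendsto_mult tendsto_const log_derivative_sum_imag_axis)
    then have lim: "((\<lambda>y. 1 / 2 * (deriv \<Phi> (\<i> * of_real y) / \<Phi> (\<i> * of_real y) + deriv \<Phi> (- (\<i> * of_real y)) / \<Phi> (- (\<i> * of_real y)))
        + a * (1 / \<phi> (\<i> * of_real y) * inverse (\<i> * of_real y) ^ (d + 1))) \<longlongrightarrow> 0) at_top"
      by simp
    have "\<forall>\<^sub>F y in at_top. 1 / 2 * (deriv \<Phi> (\<i> * of_real y) / \<Phi> (\<i> * of_real y) + deriv \<Phi> (- (\<i> * of_real y)) / \<Phi> (- (\<i> * of_real y)))
        + a * (1 / \<phi> (\<i> * of_real y) * inverse (\<i> * of_real y) ^ (d + 1)) = poly R (\<i> * of_real y) / (\<i> * of_real y) ^ (d + 1)"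
      using eventually_gt_at_top[of 0]
    proof eventually_elim
      case (elim y)
      define x where "x = \<i> * complex_of_real y"
      have "Im x \<noteq> 0" using elim by (simp add: x_def)
      moreover from this have "x \<noteq> 0" by auto
      ultimately have x: "Im x \<noteq> 0" "x ^ (d + 1) \<noteq> 0"
        by (blast, intro power_not_zero)
      have "poly R x = 1 / 2 * q x" unfolding Rq[symmetric] by simp
      then have e1: "poly R x / x ^ (d + 1) = 1 / 2 * (q x / x ^ (d + 1))"
        by (simp only: times_divide_eq_right)
      have gen2: "(X * l + p) / X = l + p / X" if "X \<noteq> 0" for l p X :: complex
        using that by (simp add: add_divide_distrib)
      have e2: "q x / x ^ (d + 1) = (deriv \<Phi> x / \<Phi> x + deriv \<Phi> (- x) / \<Phi> (- x)) + 2 * a * (1 / \<phi> x) / x ^ (d + 1)"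
        by (subst q_off[OF x(1)]) (rule gen2[OF x(2)])
      have gen: "1 / 2 * (l + 2 * a * p / X) = 1 / 2 * l + a * (p * inverse X)" for l p X :: complex
        by (simp add: distrib_left divide_inverse[of _ X])
      show ?case
        unfolding x_def[symmetric] e1 e2 gen power_inverse ..
    qed
    then show ?thesis by (rule Lim_transform_eventually[OF lim])
  qed
  from degree_le_if_imag_limit[OF this] even odd_d have "degree R \<le> d - 1"
    by (intro even_poly_degree_le)
  then show ?thesis using that even c0 id by blast
qed

text \<open>Differentiating the identity gives \<Phi>(-z) A(z) = \<Phi>(z) A(-z), where A collects
  the terms without K. At a zero of \<Phi> the factor \<Phi>(-z) is nonzero, so A vanishes there and
  K = -A/\<Phi> is entire; it is even by the same relation, and a polynomial by tameness.\<close>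

lemma differential_equation:
  fixes R :: "complex poly"
  assumes even: "even_poly R" and deg: "degree R \<le> d - 1"
    and id: "\<And>z. z ^ (d + 1) * (deriv \<Phi> z * \<Phi> (- z) + deriv \<Phi> (- z) * \<Phi> z) - 2 * poly R z * \<Phi> z * \<Phi> (- z) = - 2 * a"
  obtains K :: "complex poly" where "even_poly K" "degree K = d + 1" "lead_coeff K = 1 / 4"
    "\<And>z. z ^ (d + 1) * deriv (deriv \<Phi>) z + (of_nat (d + 1) * z ^ d - 2 * poly R z) * deriv \<Phi> z
      + (poly K z - poly (pderiv R) z) * \<Phi> z = 0"
proof -
  define A where "A = (\<lambda>z. z ^ (d + 1) * deriv (deriv \<Phi>) z + (of_nat (d + 1) * z ^ d - 2 * poly R z) * deriv \<Phi> z
      - poly (pderiv R) z * \<Phi> z)"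
  have dPhi: "deriv \<Phi> holomorphic_on UNIV" using Phi_holomorphic by (simp add: holomorphic_deriv)
  then have ddPhi: "deriv (deriv \<Phi>) holomorphic_on UNIV" by (simp add: holomorphic_deriv)
  have Ah: "A holomorphic_on UNIV"
    unfolding A_def by (intro holomorphic_intros Phi_holomorphic dPhi ddPhi)
  have Re: "poly R (- z) = poly R z" for z using even by (simp add: even_poly_def)
  have R'odd: "poly (pderiv R) (- z) = - poly (pderiv R) z" for z
  proof -
    have "((\<lambda>z. poly R (- z)) has_field_derivative poly (pderiv R) (- z) * - 1) (at z)"
      by (rule DERIV_chain2[OF poly_DERIV]) (auto intro!: derivative_eq_intros)
    then have "(poly R has_field_derivative - poly (pderiv R) (- z)) (at z)"
      unfolding Re by simp
    from DERIV_unique[OF poly_DERIV this] show ?thesis by simp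
  qed
  have cross: "\<Phi> (- z) * A z = \<Phi> z * A (- z)" for z
  proof -
    define E where "E = (\<lambda>z. z ^ (d + 1) * (deriv \<Phi> z * \<Phi> (- z) + deriv \<Phi> (- z) * \<Phi> z) - 2 * poly R z * (\<Phi> z * \<Phi> (- z)))"
    have "E = (\<lambda>_. - 2 * a)" using id unfolding E_def by (simp only: mult.assoc)
    then have E0: "(E has_field_derivative 0) (at z)" by simp
    have E1: "(E has_field_derivative
        (of_nat (d + 1) * z ^ d * (deriv \<Phi> z * \<Phi> (- z) + deriv \<Phi> (- z) * \<Phi> z)
         + ((deriv (deriv \<Phi>) z * \<Phi> (- z) + - deriv \<Phi> (- z) * deriv \<Phi> z)
            + (- deriv (deriv \<Phi>) (- z) * \<Phi> z + deriv \<Phi> z * deriv \<Phi> (- z))) * z ^ (d + 1))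
        - (2 * poly (pderiv R) z * (\<Phi> z * \<Phi> (- z))
           + (deriv \<Phi> z * \<Phi> (- z) + - deriv \<Phi> (- z) * \<Phi> z) * (2 * poly R z))) (at z)"
      unfolding E_def
    proof (intro DERIV_diff DERIV_mult DERIV_add Phi_deriv Phi_deriv2 Phi_reflect_deriv Phi_reflect_deriv2)
      show "((\<lambda>z. z ^ (d + 1)) has_field_derivative of_nat (d + 1) * z ^ d) (at z)"
        by (rule DERIV_cong[OF DERIV_power[OF DERIV_ident]]) simp
      show "((\<lambda>z. 2 * poly R z) has_field_derivative 2 * poly (pderiv R) z) (at z)"
        by (intro DERIV_cmult poly_DERIV)
    qed
    have refl: "A (- z) = z ^ (d + 1) * deriv (deriv \<Phi>) (- z) + (- (of_nat (d + 1) * z ^ d) - 2 * poly R z) * deriv \<Phi> (- z)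
      + poly (pderiv R) z * \<Phi> (- z)"
      using odd_d by (simp add: A_def Re R'odd)
    \<comment> \<open>Pure algebra, with F, F1, F2 standing for \<Phi> and its derivatives at z, and
      G, G1, G2 for those at -z.\<close>
    have gen: "G * (D * F2 + (n - 2 * r) * F1 - r1 * F) = F * (D * G2 + (- n - 2 * r) * G1 + r1 * G)"
      if "n * (F1 * G + G1 * F) + ((F2 * G + - G1 * F1) + (- G2 * F + F1 * G1)) * D - (2 * r1 * (F * G) + (F1 * G + - G1 * F) * (2 * r)) = 0"
      for n D F F1 F2 G G1 G2 r r1 :: complex
      using that by algebra
    show ?thesis
      unfolding refl unfolding A_def by (rule gen[OF DERIV_unique[OF E1 E0]])
  qed
  obtain k where k: "k holomorphic_on UNIV" "\<And>z. A z = k z * \<Phi> z"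
  proof (rule entire_quotient_simple_zeros[OF Ah Phi_holomorphic])
    show "A z = 0 \<and> deriv \<Phi> z \<noteq> 0" if "\<Phi> z = 0" for z
      using cross[of z] Phi_zero_simple[OF that] that by simp
  qed (rule that)
  let ?l = "\<lambda>z. deriv \<Phi> z / \<Phi> z"
  let ?m = "\<lambda>z. deriv (deriv \<Phi>) z / \<Phi> z"
  have k_off: "k z = z ^ (d + 1) * ?m z + (of_nat (d + 1) * z ^ d - 2 * poly R z) * ?l z - poly (pderiv R) z" if z: "Im z \<noteq> 0" for z
  proof -
    have kA: "k z = A z / \<Phi> z" using k(2)[of z] Phi_nonzero[OF z] by simp
    have gen: "(X * F2 + B * F1 - C * F) / F = X * (F2 / F) + B * (F1 / F) - C" if "F \<noteq> 0" for X F2 B F1 C F :: complex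
      using that by (simp add: add_divide_distrib diff_divide_distrib)
    show ?thesis
      unfolding kA A_def by (rule gen[OF Phi_nonzero[OF z]])
  qed
  have "tame (\<lambda>z. z ^ (d + 1) * ?m z + (of_nat (d + 1) * z ^ d - 2 * poly R z) * ?l z - poly (pderiv R) z)" (is "tame ?f")
    by (intro tame_add tame_diff tame_mult tame_power tame_ident tame_const tame_poly tame_log_derivative tame_log_derivative2)
  moreover have "tame k = tame ?f" by (rule tame_cong) (rule k_off)
  ultimately have "tame k" by (simp only:)
  then obtain P where P: "\<And>z. k z = poly P z"
    by (rule entire_tame_imp_poly[OF k(1)]) (rule that)
  define K where "K = - P"
  have Kk: "poly K z = - k z" for z by (simp add: K_def P)
  have "k (- z) = k z" for z
  proof (rule eq_if_eq_off_real[of "\<lambda>z. k (- z)" k])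
    show "continuous_on UNIV (\<lambda>z. k (- z))" "continuous_on UNIV k"
      using entire_reflect[OF k(1)] k(1) holomorphic_on_imp_continuous_on by blast+
    show "k (- z) = k z" if "Im z \<noteq> 0" for z
    proof -
      have "\<Phi> z * \<Phi> (- z) * k z = \<Phi> z * \<Phi> (- z) * k (- z)"
        using cross[of z] unfolding k(2) by (simp only: mult_ac)
      then show ?thesis using phi_nonzero[OF that] by (simp add: phi_eq)
    qed
  qed
  then have Keven: "even_poly K" by (simp add: even_poly_def Kk)
  have ode: "z ^ (d + 1) * deriv (deriv \<Phi>) z + (of_nat (d + 1) * z ^ d - 2 * poly R z) * deriv \<Phi> z
      + (poly K z - poly (pderiv R) z) * \<Phi> z = 0" for z
  proof -
    have gen: "S + (- c - r) * F = 0" if "S - r * F = c * F" for S r F c :: complex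
      using that by algebra
    show ?thesis
      unfolding Kk by (rule gen[OF k(2)[of z, unfolded A_def]])
  qed
  have lim0: "((\<lambda>y. poly p (\<i> * of_real y) / (\<i> * of_real y) ^ (d + 1)) \<longlongrightarrow> 0) at_top" if "degree p \<le> d" for p :: "complex poly"
    using poly_divide_imag_tendsto[of p "d + 1"] that by (simp add: coeff_eq_0)
  have "degree R \<le> d" using deg by simp
  moreover have "degree (pderiv R) \<le> d" using deg by (simp add: degree_pderiv)
  \<comment> \<open>After division by z^(d+1) only -\<Phi>''/\<Phi> survives in the limit, because
    z^d, R and R' have degree at most d; its limit is 1/4.\<close>
  ultimately have l1: "((\<lambda>y. - (?m (\<i> * of_real y) + (of_nat (d + 1) * inverse (\<i> * of_real y) - 2 * (poly R (\<i> * of_real y) / (\<i> * of_real y) ^ (d + 1))) * ?l (\<i> * of_real y)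
      - poly (pderiv R) (\<i> * of_real y) / (\<i> * of_real y) ^ (d + 1)))
      \<longlongrightarrow> - (- 1 / 4 + (of_nat (d + 1) * 0 - 2 * 0) * (- \<i> / 2) - 0)) at_top"
    by (intro tendsto_minus tendsto_add tendsto_diff tendsto_mult tendsto_const second_log_derivative_imag_axis
        log_derivative_imag_axis inverse_imag_tendsto_0 lim0)
  then have l2: "((\<lambda>y. - (?m (\<i> * of_real y) + (of_nat (d + 1) * inverse (\<i> * of_real y) - 2 * (poly R (\<i> * of_real y) / (\<i> * of_real y) ^ (d + 1))) * ?l (\<i> * of_real y)
      - poly (pderiv R) (\<i> * of_real y) / (\<i> * of_real y) ^ (d + 1))) \<longlongrightarrow> 1 / 4) at_top"
    by simp
  have "\<forall>\<^sub>F y in at_top. - (?m (\<i> * of_real y) + (of_nat (d + 1) * inverse (\<i> * of_real y) - 2 * (poly R (\<i> * of_real y) / (\<i> * of_real y) ^ (d + 1))) * ?l (\<i> * of_real y)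
      - poly (pderiv R) (\<i> * of_real y) / (\<i> * of_real y) ^ (d + 1)) = poly K (\<i> * of_real y) / (\<i> * of_real y) ^ (d + 1)"
    using eventually_gt_at_top[of 0]
  proof eventually_elim
    case (elim y)
    define x where "x = \<i> * complex_of_real y"
    have x: "Im x \<noteq> 0" "x \<noteq> 0" using elim by (simp_all add: x_def)
    define M L where "M = ?m x" and "L = ?l x"
    have Kx: "poly K x = - (x ^ (d + 1) * M + (of_nat (d + 1) * x ^ d - 2 * poly R x) * L - poly (pderiv R) x)"
      unfolding Kk M_def L_def k_off[OF x(1)] ..
    have gen: "- (x * u * M + (n * u - 2 * r) * L - r') / (x * u) = - (M + (n * inverse x - 2 * (r / (x * u))) * L - r' / (x * u))"
      if "u \<noteq> 0" for u n r r' :: complex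
      using x(2) that by (simp add: field_simps)
    have xd: "x ^ (d + 1) = x * x ^ d" and xd0: "x ^ d \<noteq> 0" using x(2) by simp_all
    have "poly K x / x ^ (d + 1) = - (M + (of_nat (d + 1) * inverse x - 2 * (poly R x / x ^ (d + 1))) * L - poly (pderiv R) x / x ^ (d + 1))"
      unfolding Kx unfolding xd by (rule gen[OF xd0])
    then show ?case unfolding x_def[symmetric] M_def L_def by (rule sym)
  qed
  then have "((\<lambda>y. poly K (\<i> * of_real y) / (\<i> * of_real y) ^ (d + 1)) \<longlongrightarrow> 1 / 4) at_top"
    by (rule Lim_transform_eventually[OF l2])
  from degree_le_if_imag_limit[OF this] have c: "degree K \<le> d + 1" "coeff K (d + 1) = 1 / 4" by blast+
  then have "degree K = d + 1" by (intro antisym le_degree) auto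
  then show ?thesis using that Keven ode c(2) by simp
qed

text \<open>Growth of ODE solutions with s = m + 1 = (d + 1)/2. Evenness removes the coefficient of
  K just below the leading one, so K - z^(d+1)/4 has degree at most d - 1 = 2s - 2, as an error term
  O(1/z^2) demands.\<close>

lemma Phi_decay:
  obtains M where "M \<ge> 0" "\<And>z. norm z \<ge> 1 \<Longrightarrow> norm z ^ (m + 1) * norm (\<Phi> z) \<le> M * exp (\<bar>Im z\<bar> / 2)"
proof -
  obtain R :: "complex poly" where R: "even_poly R" "degree R \<le> d - 1"
    "\<And>z. z ^ (d + 1) * (deriv \<Phi> z * \<Phi> (- z) + deriv \<Phi> (- z) * \<Phi> z) - 2 * poly R z * \<Phi> z * \<Phi> (- z) = - 2 * a"
    using functional_identity by metis
  obtain K :: "complex poly" where K: "even_poly K" "degree K = d + 1" "lead_coeff K = 1 / 4"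
    "\<And>z. z ^ (d + 1) * deriv (deriv \<Phi>) z + (of_nat (d + 1) * z ^ d - 2 * poly R z) * deriv \<Phi> z
      + (poly K z - poly (pderiv R) z) * \<Phi> z = 0"
    using differential_equation[OF R] by metis
  have e: "2 * (m + 1) = d + 1" by (simp add: dm)
  have "degree (K - monom (1 / 4) (d + 1)) \<le> d - 1"
  proof (rule even_poly_degree_le)
    show "even_poly (K - monom (1 / 4) (d + 1))"
      using K(1) odd_d by (simp add: even_poly_def poly_monom)
    show "degree (K - monom (1 / 4) (d + 1)) \<le> d + 1"
      using K(2) by (intro degree_diff_le degree_monom_le) simp
    show "coeff (K - monom (1 / 4) (d + 1)) (d + 1) = 0"
      using K(2,3) by simp
  qed (rule odd_d)
  then have deg: "degree (K - monom (1 / 4) (2 * (m + 1))) \<le> 2 * (m + 1) - 2" "degree R \<le> 2 * (m + 1) - 2"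
    unfolding e using R(2) by simp_all
  have "z ^ (2 * (m + 1)) * deriv (deriv \<Phi>) z + (of_nat (2 * (m + 1)) * z ^ (2 * (m + 1) - 1) - 2 * poly R z) * deriv \<Phi> z
      + (poly K z - poly (pderiv R) z) * \<Phi> z = 0" for z
    unfolding e add_diff_cancel_right' by (rule K(4))
  note ode = this
  show ?thesis
  proof (rule ode_solution_growth[OF Phi_holomorphic _ ode deg(2,1)])
    show "1 \<le> m + 1" by simp
  qed (rule that)
qed

section \<open>Exact exponential type and decay on the real line\<close>

lemma Phi_exp_type_upper: "exp_type_at_most \<Phi> (1 / 2)"
  unfolding exp_type_at_most_def
proof (intro allI impI)
  fix \<epsilon> :: real assume e: "\<epsilon> > 0"
  obtain M where M: "M \<ge> 0" "\<And>z. norm z \<ge> 1 \<Longrightarrow> norm z ^ (m + 1) * norm (\<Phi> z) \<le> M * exp (\<bar>Im z\<bar> / 2)"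
    by (rule Phi_decay, rule that)
  have "continuous_on (cball 0 1) \<Phi>"
    by (rule holomorphic_on_imp_continuous_on[OF holomorphic_on_subset[OF Phi_holomorphic]]) simp
  then have "bounded (\<Phi> ` cball 0 1)"
    by (intro compact_imp_bounded compact_continuous_image) auto
  then obtain B where B: "\<And>z. norm z \<le> 1 \<Longrightarrow> norm (\<Phi> z) \<le> B"
    unfolding bounded_iff by fastforce
  have B0: "B \<ge> 0" using order_trans[OF norm_ge_zero B[of 0]] by simp
  have "norm (\<Phi> z) \<le> (M + B) * exp ((1 / 2 + \<epsilon>) * norm z)" for z
  proof (cases "norm z \<le> 1")
    case True
    have "norm (\<Phi> z) \<le> B * 1" using B[OF True] by simp
    also have "\<dots> \<le> (M + B) * exp ((1 / 2 + \<epsilon>) * norm z)"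
      using B0 M(1) e by (intro mult_mono) auto
    finally show ?thesis .
  next
    case False
    have "1 * norm (\<Phi> z) \<le> norm z ^ (m + 1) * norm (\<Phi> z)"
      using False by (intro mult_right_mono one_le_power) auto
    also have "\<dots> \<le> M * exp (\<bar>Im z\<bar> / 2)" using M(2)[of z] False by simp
    also have "\<dots> \<le> (M + B) * exp ((1 / 2 + \<epsilon>) * norm z)"
    proof (intro mult_mono)
      have "\<bar>Im z\<bar> / 2 \<le> 1 / 2 * norm z + \<epsilon> * norm z"
        using abs_Im_le_cmod[of z] e by (intro add_increasing2) auto
      then show "exp (\<bar>Im z\<bar> / 2) \<le> exp ((1 / 2 + \<epsilon>) * norm z)" by (simp add: distrib_right)
    qed (use M(1) B0 in auto)
    finally show ?thesis by simp
  qed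
  then show "\<exists>A. \<forall>z. norm (\<Phi> z) \<le> A * exp ((1 / 2 + \<epsilon>) * norm z)" by blast
qed

text \<open>A smaller type would give |\<phi>(iy)| = O(exp(2\<sigma>y)) with 2\<sigma> < 1. But the
  logarithmic derivative of \<phi>(iy) in y tends to 1, so |\<phi>(iy)| is eventually at least a
  positive multiple of exp(cy) with c between 2\<sigma> and 1.\<close>

lemma Phi_exp_type_lower:
  assumes s: "s < 1 / 2"
  shows "\<not> exp_type_at_most \<Phi> s"
proof
  assume ty: "exp_type_at_most \<Phi> s"
  \<comment> \<open>Makes \<sigma> = s + \<epsilon> the midpoint of s and 1/2; likewise c below is
    the midpoint of 2\<sigma> and 1.\<close>
  define \<epsilon> where "\<epsilon> = 1 / 4 - s / 2"
  have \<epsilon>: "\<epsilon> > 0" "s = 1 / 2 - 2 * \<epsilon>"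
    using s by (simp_all add: \<epsilon>_def right_diff_distrib)
  define \<sigma> where "\<sigma> = s + \<epsilon>"
  have \<sigma>: "\<sigma> < 1 / 2" unfolding \<sigma>_def using \<epsilon> by linarith
  obtain A where A: "A \<ge> 0" "\<And>z. norm (\<Phi> z) \<le> A * exp (\<sigma> * norm z)"
    by (rule exp_type_at_most_nonneg[OF ty \<epsilon>(1), folded \<sigma>_def]) (rule that)
  define c where "c = \<sigma> + 1 / 2"
  have c: "c < 1" "2 * \<sigma> < c" using \<sigma> by (simp_all add: c_def)
  define f where "f = (\<lambda>y. \<phi> (\<i> * complex_of_real y))"
  \<comment> \<open>The logarithmic derivative of y \<mapsto> \<phi>(iy); its limit is i (-i) =
    1.\<close>
  define g where "g = (\<lambda>y. \<i> * (deriv \<Phi> (\<i> * of_real y) / \<Phi> (\<i> * of_real y) - deriv \<Phi> (- (\<i> * of_real y)) / \<Phi> (- (\<i> * of_real y))))"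
  have "(g \<longlongrightarrow> \<i> * - \<i>) at_top"
    unfolding g_def by (intro tendsto_mult tendsto_const log_derivative_diff_imag_axis)
  then have "((\<lambda>y. Re (g y)) \<longlongrightarrow> Re (\<i> * - \<i>)) at_top" by (rule tendsto_Re)
  then have "\<forall>\<^sub>F y in at_top. c < Re (g y)"
    using c by (intro order_tendstoD(1)) auto
  then obtain y0 where y0: "\<And>y. y \<ge> y0 \<Longrightarrow> c < Re (g y)"
    unfolding eventually_at_top_linorder by blast
  define y1 where "y1 = max y0 1"
  have df: "(f has_vector_derivative f y * g y) (at y)" if "y > 0" for y
  proof -
    have z: "Im (\<i> * of_real y) \<noteq> 0" using that by simp
    have nz: "\<Phi> (\<i> * of_real y) \<noteq> 0" "\<Phi> (- (\<i> * of_real y)) \<noteq> 0"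
      using z by (auto intro!: Phi_nonzero)
    have "(\<phi> has_field_derivative deriv \<phi> (\<i> * of_real y)) (at (\<i> * of_real y))"
      using phi_holomorphic by (simp add: holomorphic_derivI)
    then have "((\<lambda>u. \<phi> (\<i> * u)) has_field_derivative deriv \<phi> (\<i> * of_real y) * \<i>) (at (of_real y))"
      by (rule DERIV_chain2) (auto intro!: derivative_eq_intros)
    then have "(f has_vector_derivative deriv \<phi> (\<i> * of_real y) * \<i>) (at y)"
      unfolding f_def by (rule has_vector_derivative_real_field)
    moreover have "deriv \<phi> (\<i> * of_real y) * \<i> = f y * g y"
    proof -
      have gen: "(f1 * G - g1 * F) * c = (F * G) * (c * (f1 / F - g1 / G))" if "F \<noteq> 0" "G \<noteq> 0" for f1 g1 F G c :: complex
        using that by (simp add: field_simps)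
      show ?thesis
        unfolding f_def g_def phi_eq deriv_phi by (rule gen[OF nz])
    qed
    ultimately show ?thesis by simp
  qed
  define L where "L = (\<lambda>y. (norm (f y))\<^sup>2 * exp (- 2 * c * y))"
  have mono: "L y1 \<le> L y" if y: "y \<ge> y1" for y
  proof (rule DERIV_nonneg_imp_nondecreasing[OF y])
    fix x assume x: "y1 \<le> x" "x \<le> y"
    then have x0: "x > 0" "y0 \<le> x" by (auto simp: y1_def)
    have "((\<lambda>x. (norm (f x))\<^sup>2) has_real_derivative 2 * (f x \<bullet> (f x * g x))) (at x)"
      using bounded_bilinear.has_vector_derivative[OF bounded_bilinear_inner df[OF x0(1)] df[OF x0(1)]]
      by (simp add: has_real_derivative_iff_has_vector_derivative dot_square_norm[symmetric] inner_commute)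
    moreover have "f x \<bullet> (f x * g x) = (norm (f x))\<^sup>2 * Re (g x)"
      unfolding cmod_power2 by (simp add: inner_complex_def power2_eq_square algebra_simps)
    ultimately have d1: "((\<lambda>x. (norm (f x))\<^sup>2) has_real_derivative 2 * ((norm (f x))\<^sup>2 * Re (g x))) (at x)" by simp
    have d2: "((\<lambda>x. exp (- 2 * c * x)) has_real_derivative - 2 * c * exp (- 2 * c * x)) (at x)"
      by (auto intro!: derivative_eq_intros)
    have "(L has_real_derivative 2 * ((norm (f x))\<^sup>2 * Re (g x)) * exp (- 2 * c * x) + - 2 * c * exp (- 2 * c * x) * (norm (f x))\<^sup>2) (at x)"
      unfolding L_def by (rule DERIV_mult[OF d1 d2])
    moreover have "2 * ((norm (f x))\<^sup>2 * Re (g x)) * exp (- 2 * c * x) + - 2 * c * exp (- 2 * c * x) * (norm (f x))\<^sup>2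
        = 2 * (norm (f x))\<^sup>2 * exp (- 2 * c * x) * (Re (g x) - c)"
      by (simp add: algebra_simps)
    moreover have "\<dots> \<ge> 0"
      using y0[OF x0(2)] by (intro mult_nonneg_nonneg) auto
    ultimately show "\<exists>d. (L has_real_derivative d) (at x) \<and> 0 \<le> d" by metis
  qed
  have "L y1 > 0"
  proof -
    have "norm (f y1) > 0"
      unfolding f_def using phi_imag_axis_ge_1[of y1] by linarith
    then show ?thesis by (simp add: L_def)
  qed
  have up: "L y \<le> A ^ 4 * exp ((4 * \<sigma> - 2 * c) * y)" if "y \<ge> 0" for y
  proof -
    have "norm (f y) \<le> (A * exp (\<sigma> * y)) * (A * exp (\<sigma> * y))"
      unfolding f_def phi_eq norm_mult
      using A(2)[of "\<i> * of_real y"] A(2)[of "- (\<i> * of_real y)"] that A(1) by (intro mult_mono) (auto simp: norm_mult)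
    then have "(norm (f y))\<^sup>2 \<le> ((A * exp (\<sigma> * y)) * (A * exp (\<sigma> * y)))\<^sup>2"
      by (intro power_mono) auto
    also have "\<dots> = A ^ 4 * exp (4 * \<sigma> * y)"
    proof -
      have "exp (4 * \<sigma> * y) = exp (\<sigma> * y) ^ 4"
        by (simp flip: exp_of_nat_mult)
      then show ?thesis by (simp add: power2_eq_square power4_eq_xxxx mult_ac)
    qed
    finally have "L y \<le> A ^ 4 * exp (4 * \<sigma> * y) * exp (- 2 * c * y)"
      unfolding L_def by (intro mult_right_mono) auto
    also have "\<dots> = A ^ 4 * exp ((4 * \<sigma> - 2 * c) * y)"
      unfolding mult.assoc exp_add[symmetric] by (simp add: algebra_simps)
    finally show ?thesis .
  qed
  have neg: "4 * \<sigma> - 2 * c < 0" using c by simp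
  have "((\<lambda>y. A ^ 4 * exp ((4 * \<sigma> - 2 * c) * y)) \<longlongrightarrow> 0) at_top"
    using neg by real_asymp
  then have "\<forall>\<^sub>F y in at_top. A ^ 4 * exp ((4 * \<sigma> - 2 * c) * y) < L y1"
    using \<open>L y1 > 0\<close> by (rule order_tendstoD(2))
  then have "\<forall>\<^sub>F y in at_top. A ^ 4 * exp ((4 * \<sigma> - 2 * c) * y) < L y1 \<and> y \<ge> y1"
    using eventually_ge_at_top[of y1] by eventually_elim auto
  then obtain y where y: "A ^ 4 * exp ((4 * \<sigma> - 2 * c) * y) < L y1" "y \<ge> y1"
    unfolding eventually_at_top_linorder by blast
  have "y \<ge> 0" using y(2) by (simp add: y1_def)
  then show False using up[of y] mono[OF y(2)] y(1) by linarith
qed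

lemma Phi_exact_type: "has_exact_exp_type \<Phi> (1 / 2)"
  unfolding has_exact_exp_type_def using Phi_holomorphic Phi_exp_type_upper Phi_exp_type_lower by blast

lemma Phi_real_decay: "(\<lambda>x::real. norm (\<Phi> (of_real x))) \<in> O[at_infinity](\<lambda>x. \<bar>x\<bar> powr (- (real d + 1) / 2))"
proof -
  obtain M where M: "\<And>z. norm z \<ge> 1 \<Longrightarrow> norm z ^ (m + 1) * norm (\<Phi> z) \<le> M * exp (\<bar>Im z\<bar> / 2)"
    by (rule Phi_decay, rule that)
  have "norm (norm (\<Phi> (of_real x))) \<le> M * norm (\<bar>x\<bar> powr (- (real d + 1) / 2))" if x: "1 \<le> norm x" for x :: real
  proof -
    have x0: "\<bar>x\<bar> > 0" using x by simp
    have "- (real d + 1) / 2 = - real (m + 1)" by (simp add: dm)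
    then have "\<bar>x\<bar> powr (- (real d + 1) / 2) = inverse (\<bar>x\<bar> ^ (m + 1))"
      using x0 by (simp only: powr_minus powr_realpow)
    moreover have "norm (\<Phi> (of_real x)) \<le> M * inverse (\<bar>x\<bar> ^ (m + 1))"
      using M[of "of_real x"] x x0 by (simp add: field_simps)
    ultimately show ?thesis by simp
  qed
  then have "\<forall>\<^sub>F x in at_infinity. norm (norm (\<Phi> (of_real x))) \<le> M * norm (\<bar>x\<bar> powr (- (real d + 1) / 2))"
    unfolding eventually_at_infinity by blast
  then show ?thesis by (rule bigoI)
qed

text \<open>Parity removes the linear coefficient, so R - a is divisible by z^2. For d = 1 the
  degree bound makes R constant, whence Q = 0.\<close>

lemma even_polynomial_part:
  fixes R :: "complex poly"
  assumes R: "even_poly R" "degree R \<le> d - 1" "coeff R 0 = a"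
  obtains Q where "even_poly Q" "R = [:a:] + monom 1 2 * Q" "d = 1 \<longrightarrow> Q = 0" "d \<ge> 3 \<longrightarrow> degree Q \<le> d - 3"
proof -
  define Q where "Q = poly_shift 2 R"
  have Q: "coeff Q i = coeff R (i + 2)" for i by (simp add: Q_def coeff_poly_shift)
  have RQ: "R = [:a:] + monom 1 2 * Q"
  proof (rule poly_eqI)
    fix n :: nat
    consider "n = 0" | "n = 1" | i :: nat where "n = i + 2"
    proof (cases "n \<ge> 2")
      case True
      then have "n = (n - 2) + 2" by simp
      then show thesis by (rule that(3))
    next
      case False
      then have "n = 0 \<or> n = 1" by linarith
      then show thesis using that(1,2) by blast
    qed
    then show "coeff R n = coeff ([:a:] + monom 1 2 * Q) n"
      using R(3) even_poly_coeff_odd[OF R(1), of 1]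
      by cases (simp_all add: coeff_monom_mult Q coeff_pCons split: nat.split)
  qed
  have "poly Q (- z) = poly Q z" for z
  proof (cases "z = 0")
    case False
    have "poly R z = a + z\<^sup>2 * poly Q z" "poly R (- z) = a + z\<^sup>2 * poly Q (- z)"
      by (simp_all add: RQ poly_monom)
    then show ?thesis using R(1) False by (simp add: even_poly_def)
  qed simp
  then have "even_poly Q" by (simp add: even_poly_def)
  moreover have c: "coeff Q i = 0" if "i + 2 > d - 1" for i
    unfolding Q using R(2) that by (intro coeff_eq_0) simp
  then have "d = 1 \<longrightarrow> Q = 0" by (auto intro!: poly_eqI)
  moreover have "d \<ge> 3 \<longrightarrow> degree Q \<le> d - 3"
    using c by (auto intro!: degree_le)
  ultimately show ?thesis using that RQ by blast
qed

end

theorem theorem1: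
  fixes \<phi> :: "complex \<Rightarrow> complex" and \<tau> :: "nat \<Rightarrow> real" and d m :: nat
  defines "\<Phi> \<equiv> Phi \<tau>"
    and "a \<equiv> a_const TYPE('n::finite)"
    and "R \<equiv> \<lambda>Q :: complex poly. [:complex_of_real (a_const TYPE('n::finite)):] + monom 1 2 * Q"
  assumes dim: "d = CARD('n)" "d = 2 * m + 1"
    and extremal: "radial_extremal TYPE('n) \<phi>"
    and zeros_simple: "\<And>z. \<phi> z = 0 \<Longrightarrow> z \<in> \<real> \<and> deriv \<phi> z \<noteq> 0"
    and zeros_increasing: "strict_mono_on {1..} \<tau>"
    and positive_zeros: "\<tau> ` {1..} = {x. x > 0 \<and> \<phi> (complex_of_real x) = 0}"
    and product: "\<And>z. (\<lambda>n. \<Prod>k=1..n. 1 - z\<^sup>2 / (complex_of_real (\<tau> k))\<^sup>2) \<longlonglongrightarrow> \<phi> z"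
    and zeros_asymp: "\<tau> \<sim>[at_top] (\<lambda>k. pi * real k)"
  shows "(\<exists>Q.
            even_poly Q \<and>
            (\<forall>z. z ^ (d + 1) * (deriv \<Phi> z * \<Phi> (- z) + deriv \<Phi> (- z) * \<Phi> z)
                  - 2 * poly (R Q) z * \<Phi> z * \<Phi> (- z) = - 2 * complex_of_real a) \<and>
            (d = 1 \<longrightarrow> Q = 0) \<and>
            (d \<ge> 3 \<longrightarrow> degree Q \<le> d - 3) \<and>
            (\<exists>K.
               even_poly K \<and>
               (\<forall>z. z ^ (d + 1) * deriv (deriv \<Phi>) z
                     + (of_nat (d + 1) * z ^ d - 2 * poly (R Q) z) * deriv \<Phi> z
                     + (poly K z - poly (pderiv (R Q)) z) * \<Phi> z = 0) \<and>
               degree K = d + 1 \<and> lead_coeff K = 1 / 4)) \<and>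
         has_exact_exp_type \<Phi> (1 / 2) \<and>
         (\<lambda>x::real. norm (\<Phi> (complex_of_real x)))
           \<in> O[at_infinity](\<lambda>x. \<bar>x\<bar> powr (- (real d + 1) / 2))"
proof -
  interpret E: extremal_zeros \<phi> "TYPE('n)" d \<tau> m
  proof unfold_locales
    show "\<tau> k > 0" if "k \<ge> 1" for k
      using positive_zeros that by blast
  qed (use assms in auto)
  obtain R0 :: "complex poly" where R0: "even_poly R0" "degree R0 \<le> d - 1" "coeff R0 0 = E.a"
    "\<And>z. z ^ (d + 1) * (deriv (Phi \<tau>) z * Phi \<tau> (- z) + deriv (Phi \<tau>) (- z) * Phi \<tau> z) - 2 * poly R0 z * Phi \<tau> z * Phi \<tau> (- z) = - 2 * E.a"
    using E.functional_identity by blast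
  obtain Q where Q: "even_poly Q" "R0 = [:E.a:] + monom 1 2 * Q" "d = 1 \<longrightarrow> Q = 0" "d \<ge> 3 \<longrightarrow> degree Q \<le> d - 3"
    using E.even_polynomial_part[OF R0(1-3)] by blast
  have RQ: "R Q = R0" by (simp add: R_def Q(2) E.a_def)
  obtain K :: "complex poly" where K: "even_poly K" "degree K = d + 1" "lead_coeff K = 1 / 4"
    "\<And>z. z ^ (d + 1) * deriv (deriv (Phi \<tau>)) z + (of_nat (d + 1) * z ^ d - 2 * poly R0 z) * deriv (Phi \<tau>) z
      + (poly K z - poly (pderiv R0) z) * Phi \<tau> z = 0"
    using E.differential_equation[OF R0(1,2,4)] by blast
  have a: "complex_of_real a = E.a" by (simp add: a_def E.a_def)
  have "\<exists>K. even_poly K \<and>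
      (\<forall>z. z ^ (d + 1) * deriv (deriv \<Phi>) z + (of_nat (d + 1) * z ^ d - 2 * poly (R Q) z) * deriv \<Phi> z
        + (poly K z - poly (pderiv (R Q)) z) * \<Phi> z = 0) \<and> degree K = d + 1 \<and> lead_coeff K = 1 / 4"
    unfolding RQ \<Phi>_def by (intro exI[of _ K] conjI allI K)
  moreover have "z ^ (d + 1) * (deriv \<Phi> z * \<Phi> (- z) + deriv \<Phi> (- z) * \<Phi> z)
      - 2 * poly (R Q) z * \<Phi> z * \<Phi> (- z) = - 2 * complex_of_real a" for z
    unfolding RQ \<Phi>_def a by (rule R0(4))
  moreover have "has_exact_exp_type \<Phi> (1 / 2)"
    "(\<lambda>x::real. norm (\<Phi> (complex_of_real x))) \<in> O[at_infinity](\<lambda>x. \<bar>x\<bar> powr (- (real d + 1) / 2))"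
    unfolding \<Phi>_def by (fact E.Phi_exact_type E.Phi_real_decay)+
  ultimately show ?thesis
    using Q(1,3,4) by blast
qed

end
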